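(* Let $\nu=\frac12$ (so $\alpha=\frac23$), and let $(e^{\boldsymbol u},e^p):=(\boldsymbol u-\boldsymbol u_{h,\Lambda},\,p-p_{h,\Lambda})$ be the error in the stochastic Galerkin mixed finite element approximation of the weak solution $(\boldsymbol u,p)$ of the parametric Stokes problem. Assume that $\boldsymbol e_0^{\boldsymbol u}\ne0$ and $\boldsymbol e_0^{\boldsymbol u,*}\neq0$, and let $\Theta\in[0,1)$ be a constant with $$|\boldsymbol e_0^{\boldsymbol u,*}|_{\bar a_0}\le|\boldsymbol e_0^{\boldsymbol u}|_{\bar a_0}\le\tfrac1{\sqrt{1-\Theta^2}}|\boldsymbol e_0^{\boldsymbol u,*}|_{\bar a_0}$$ (such a constant exists). Then $$C_6\,\eta\le|||(e^{\boldsymbol u},e^p)|||_S\le\frac{C_7}{\sqrt{1-\gamma^2}\sqrt{1-\Theta^2}}\,\eta,$$ where $|||(\boldsymbol v,q)|||_S^2:=\alpha\|\nabla\boldsymbol v\|^2_{\boldsymbol{\mathcal W}}+\alpha^{-1}\|q\|^2_{\mathcal W}$, $\eta=(\eta_1^2+\eta_2^2)^{1/2}$, $C_6:=\big(\sqrt2\,(E_{\max}+\sqrt d)\big)^{-1}$, $C_7:=C_2/(C_1E_{\min})$, $C_1:=\frac12\min\{C_K,\frac{C_D^2}{E_{\max}^2},\frac1{E_{\max}^2}\}$, $C_2:=\sqrt{2(E_{\max}^2+C_D^2+1)}/E_{\max}$, and $\gamma:=\max\{\gamma_1,\gamma_2\}\in[0,1)$ with $\gamma_1,\gamma_2$ the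 CBS constants.
   Context: **Data.** $d\in\{2,3\}$; $D\subset\mathbb R^d$ is a bounded Lipschitz polygon ($d=2$) or polyhedron ($d=3$) with $\partial D=\partial D_D\cup\partial D_N$, $\partial D_D\cap\partial D_N=\emptyset$, both parts nonempty. $\Gamma=\prod_{k=1}^\infty[-1,1]$ carries the product probability measure $\pi=\prod_k\pi_k$, each $\pi_k$ being the uniform probability measure on $[-1,1]$. The Young's modulus is $E(\boldsymbol x,\boldsymbol y)=e_0(\boldsymbol x)+\sum_{k=1}^\infty e_k(\boldsymbol x)y_k$, with $E\in L^\infty(D\times\Gamma)$, $0<E_{\min}\le E\le E_{\max}<\infty$ a.e. in $D\times\Gamma$, $0<e_0^{\min}\le e_0\le e_0^{\max}<\infty$ a.e. in $D$, and $\frac1{e_0^{\min}}\sum_{k\ge1}\|e_k\|_{L^\infty(D)}<1$. $\alpha:=\frac1{1+\nu}$ and $\boldsymbol f\in (L^2(D))^d$. **Spaces and forms.** $\boldsymbol H^1_{E_0}(D)=\{\boldsymbol v\in H^1(D;\mathbb R^d):\boldsymbol v|_{\partial D_D}=\boldsymbol 0\}$, $\boldsymbol{\mathcal V}=L^2_\pi(\Gamma,\boldsymbol H^1_{E_0}(D))$, $\mathcal W=L^2_\pi(\Gamma,L^2(D))$; $\|\cdot\|_{\mathcal W}$ is the norm of $\mathcal W$ and $\|\nabla\boldsymbol v\|_{\boldsymbol{\mathcal W}}:=\big(\int_\Gamma\int_D|\nabla\boldsymbol v|^2\,d\boldsymbol x\,d\pi\big)^{1/2}$. With $\boldsymbol\varepsilon(\boldsymbol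 v)=\frac12(\nabla\boldsymbol v+(\nabla\boldsymbol v)^\top)$: $a(\boldsymbol u,\boldsymbol v)=\alpha\int_\Gamma\int_D E\,\boldsymbol\varepsilon(\boldsymbol u):\boldsymbol\varepsilon(\boldsymbol v)$, $b(\boldsymbol v,p)=-\int_\Gamma\int_D p\,\nabla\cdot\boldsymbol v$, $f(\boldsymbol v)=\int_\Gamma\int_D\boldsymbol f\cdot\boldsymbol v$ (integrals with respect to $d\boldsymbol x\,d\pi(\boldsymbol y)$), and $\bar a_0(\boldsymbol u,\boldsymbol v):=\alpha\int_\Gamma\int_D\nabla\boldsymbol u:\nabla\boldsymbol v$ with $|\boldsymbol v|_{\bar a_0}:=\bar a_0(\boldsymbol v,\boldsymbol v)^{1/2}$. **Weak Stokes problem.** The strong form is $-\nabla\cdot\boldsymbol\sigma=\boldsymbol f$, $\nabla\cdot\boldsymbol u=0$ in $D\times\Gamma$, $\boldsymbol u=\boldsymbol0$ on $\partial D_D$, $\boldsymbol\sigma\boldsymbol n=\boldsymbol 0$ on $\partial D_N$, with $\boldsymbol\sigma=\alpha E\boldsymbol\varepsilon(\boldsymbol u)-p\boldsymbol I$. Weak form: $(\boldsymbol u,p)\in\boldsymbol{\mathcal V}\times\mathcal W$ solves $a(\boldsymbol u,\boldsymbol v)+b(\boldsymbol v,p)=f(\boldsymbol v)$ for all $\boldsymbol v\in\boldsymbol{\mathcal V}$ and $b(\boldsymbol u,q)=0$ for all $q\in\mathcal W$. **Constants.** $C_K\in(0,1]$ is the Korn constant, i.e. $\int_D\boldsymbol\varepsilon(\boldsymbol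 v):\boldsymbol\varepsilon(\boldsymbol v)\ge C_K\|\nabla\boldsymbol v\|_{L^2(D)}^2$ for $\boldsymbol v\in\boldsymbol H^1_{E_0}(D)$; $C_D>0$ is the inf-sup constant: $\sup_{0\ne\boldsymbol v\in\boldsymbol{\mathcal V}} b(\boldsymbol v,q)/\|\nabla\boldsymbol v\|_{\boldsymbol{\mathcal W}}\ge C_D\|q\|_{\mathcal W}$ for all $q\in\mathcal W$. **Discretisation.** $\boldsymbol V_h\subset\boldsymbol H^1_{E_0}(D)$ and $W_h\subset L^2(D)$ are finite-dimensional (conforming finite element) spaces satisfying, with some $\gamma_h>0$, $\sup_{0\ne\boldsymbol v\in\boldsymbol V_h}\frac{\int_D q\,\nabla\cdot\boldsymbol v}{\|\nabla\boldsymbol v\|_{L^2(D)}}\ge\gamma_h\|q\|_{L^2(D)}$ for all $q\in W_h$. $\mathfrak I$ is the set of finitely supported sequences in $\mathbb N_0^{\mathbb N}$; $\psi_{\boldsymbol\alpha}(\boldsymbol y)=\prod_i\psi_{\alpha_i}(y_i)$, where $\psi_n$ is the univariate Legendre polynomial of degree $n$ on $[-1,1]$ normalised in $L^2$ for the uniform probability measure ($\psi_0=1$). For a finite $\Lambda\subset\mathfrak I$, $S_\Lambda=\mathrm{span}\{\psi_{\boldsymbol\alpha}:\boldsymbol\alpha\in\Lambda\}$, $\boldsymbol V_{h,\Lambda}=\boldsymbol V_h\otimes S_\Lambda$, $W_{h,\Lambda}=W_h\otimes S_\Lambda$. The approximation $(\boldsymbol u_{h,\Lambda},p_{h,\Lambda})\in\boldsymbol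 V_{h,\Lambda}\times W_{h,\Lambda}$ solves the weak equations with test functions restricted to $\boldsymbol V_{h,\Lambda}\times W_{h,\Lambda}$. Residual: $\mathcal R^{\boldsymbol u}(\boldsymbol v):=f(\boldsymbol v)-a(\boldsymbol u_{h,\Lambda},\boldsymbol v)-b(\boldsymbol v,p_{h,\Lambda})$ on $\boldsymbol{\mathcal V}$. **Enriched spaces and CBS constants.** $\boldsymbol V_h^*=\boldsymbol V_h\oplus\widetilde{\boldsymbol V}_h$, $W_h^*=W_h\oplus\widetilde W_h$ with finite-dimensional $\widetilde{\boldsymbol V}_h\subset\boldsymbol H^1_{E_0}(D)$, $\widetilde W_h\subset L^2(D)$, $\boldsymbol V_h\cap\widetilde{\boldsymbol V}_h=\{\boldsymbol0\}$, $W_h\cap\widetilde W_h=\{0\}$, the pair $\boldsymbol V_h^*,W_h^*$ being inf-sup stable in the same sense as $\boldsymbol V_h,W_h$. The CBS constants $\gamma_1,\gamma_2\in[0,1)$ satisfy $|\int_D\nabla\boldsymbol v:\nabla\widetilde{\boldsymbol v}|\le\gamma_1\|\nabla\boldsymbol v\|_{L^2(D)}\|\nabla\widetilde{\boldsymbol v}\|_{L^2(D)}$ for $\boldsymbol v\in\boldsymbol V_h$, $\widetilde{\boldsymbol v}\in\widetilde{\boldsymbol V}_h$, and $|\int_D q\,\tilde q|\le\gamma_2\|q\|_{L^2(D)}\|\tilde q\|_{L^2(D)}$ for $q\in W_h$, $\tilde q\in\widetilde W_h$. $\mathfrak Q\subset\mathfrak I$ is a finite index set with $\Lambda\cap\mathfrak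 Q=\emptyset$. Put $\widetilde{\boldsymbol V}_{h,\Lambda}=\widetilde{\boldsymbol V}_h\otimes S_\Lambda$, $\boldsymbol V_{h,\mathfrak Q}=\boldsymbol V_h\otimes S_{\mathfrak Q}$ and $\boldsymbol V^*_{h,\Lambda}:=\boldsymbol V_{h,\Lambda}\oplus\widetilde{\boldsymbol V}_{h,\Lambda}\oplus\boldsymbol V_{h,\mathfrak Q}$. **Estimators.** $\boldsymbol e_0^{\boldsymbol u}\in\boldsymbol{\mathcal V}$, $\boldsymbol e_0^{\boldsymbol u,*}\in\boldsymbol V^*_{h,\Lambda}$, $\tilde{\boldsymbol e}^{\boldsymbol u}_{h,\Lambda}\in\widetilde{\boldsymbol V}_{h,\Lambda}$ and $\boldsymbol e^{\boldsymbol u}_{h,\mathfrak Q}\in\boldsymbol V_{h,\mathfrak Q}$ each solve $\bar a_0(\cdot,\boldsymbol v)=\mathcal R^{\boldsymbol u}(\boldsymbol v)$ for all $\boldsymbol v$ in the respective space. Then $$\eta_1:=\big(|\tilde{\boldsymbol e}^{\boldsymbol u}_{h,\Lambda}|^2_{\bar a_0}+|\boldsymbol e^{\boldsymbol u}_{h,\mathfrak Q}|^2_{\bar a_0}\big)^{1/2},\qquad \eta_2:=\alpha^{1/2}\|\nabla\cdot\boldsymbol u_{h,\Lambda}\|_{\mathcal W}.$$ *)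

theory Defs
  imports
    "HOL-Analysis.Analysis"
    "HOL-Probability.Essential_Supremum"
    "HOL-Computational_Algebra.Polynomial"
begin

text \<open>
  Elements of \<open>L\<^sup>2\<close>-type spaces are represented by functions, and two functions denote the same
  element if they agree almost everywhere. A field on the spatial domain is a function of
  \<open>x\<close>; a parametric field is a function \<open>y \<mapsto> (x \<mapsto> v y x)\<close>, i.e. parameter first.
\<close>


subsection \<open>Spatial domains\<close>

definition lipschitz_domain :: "'a::euclidean_space set \<Rightarrow> bool" where
  "lipschitz_domain D \<longleftrightarrow> D \<noteq> {} \<and> open D \<and> connected D \<and> bounded D \<and>
     (\<forall>x\<in>frontier D. \<exists>n g L r. norm n = 1 \<and> r > 0 \<and>
        L-lipschitz_on {w. w \<bullet> n = 0} (g :: 'a \<Rightarrow> real) \<and>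
        (\<forall>z\<in>ball x r. z \<in> D \<longleftrightarrow> z \<bullet> n < g (z - (z \<bullet> n) *\<^sub>R n)))"

text \<open>Bounded Lipschitz polygons and polyhedra; they need not be convex.\<close>

definition lipschitz_polyhedron :: "'a::euclidean_space set \<Rightarrow> bool" where
  "lipschitz_polyhedron D \<longleftrightarrow> lipschitz_domain D \<and>
     (\<exists>F. finite F \<and> (\<forall>P\<in>F. polytope P) \<and> closure D = \<Union>F)"

text \<open>
  Surface measure is the Hausdorff measure of codimension one on the Borel sets, where the
  Hausdorff outer measure is countably additive by Caratheodory's criterion for metric outer
  measures. The factor \<open>unit_ball_vol s / 2 ^ s\<close> is the usual normalisation.
\<close>

definition hausdorff_outer :: "nat \<Rightarrow> 'a::metric_space set \<Rightarrow> ennreal" where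
  "hausdorff_outer s A = (SUP \<delta>\<in>{0<..}.
     INF C\<in>{C :: nat \<Rightarrow> 'a set. A \<subseteq> (\<Union>i. C i) \<and> (\<forall>i. bounded (C i) \<and> diameter (C i) \<le> \<delta>)}.
       \<Sum>i. ennreal (unit_ball_vol (real s) * (diameter (C i) / 2) ^ s))"

definition surface_measure :: "(real ^ 'd) measure" where
  "surface_measure = measure_of UNIV (sets borel) (hausdorff_outer (CARD('d) - 1))"


subsection \<open>Lebesgue and Sobolev spaces on \<open>D\<close>\<close>

definition l2_space :: "(real ^ 'd) set \<Rightarrow> (real ^ 'd \<Rightarrow> 'b::euclidean_space) set" where
  "l2_space D = {v. v \<in> borel_measurable (lebesgue_on D) \<and>
                    integrable (lebesgue_on D) (\<lambda>x. (norm (v x))\<^sup>2)}"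

definition l2_norm :: "(real ^ 'd) set \<Rightarrow> (real ^ 'd \<Rightarrow> 'b::euclidean_space) \<Rightarrow> real" where
  "l2_norm D v = sqrt (LINT x|lebesgue_on D. (norm (v x))\<^sup>2)"

text \<open>
  \<open>G x $ i $ j\<close> is the weak derivative of the \<open>i\<close>-th component in direction \<open>j\<close>. Test functions are
  \<open>C\<^sup>1\<close> with compact support, which is equivalent to testing with \<open>C\<^sup>\<infinity>\<close> functions.
\<close>

definition is_weak_grad ::
    "(real ^ 'd) set \<Rightarrow> (real ^ 'd \<Rightarrow> real ^ 'd) \<Rightarrow> (real ^ 'd \<Rightarrow> real ^ 'd ^ 'd) \<Rightarrow> bool" where
  "is_weak_grad D v G \<longleftrightarrow>
     (\<forall>\<phi> \<phi>' K. (\<forall>x. GDERIV \<phi> x :> \<phi>' x) \<longrightarrow> continuous_on UNIV \<phi>' \<longrightarrow>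
        compact K \<longrightarrow> K \<subseteq> D \<longrightarrow> (\<forall>x. x \<notin> K \<longrightarrow> \<phi> x = 0) \<longrightarrow>
        (\<forall>i j. (LINT x|lebesgue_on D. v x $ i * \<phi>' x $ j)
             = - (LINT x|lebesgue_on D. G x $ i $ j * \<phi> x)))"

definition h1_space :: "(real ^ 'd) set \<Rightarrow> (real ^ 'd \<Rightarrow> real ^ 'd) set" where
  "h1_space D = {v. v \<in> l2_space D \<and> (\<exists>G. G \<in> l2_space D \<and> is_weak_grad D v G)}"

definition weak_grad :: "(real ^ 'd) set \<Rightarrow> (real ^ 'd \<Rightarrow> real ^ 'd) \<Rightarrow> real ^ 'd \<Rightarrow> real ^ 'd ^ 'd" where
  "weak_grad D v = (SOME G. G \<in> l2_space D \<and> is_weak_grad D v G)"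

definition strain :: "(real ^ 'd) set \<Rightarrow> (real ^ 'd \<Rightarrow> real ^ 'd) \<Rightarrow> real ^ 'd \<Rightarrow> real ^ 'd ^ 'd" where
  "strain D v x = (1 / 2) *\<^sub>R (weak_grad D v x + transpose (weak_grad D v x))"

definition weak_div :: "(real ^ 'd) set \<Rightarrow> (real ^ 'd \<Rightarrow> real ^ 'd) \<Rightarrow> real ^ 'd \<Rightarrow> real" where
  "weak_div D v x = trace (weak_grad D v x)"

definition h1_norm :: "(real ^ 'd) set \<Rightarrow> (real ^ 'd \<Rightarrow> real ^ 'd) \<Rightarrow> real" where
  "h1_norm D v = sqrt ((l2_norm D v)\<^sup>2 + (l2_norm D (weak_grad D v))\<^sup>2)"

text \<open>
  The trace operator is the continuous extension, from \<open>H\<^sup>1(D)\<close> to \<open>L\<^sup>2(\<partial>D)\<close>, of the restriction to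
  \<open>\<partial>D\<close> of functions that are continuous up to the boundary. \<open>is_trace D v g\<close> is its graph.
\<close>

definition is_trace ::
    "(real ^ 'd) set \<Rightarrow> (real ^ 'd \<Rightarrow> real ^ 'd) \<Rightarrow> (real ^ 'd \<Rightarrow> real ^ 'd) \<Rightarrow> bool" where
  "is_trace D v g \<longleftrightarrow> g \<in> borel_measurable borel \<and>
     (\<integral>\<^sup>+x\<in>frontier D. ennreal ((norm (g x))\<^sup>2) \<partial>surface_measure) < \<infinity> \<and>
     (\<exists>\<phi> :: nat \<Rightarrow> real ^ 'd \<Rightarrow> real ^ 'd.
        (\<forall>n. \<phi> n \<in> h1_space D \<and> continuous_on (closure D) (\<phi> n)) \<and>
        (\<lambda>n. h1_norm D (\<lambda>x. \<phi> n x - v x)) \<longlonglongrightarrow> 0 \<and>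
        (\<lambda>n. \<integral>\<^sup>+x\<in>frontier D. ennreal ((norm (\<phi> n x - g x))\<^sup>2) \<partial>surface_measure) \<longlonglongrightarrow> 0)"

definition h1_E0 :: "(real ^ 'd) set \<Rightarrow> (real ^ 'd) set \<Rightarrow> (real ^ 'd \<Rightarrow> real ^ 'd) set" where
  "h1_E0 D dirichlet = {v \<in> h1_space D.
     \<exists>g. is_trace D v g \<and> (AE x in surface_measure. x \<in> dirichlet \<longrightarrow> g x = 0)}"


subsection \<open>Parameter domain and Bochner spaces\<close>

text \<open>
  The coordinate \<open>y k\<close>, \<open>k \<ge> 0\<close>, of the product space is the parameter with number \<open>k + 1\<close>.
\<close>

definition param_measure :: "(nat \<Rightarrow> real) measure" where
  "param_measure =
     (\<Pi>\<^sub>M k\<in>UNIV. uniform_measure (restrict_space lborel {-1..1}) {-1..1})"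

text \<open>
  Square-integrable strongly measurable functions with values in the space \<open>X\<close> normed by \<open>N\<close>. Each
  class contains a representative that is a limit of simple functions at every point, not only
  almost everywhere.
\<close>

definition bochner_L2 :: "'y measure \<Rightarrow> ('x \<Rightarrow> 'b::real_vector) set \<Rightarrow> (('x \<Rightarrow> 'b) \<Rightarrow> real) \<Rightarrow>
    ('y \<Rightarrow> 'x \<Rightarrow> 'b) set" where
  "bochner_L2 P X N = {v. (\<forall>y\<in>space P. v y \<in> X) \<and>
     (\<exists>s. (\<forall>n :: nat. simple_function P (s n) \<and> s n ` space P \<subseteq> X) \<and>
          (\<forall>y\<in>space P. (\<lambda>n. N (\<lambda>x. s n y x - v y x)) \<longlonglongrightarrow> 0)) \<and>
     integrable P (\<lambda>y. (N (v y))\<^sup>2)}"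

definition space_V :: "(real ^ 'd) set \<Rightarrow> (real ^ 'd) set \<Rightarrow>
    ((nat \<Rightarrow> real) \<Rightarrow> real ^ 'd \<Rightarrow> real ^ 'd) set" where
  "space_V D dirichlet = bochner_L2 param_measure (h1_E0 D dirichlet) (h1_norm D)"

definition space_W :: "(real ^ 'd) set \<Rightarrow> ((nat \<Rightarrow> real) \<Rightarrow> real ^ 'd \<Rightarrow> real) set" where
  "space_W D = bochner_L2 param_measure (l2_space D) (l2_norm D)"

definition zero_field :: "(real ^ 'd) set \<Rightarrow> ((nat \<Rightarrow> real) \<Rightarrow> real ^ 'd \<Rightarrow> 'b::euclidean_space) \<Rightarrow> bool" where
  "zero_field D v \<longleftrightarrow> (AE y in param_measure. AE x in lebesgue_on D. v y x = 0)"

definition norm_W :: "(real ^ 'd) set \<Rightarrow> ((nat \<Rightarrow> real) \<Rightarrow> real ^ 'd \<Rightarrow> 'b::euclidean_space) \<Rightarrow> real" where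
  "norm_W D q = sqrt (LINT y|param_measure. LINT x|lebesgue_on D. (norm (q y x))\<^sup>2)"

definition grad_norm_W :: "(real ^ 'd) set \<Rightarrow> ((nat \<Rightarrow> real) \<Rightarrow> real ^ 'd \<Rightarrow> real ^ 'd) \<Rightarrow> real" where
  "grad_norm_W D v = norm_W D (\<lambda>y. weak_grad D (v y))"


subsection \<open>Forms, residual and weak problems\<close>

text \<open>On matrices, \<open>\<bullet>\<close> is the Frobenius product.\<close>

definition young :: "(real ^ 'd \<Rightarrow> real) \<Rightarrow> (nat \<Rightarrow> real ^ 'd \<Rightarrow> real) \<Rightarrow>
    real ^ 'd \<Rightarrow> (nat \<Rightarrow> real) \<Rightarrow> real" where
  "young e0 e x y = e0 x + (\<Sum>k. e k x * y k)"

definition form_a where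
  "form_a D \<alpha> E u v = \<alpha> * (LINT y|param_measure. LINT x|lebesgue_on D.
     E x y * (strain D (u y) x \<bullet> strain D (v y) x))"

definition form_b where
  "form_b D v p = - (LINT y|param_measure. LINT x|lebesgue_on D. p y x * weak_div D (v y) x)"

definition load where
  "load D f v = (LINT y|param_measure. LINT x|lebesgue_on D. f x \<bullet> v y x)"

definition form_a0 where
  "form_a0 D \<alpha> u v = \<alpha> * (LINT y|param_measure. LINT x|lebesgue_on D.
     weak_grad D (u y) x \<bullet> weak_grad D (v y) x)"

definition norm_a0 where
  "norm_a0 D \<alpha> v = sqrt (form_a0 D \<alpha> v v)"

text \<open>Both the continuous and the Galerkin problem, depending on the spaces \<open>V\<close> and \<open>W\<close>.\<close>

definition stokes_solution where
  "stokes_solution D \<alpha> E f V W u p \<longleftrightarrow> u \<in> V \<and> p \<in> W \<and>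
     (\<forall>v\<in>V. form_a D \<alpha> E u v + form_b D v p = load D f v) \<and>
     (\<forall>q\<in>W. form_b D u q = 0)"

definition residual_u where
  "residual_u D \<alpha> E f uh ph v = load D f v - form_a D \<alpha> E uh v - form_b D v ph"

definition residual_solution where
  "residual_solution D \<alpha> R X z \<longleftrightarrow> z \<in> X \<and> (\<forall>v\<in>X. form_a0 D \<alpha> z v = R v)"

definition norm_S where
  "norm_S D \<alpha> v q = sqrt (\<alpha> * (grad_norm_W D v)\<^sup>2 + inverse \<alpha> * (norm_W D q)\<^sup>2)"

text \<open>
  The constants are required to be valid in the respective inequality, not to be optimal.
\<close>

definition korn_const where
  "korn_const D dirichlet C \<longleftrightarrow> 0 < C \<and> C \<le> 1 \<and> (\<forall>v\<in>h1_E0 D dirichlet.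
     (LINT x|lebesgue_on D. strain D v x \<bullet> strain D v x) \<ge> C * (l2_norm D (weak_grad D v))\<^sup>2)"

definition inf_sup_const where
  "inf_sup_const D dirichlet C \<longleftrightarrow> 0 < C \<and> (\<forall>q\<in>space_W D.
     (SUP v\<in>{v \<in> space_V D dirichlet. \<not> zero_field D v}. ereal (form_b D v q / grad_norm_W D v))
       \<ge> ereal (C * norm_W D q))"


subsection \<open>Discrete spaces\<close>

definition finite_dim_space :: "('x \<Rightarrow> 'b::real_vector) set \<Rightarrow> bool" where
  "finite_dim_space V \<longleftrightarrow>
     (\<exists>(n :: nat) b. V = {\<lambda>x. \<Sum>i<n. c i *\<^sub>R b i x | c :: nat \<Rightarrow> real. True})"

definition discrete_inf_sup ::
    "(real ^ 'd) set \<Rightarrow> (real ^ 'd \<Rightarrow> real ^ 'd) set \<Rightarrow> (real ^ 'd \<Rightarrow> real) set \<Rightarrow> bool" where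
  "discrete_inf_sup D V W \<longleftrightarrow> (\<exists>\<gamma>>0. \<forall>q\<in>W.
     (SUP v\<in>{v \<in> V. \<not> (AE x in lebesgue_on D. v x = 0)}.
        ereal ((LINT x|lebesgue_on D. q x * weak_div D v x) / l2_norm D (weak_grad D v)))
       \<ge> ereal (\<gamma> * l2_norm D q))"

definition trivial_intersection ::
    "(real ^ 'd) set \<Rightarrow> (real ^ 'd \<Rightarrow> 'b::euclidean_space) set \<Rightarrow> (real ^ 'd \<Rightarrow> 'b) set \<Rightarrow> bool" where
  "trivial_intersection D V V' \<longleftrightarrow> (\<forall>v\<in>V. \<forall>v'\<in>V'.
     (AE x in lebesgue_on D. v x = v' x) \<longrightarrow> (AE x in lebesgue_on D. v x = 0))"

definition sum_space :: "('x \<Rightarrow> 'b::real_vector) set \<Rightarrow> ('x \<Rightarrow> 'b) set \<Rightarrow> ('x \<Rightarrow> 'b) set" where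
  "sum_space V V' = {\<lambda>x. v x + v' x | v v'. v \<in> V \<and> v' \<in> V'}"

definition multi_indices :: "(nat \<Rightarrow> nat) set" where
  "multi_indices = {\<mu>. finite {i. \<mu> i \<noteq> 0}}"

text \<open>Rodrigues' formula; the factor \<open>sqrt (2 * n + 1)\<close> normalises for the uniform probability measure.\<close>

definition legendre :: "nat \<Rightarrow> real \<Rightarrow> real" where
  "legendre n t = sqrt (2 * real n + 1) *
     poly (smult (1 / (2 ^ n * fact n)) ((pderiv ^^ n) ([:-1, 0, 1:] ^ n))) t"

definition legendre_multi :: "(nat \<Rightarrow> nat) \<Rightarrow> (nat \<Rightarrow> real) \<Rightarrow> real" where
  "legendre_multi \<mu> y = (\<Prod>i\<in>{i. \<mu> i \<noteq> 0}. legendre (\<mu> i) (y i))"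

definition legendre_span :: "(nat \<Rightarrow> nat) set \<Rightarrow> ((nat \<Rightarrow> real) \<Rightarrow> real) set" where
  "legendre_span \<Lambda> = {\<lambda>y. \<Sum>\<mu>\<in>\<Lambda>. c \<mu> * legendre_multi \<mu> y | c :: (nat \<Rightarrow> nat) \<Rightarrow> real. True}"

definition tensor_space :: "('x \<Rightarrow> 'b::real_vector) set \<Rightarrow> ('y \<Rightarrow> real) set \<Rightarrow> ('y \<Rightarrow> 'x \<Rightarrow> 'b) set" where
  "tensor_space V S = {\<lambda>y x. \<Sum>i<n. s i y *\<^sub>R v i x | (n :: nat) s v.
     (\<forall>i<n. s i \<in> S) \<and> (\<forall>i<n. v i \<in> V)}"

definition enriched_V where
  "enriched_V Vh Vt \<Lambda> Q =
     {\<lambda>y x. v y x + vt y x + vq y x | v vt vq.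
        v \<in> tensor_space Vh (legendre_span \<Lambda>) \<and>
        vt \<in> tensor_space Vt (legendre_span \<Lambda>) \<and>
        vq \<in> tensor_space Vh (legendre_span Q)}"

end

theory Submission
  imports Defs "HOL-Probability.Infinite_Product_Measure"
begin

text \<open>
  The error satisfies \<open>a (e\<^sup>u, v) + b (v, e\<^sup>p) = R v\<close> on all of \<open>V\<close>. Testing with the estimator
  \<open>ut + uq\<close>, whose two parts are orthogonal because the Legendre indices are disjoint, gives the lower
  bound. For the upper bound, \<open>e\<^sup>u + \<delta> w\<close> is used as a test function, where \<open>w\<close> almost realises the
  inf-sup constant for \<open>e\<^sup>p\<close>; the dual norm of \<open>R\<close> is the energy norm of \<open>eu0\<close>, which is compared with
  that of \<open>eustar\<close> by saturation and then with \<open>\<eta>1\<close> by the strengthened Cauchy-Schwarz inequality,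
  applied for each parameter value separately.

  Linearity of \<open>weak_grad\<close> holds only almost everywhere, since \<open>weak_grad\<close> is a choice, and rests on the
  fundamental lemma of the calculus of variations. The existence of \<open>\<Theta>\<close> requires that the energy norm is
  definite.
\<close>

subsection \<open>Square-integrable functions\<close>

text \<open>The scaling is dictated by the norm of the claim: with A the energy norm of
  \<open>eu\<close> and B the norm of \<open>ep\<close> divided by sqrt \<alpha>, that norm is the
  Euclidean length of (A, B), and both bounds end in real inequalities about A and B. The supremum
  in the inf-sup condition may fail to be attained, so stability is shown for every b below the
  inf-sup constant, and b is sent to that constant only in the final real inequality. The bounds
  \<open>Emin\<close> and \<open>Emax\<close> hold for almost every pair (x, y), whereas strong
  measurability and the pairings work at each single parameter value; the decay of the coefficients
  supplies a cruder bound at every y. The crude bound secures integrability, the sharp ones enter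
  through inequalities between integrals and determine the constants. Elements of the spaces are
  functions and not classes, so norms are treated as seminorms, and each a.e. identity for weak
  gradients is absorbed by an integral over D before a form is called bilinear.\<close>

lemma psd_cauchy_schwarz:
  fixes a b c :: real
  assumes "\<And>t. 0 \<le> a + 2 * t * b + t\<^sup>2 * c" and "0 \<le> c"
  shows "\<bar>b\<bar> \<le> sqrt a * sqrt c"
proof (cases "c = 0")
  case True
  have "b = 0"
  proof (rule ccontr)
    assume "b \<noteq> 0"
    \<comment> \<open>For \<open>c = 0\<close> the quadratic is affine in t, and this t gives it the
      value -1. In the other case t = - b / c is its minimiser.\<close>
    with True assms(1)[of "- (a + 1) / (2 * b)"] show False by (simp add: field_simps)
  qed
  then show ?thesis using True by simp
next
  case False
  then have "0 < c" using assms(2) by simp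
  have "0 \<le> a - b\<^sup>2 / c"
    using assms(1)[of "- b / c"] False by (simp add: field_simps power2_eq_square)
  then have "b\<^sup>2 \<le> a * c" using \<open>0 < c\<close> by (simp add: field_simps)
  then have "sqrt (b\<^sup>2) \<le> sqrt (a * c)" by (rule real_sqrt_le_mono)
  then show ?thesis by (simp add: real_sqrt_mult)
qed

text \<open>Functions that agree a.e. remain distinct elements of \<open>X\<close>, so
  \<open>N\<close> can only be a seminorm. Nonnegativity follows from the triangle inequality for v
  and -v. The locale is shared by \<open>l2_space\<close>, \<open>h1_space\<close> and
  \<open>h1_E0\<close>, and later carries the Bochner spaces over them.\<close>

locale seminormed =
  fixes X :: "('x \<Rightarrow> 'b::real_vector) set" and N :: "('x \<Rightarrow> 'b) \<Rightarrow> real"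
  assumes zero_mem: "(\<lambda>x. 0) \<in> X"
    and add_mem: "v \<in> X \<Longrightarrow> w \<in> X \<Longrightarrow> (\<lambda>x. v x + w x) \<in> X"
    and scale_mem: "v \<in> X \<Longrightarrow> (\<lambda>x. c *\<^sub>R v x) \<in> X"
    and N_add: "v \<in> X \<Longrightarrow> w \<in> X \<Longrightarrow> N (\<lambda>x. v x + w x) \<le> N v + N w"
    and N_scale: "v \<in> X \<Longrightarrow> N (\<lambda>x. c *\<^sub>R v x) = \<bar>c\<bar> * N v"
begin

lemma uminus_mem: "v \<in> X \<Longrightarrow> (\<lambda>x. - v x) \<in> X"
  using scale_mem[of v "- 1"] by simp

lemma diff_mem: "v \<in> X \<Longrightarrow> w \<in> X \<Longrightarrow> (\<lambda>x. v x - w x) \<in> X"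
  using add_mem[of v "\<lambda>x. - w x"] uminus_mem[of w] by simp

lemma N_uminus: "v \<in> X \<Longrightarrow> N (\<lambda>x. - v x) = N v"
  using N_scale[of v "- 1"] by simp

lemma N_zero: "N (\<lambda>x. 0) = 0"
  using N_scale[OF zero_mem, of 0] by simp

lemma N_nonneg: "v \<in> X \<Longrightarrow> 0 \<le> N v"
  using N_add[of v "\<lambda>x. - v x"] uminus_mem[of v] N_uminus[of v] by (simp add: N_zero)

lemma N_minus: "v \<in> X \<Longrightarrow> w \<in> X \<Longrightarrow> N (\<lambda>x. v x - w x) = N (\<lambda>x. w x - v x)"
  using N_uminus[OF diff_mem, of v w] by simp

lemma N_triangle:
  assumes "v \<in> X" "w \<in> X" shows "N v \<le> N w + N (\<lambda>x. v x - w x)"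
  using N_add[OF assms(2) diff_mem[OF assms]] by simp

lemma N_diff_bound: "v \<in> X \<Longrightarrow> w \<in> X \<Longrightarrow> \<bar>N v - N w\<bar> \<le> N (\<lambda>x. v x - w x)"
  using N_triangle[of v w] N_triangle[of w v] N_minus[of v w] by linarith

end

definition l2_inner ::
    "(real ^ 'd) set \<Rightarrow> (real ^ 'd \<Rightarrow> 'b::euclidean_space) \<Rightarrow> (real ^ 'd \<Rightarrow> 'b) \<Rightarrow> real" where
  "l2_inner D v w = (LINT x|lebesgue_on D. v x \<bullet> w x)"

lemma l2_spaceD:
  assumes "v \<in> l2_space D"
  shows "v \<in> borel_measurable (lebesgue_on D)" "integrable (lebesgue_on D) (\<lambda>x. (norm (v x))\<^sup>2)"
  using assms by (auto simp: l2_space_def)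

lemma l2_inner_integrable:
  assumes "v \<in> l2_space D" "w \<in> l2_space D"
  shows "integrable (lebesgue_on D) (\<lambda>x. v x \<bullet> w x)"
proof (rule Bochner_Integration.integrable_bound)
  note [measurable] = l2_spaceD(1)[OF assms(1)] l2_spaceD(1)[OF assms(2)]
  show "integrable (lebesgue_on D) (\<lambda>x. (norm (v x))\<^sup>2 + (norm (w x))\<^sup>2)"
    using assms by (intro Bochner_Integration.integrable_add l2_spaceD(2))
  show "(\<lambda>x. v x \<bullet> w x) \<in> borel_measurable (lebesgue_on D)" by measurable
  have "\<bar>v x \<bullet> w x\<bar> \<le> (norm (v x))\<^sup>2 + (norm (w x))\<^sup>2" for x
  proof -
    have "\<bar>v x \<bullet> w x\<bar> \<le> norm (v x) * norm (w x)" by (rule Cauchy_Schwarz_ineq2)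
    also have "\<dots> \<le> 2 * (norm (v x) * norm (w x))" by simp
    also have "\<dots> \<le> (norm (v x))\<^sup>2 + (norm (w x))\<^sup>2"
      using sum_squares_bound[of "norm (v x)" "norm (w x)"] by simp
    finally show ?thesis .
  qed
  then show "AE x in lebesgue_on D. norm (v x \<bullet> w x) \<le> norm ((norm (v x))\<^sup>2 + (norm (w x))\<^sup>2)"
    by simp
qed

lemma l2_zero: "(\<lambda>x. 0) \<in> l2_space D"
  by (simp add: l2_space_def)

lemma l2_scale: "v \<in> l2_space D \<Longrightarrow> (\<lambda>x. c *\<^sub>R v x) \<in> l2_space D"
  by (auto simp: l2_space_def power_mult_distrib intro!: borel_measurable_scaleR)

lemma l2_add:
  assumes "v \<in> l2_space D" "w \<in> l2_space D"
  shows "(\<lambda>x. v x + w x) \<in> l2_space D"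
proof -
  note [measurable] = l2_spaceD(1)[OF assms(1)] l2_spaceD(1)[OF assms(2)]
  have "integrable (lebesgue_on D) (\<lambda>x. (norm (v x))\<^sup>2 + 2 * (v x \<bullet> w x) + (norm (w x))\<^sup>2)"
    using assms by (intro Bochner_Integration.integrable_add l2_spaceD(2) integrable_mult_right l2_inner_integrable)
  then have "integrable (lebesgue_on D) (\<lambda>x. (norm (v x + w x))\<^sup>2)"
    by (simp add: power2_norm_eq_inner inner_simps inner_commute algebra_simps)
  then show ?thesis unfolding l2_space_def by simp
qed

lemma l2_diff:
  assumes "v \<in> l2_space D" "w \<in> l2_space D"
  shows "(\<lambda>x. v x - w x) \<in> l2_space D"
  using l2_add[OF assms(1) l2_scale[OF assms(2), of "- 1"]] by simp

lemma l2_norm_nonneg: "0 \<le> l2_norm D v"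
  by (simp add: l2_norm_def)

lemma l2_norm_sq: "(l2_norm D v)\<^sup>2 = l2_inner D v v"
  by (simp add: l2_norm_def l2_inner_def power2_norm_eq_inner)

lemma l2_norm_eq_inner: "l2_norm D v = sqrt (l2_inner D v v)"
  by (simp add: l2_norm_def l2_inner_def power2_norm_eq_inner)

lemma l2_inner_commute: "l2_inner D v w = l2_inner D w v"
  by (simp add: l2_inner_def inner_commute)

lemma l2_inner_add_left:
  assumes "v \<in> l2_space D" "v' \<in> l2_space D" "w \<in> l2_space D"
  shows "l2_inner D (\<lambda>x. v x + v' x) w = l2_inner D v w + l2_inner D v' w"
  unfolding l2_inner_def inner_add_left
  by (intro Bochner_Integration.integral_add l2_inner_integrable assms)

lemma l2_inner_scale_left: "l2_inner D (\<lambda>x. c *\<^sub>R v x) w = c * l2_inner D v w"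
  unfolding l2_inner_def by simp

lemma l2_inner_add_right:
  assumes "v \<in> l2_space D" "v' \<in> l2_space D" "w \<in> l2_space D"
  shows "l2_inner D w (\<lambda>x. v x + v' x) = l2_inner D w v + l2_inner D w v'"
  unfolding l2_inner_commute[of D w] using assms by (rule l2_inner_add_left)

lemma l2_inner_scale_right: "l2_inner D w (\<lambda>x. c *\<^sub>R v x) = c * l2_inner D w v"
  unfolding l2_inner_def by simp

lemma l2_inner_cong_AE:
  assumes "v \<in> l2_space D" "v' \<in> l2_space D" "w \<in> l2_space D" "w' \<in> l2_space D"
    and "AE x in lebesgue_on D. v x = v' x" "AE x in lebesgue_on D. w x = w' x"
  shows "l2_inner D v w = l2_inner D v' w'"
  unfolding l2_inner_def
proof (rule integral_cong_AE)
  show "AE x in lebesgue_on D. v x \<bullet> w x = v' x \<bullet> w' x"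
    using assms(5,6) by eventually_elim simp
qed (use assms l2_inner_integrable in blast)+

lemma l2_norm_cong_AE:
  assumes "v \<in> l2_space D" "v' \<in> l2_space D" "AE x in lebesgue_on D. v x = v' x"
  shows "l2_norm D v = l2_norm D v'"
  unfolding l2_norm_eq_inner using l2_inner_cong_AE[of v D v' v v'] assms by simp

lemma l2_cauchy_schwarz:
  assumes "v \<in> l2_space D" "w \<in> l2_space D"
  shows "\<bar>l2_inner D v w\<bar> \<le> l2_norm D v * l2_norm D w"
  unfolding l2_norm_eq_inner
proof (rule psd_cauchy_schwarz)
  fix t :: real
  let ?z = "\<lambda>x. v x + t *\<^sub>R w x"
  have tw: "(\<lambda>x. t *\<^sub>R w x) \<in> l2_space D" using assms(2) by (rule l2_scale)
  have "0 \<le> l2_inner D ?z ?z" by (simp add: l2_inner_def)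
  also have "\<dots> = l2_inner D v ?z + t * l2_inner D w ?z"
    using assms tw l2_add[OF assms(1) tw] by (simp add: l2_inner_add_left l2_inner_scale_left)
  also have "\<dots> = l2_inner D v v + 2 * t * l2_inner D v w + t\<^sup>2 * l2_inner D w w"
    using assms tw
    by (simp add: l2_inner_add_right l2_inner_scale_right l2_inner_commute[of _ w v]
        power2_eq_square algebra_simps)
  finally show "0 \<le> l2_inner D v v + 2 * t * l2_inner D v w + t\<^sup>2 * l2_inner D w w" .
qed (simp add: l2_inner_def)

lemma l2_seminormed: "seminormed (l2_space D :: (real ^ 'd \<Rightarrow> 'b::euclidean_space) set) (l2_norm D)"
proof
  fix v w :: "real ^ 'd \<Rightarrow> 'b" and c :: real
  assume v: "v \<in> l2_space D"
  show "(\<lambda>x. c *\<^sub>R v x) \<in> l2_space D" using v by (rule l2_scale)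
  show "l2_norm D (\<lambda>x. c *\<^sub>R v x) = \<bar>c\<bar> * l2_norm D v"
    by (simp add: l2_norm_def power_mult_distrib real_sqrt_mult)
  assume w: "w \<in> l2_space D"
  show vw: "(\<lambda>x. v x + w x) \<in> l2_space D" using v w by (rule l2_add)
  have "(l2_norm D (\<lambda>x. v x + w x))\<^sup>2 = l2_inner D v v + 2 * l2_inner D v w + l2_inner D w w"
    using v w vw
    by (simp add: l2_norm_sq l2_inner_add_left l2_inner_add_right l2_inner_commute[of _ w v])
  also have "\<dots> \<le> (l2_norm D v)\<^sup>2 + 2 * (l2_norm D v * l2_norm D w) + (l2_norm D w)\<^sup>2"
    using l2_cauchy_schwarz[OF v w] by (simp add: l2_norm_sq)
  also have "\<dots> = (l2_norm D v + l2_norm D w)\<^sup>2" by (simp add: power2_sum)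
  finally show "l2_norm D (\<lambda>x. v x + w x) \<le> l2_norm D v + l2_norm D w"
    by (rule power2_le_imp_le) (simp add: l2_norm_nonneg)
qed (rule l2_zero)

lemma l2_norm_eq_0:
  assumes "v \<in> l2_space D" "l2_norm D v = 0"
  shows "AE x in lebesgue_on D. v x = 0"
proof -
  have "(LINT x|lebesgue_on D. (norm (v x))\<^sup>2) = 0" using assms(2) by (simp add: l2_norm_def)
  then have "AE x in lebesgue_on D. (norm (v x))\<^sup>2 = 0"
    using integral_nonneg_eq_0_iff_AE[of "lebesgue_on D" "\<lambda>x. (norm (v x))\<^sup>2"] l2_spaceD(2)[OF assms(1)]
    by simp
  then show ?thesis by simp
qed

lemma l2_dominated:
  assumes "v \<in> l2_space D" and m[measurable]: "w \<in> borel_measurable (lebesgue_on D)"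
    and dom: "AE x in lebesgue_on D. norm (w x) \<le> K * norm (v x)"
  shows "w \<in> l2_space D" and "0 \<le> K \<Longrightarrow> l2_norm D w \<le> K * l2_norm D v"
proof -
  have ae: "AE x in lebesgue_on D. (norm (w x))\<^sup>2 \<le> K\<^sup>2 * (norm (v x))\<^sup>2"
    using dom
  proof eventually_elim
    case (elim x)
    then show ?case using power_mono[OF elim, of 2] by (simp add: power_mult_distrib)
  qed
  have int: "integrable (lebesgue_on D) (\<lambda>x. K\<^sup>2 * (norm (v x))\<^sup>2)"
    using l2_spaceD(2)[OF assms(1)] by simp
  have int': "integrable (lebesgue_on D) (\<lambda>x. (norm (w x))\<^sup>2)"
    by (rule Bochner_Integration.integrable_bound[OF int]) (use ae in auto)
  then show "w \<in> l2_space D" by (simp add: l2_space_def)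
  assume "0 \<le> K"
  have "(LINT x|lebesgue_on D. (norm (w x))\<^sup>2) \<le> K\<^sup>2 * (LINT x|lebesgue_on D. (norm (v x))\<^sup>2)"
    using integral_mono_AE[OF int' int ae] by simp
  then have "l2_norm D w \<le> sqrt (K\<^sup>2 * (LINT x|lebesgue_on D. (norm (v x))\<^sup>2))"
    unfolding l2_norm_def by (rule real_sqrt_le_mono)
  then show "l2_norm D w \<le> K * l2_norm D v"
    using \<open>0 \<le> K\<close> by (simp add: l2_norm_def real_sqrt_mult)
qed

lemma l2_bounded_mult:
  assumes "v \<in> l2_space D" and [measurable]: "m \<in> borel_measurable (lebesgue_on D)"
    and "AE x in lebesgue_on D. \<bar>m x\<bar> \<le> K"
  shows "(\<lambda>x. m x *\<^sub>R v x) \<in> l2_space D"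
    and "0 \<le> K \<Longrightarrow> l2_norm D (\<lambda>x. m x *\<^sub>R v x) \<le> K * l2_norm D v"
proof -
  note [measurable] = l2_spaceD(1)[OF assms(1)]
  have "AE x in lebesgue_on D. norm (m x *\<^sub>R v x) \<le> K * norm (v x)"
    using assms(3) by eventually_elim (simp add: mult_right_mono)
  note * = l2_dominated[OF assms(1) _ this]
  show "(\<lambda>x. m x *\<^sub>R v x) \<in> l2_space D" by (rule *(1)) measurable
  show "l2_norm D (\<lambda>x. m x *\<^sub>R v x) \<le> K * l2_norm D v" if "0 \<le> K"
    by (rule *(2)[OF _ that]) measurable
qed

lemma l2_bounded_linear:
  assumes "v \<in> l2_space D" and T: "bounded_linear T" and K: "\<And>z. norm (T z) \<le> K * norm z" "0 \<le> K"
  shows "(\<lambda>x. T (v x)) \<in> l2_space D" and "l2_norm D (\<lambda>x. T (v x)) \<le> K * l2_norm D v"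
proof -
  have m: "(\<lambda>x. T (v x)) \<in> borel_measurable (lebesgue_on D)"
    using bounded_linear.continuous_on[OF T continuous_on_id] l2_spaceD(1)[OF assms(1)]
    by (intro borel_measurable_continuous_on[where f = T]) auto
  show "(\<lambda>x. T (v x)) \<in> l2_space D" "l2_norm D (\<lambda>x. T (v x)) \<le> K * l2_norm D v"
    using l2_dominated[OF assms(1) m, of K] K by auto
qed

lemma l2_weighted_bound:
  assumes "v \<in> l2_space D" "w \<in> l2_space D" and m[measurable]: "m \<in> borel_measurable (lebesgue_on D)"
    and "AE x in lebesgue_on D. \<bar>m x\<bar> \<le> K" "0 \<le> K"
  shows "integrable (lebesgue_on D) (\<lambda>x. m x * (v x \<bullet> w x))"
    and "\<bar>LINT x|lebesgue_on D. m x * (v x \<bullet> w x)\<bar> \<le> K * (l2_norm D v * l2_norm D w)"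
proof -
  note mv = l2_bounded_mult[OF assms(1,3,4)]
  show "integrable (lebesgue_on D) (\<lambda>x. m x * (v x \<bullet> w x))"
    using l2_inner_integrable[OF mv(1) assms(2)] by simp
  have "\<bar>LINT x|lebesgue_on D. m x * (v x \<bullet> w x)\<bar> \<le> l2_norm D (\<lambda>x. m x *\<^sub>R v x) * l2_norm D w"
    using l2_cauchy_schwarz[OF mv(1) assms(2)] by (simp add: l2_inner_def)
  also have "\<dots> \<le> (K * l2_norm D v) * l2_norm D w"
    using mv(2)[OF assms(5)] l2_norm_nonneg by (rule mult_right_mono)
  finally show "\<bar>LINT x|lebesgue_on D. m x * (v x \<bullet> w x)\<bar> \<le> K * (l2_norm D v * l2_norm D w)"
    by (simp add: mult.assoc)
qed

subsection \<open>The fundamental lemma of the calculus of variations\<close>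

text \<open>The regularity that \<open>is_weak_grad\<close> demands of its test functions. Being
  only C^1, it admits explicit rational bumps in place of mollifiers.\<close>

definition c1_fun :: "('a::real_inner \<Rightarrow> real) \<Rightarrow> bool" where
  "c1_fun \<phi> \<longleftrightarrow> (\<exists>\<phi>'. (\<forall>x. GDERIV \<phi> x :> \<phi>' x) \<and> continuous_on UNIV \<phi>')"

lemma c1_fun_continuous:
  assumes "c1_fun \<phi>" shows "continuous_on UNIV \<phi>"
proof -
  obtain \<phi>' where "\<And>x. GDERIV \<phi> x :> \<phi>' x" using assms by (auto simp: c1_fun_def)
  then have "isCont \<phi> x" for x using has_derivative_continuous by (fastforce simp: gderiv_def)
  then show ?thesis by (simp add: continuous_at_imp_continuous_on)
qed

lemma c1_fun_const: "c1_fun (\<lambda>x. c)"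
  unfolding c1_fun_def by (intro exI[of _ "\<lambda>x. 0"]) (auto simp: GDERIV_const)

lemma c1_fun_mult:
  assumes "c1_fun f" "c1_fun g" shows "c1_fun (\<lambda>x. f x * g x)"
proof -
  obtain f' g' where d: "\<And>x. GDERIV f x :> f' x" "continuous_on UNIV f'"
    "\<And>x. GDERIV g x :> g' x" "continuous_on UNIV g'"
    using assms by (auto simp: c1_fun_def)
  show ?thesis unfolding c1_fun_def
    using d c1_fun_continuous[OF assms(1)] c1_fun_continuous[OF assms(2)]
    by (intro exI[of _ "\<lambda>x. f x *\<^sub>R g' x + g x *\<^sub>R f' x"])
      (auto intro!: GDERIV_mult continuous_intros)
qed

lemma c1_fun_prod: "finite I \<Longrightarrow> (\<And>i. i \<in> I \<Longrightarrow> c1_fun (f i)) \<Longrightarrow> c1_fun (\<lambda>x. \<Prod>i\<in>I. f i x)"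
  by (induction I rule: finite_induct) (auto intro: c1_fun_const c1_fun_mult)

lemma c1_fun_compose_affine:
  fixes i :: "'a::real_inner"
  assumes "\<And>t. (h has_real_derivative h' t) (at t)" "continuous_on UNIV h'"
  shows "c1_fun (\<lambda>x. h (x \<bullet> i - a))"
  unfolding c1_fun_def
proof (intro exI conjI allI)
  show "GDERIV (\<lambda>x. h (x \<bullet> i - a)) x :> h' (x \<bullet> i - a) *\<^sub>R i" for x
  proof (rule GDERIV_DERIV_compose[OF _ assms(1)])
    show "GDERIV (\<lambda>x. x \<bullet> i - a) x :> i"
      unfolding gderiv_def by (auto intro!: derivative_eq_intros)
  qed
  show "continuous_on UNIV (\<lambda>x. h' (x \<bullet> i - a) *\<^sub>R i)"
    by (intro continuous_intros continuous_on_compose2[OF assms(2)]) auto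
qed

text \<open>A C^1 approximation of the indicator of the positive half-line: squaring the positive
  part removes the kink at 0, and n s / (1 + n s) stays below 1 and tends to 1 for every s >
  0.\<close>

definition bump :: "nat \<Rightarrow> real \<Rightarrow> real" where
  "bump n t = real n * (max 0 t)\<^sup>2 / (1 + real n * (max 0 t)\<^sup>2)"

lemma DERIV_max_sq: "((\<lambda>t::real. (max 0 t)\<^sup>2) has_real_derivative 2 * max 0 t) (at t)"
proof -
  consider "t < 0" | "t > 0" | "t = 0" by linarith
  then show ?thesis
  proof cases
    case 1
    show ?thesis
      by (rule has_field_derivative_transform_within_open[of "\<lambda>t. 0" _ _ "{..<0}"])
        (use 1 in \<open>auto intro!: derivative_eq_intros\<close>)
  next
    case 2
    show ?thesis
      by (rule has_field_derivative_transform_within_open[of "\<lambda>t. t\<^sup>2" _ _ "{0<..}"])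
        (use 2 in \<open>auto intro!: derivative_eq_intros\<close>)
  next
    case 3
    \<comment> \<open>At the kink the difference quotient y |-> (max 0 y)^2 / y coincides with max 0
      y away from 0.\<close>
    have "((\<lambda>y::real. max 0 y) \<longlongrightarrow> max 0 0) (at 0)" by (intro tendsto_intros)
    then have "((\<lambda>y::real. ((max 0 y)\<^sup>2 - (max 0 0)\<^sup>2) / (y - 0)) \<longlongrightarrow> 0) (at 0)"
      by (subst (asm) tendsto_cong[where g = "\<lambda>y. ((max 0 y)\<^sup>2 - (max 0 0)\<^sup>2) / (y - 0)"])
        (auto simp: eventually_at power2_eq_square max_def intro!: exI[of _ 1])
    then show ?thesis using 3 by (simp add: has_field_derivative_iff)
  qed
qed

lemma c1_fun_bump: "c1_fun (\<lambda>x::'a::real_inner. bump n (x \<bullet> i - a))"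
proof (rule c1_fun_compose_affine)
  have pos: "1 + real n * (max 0 t)\<^sup>2 > 0" for t
    by (meson add_pos_nonneg mult_nonneg_nonneg of_nat_0_le_iff zero_le_power2 zero_less_one)
  have d: "((\<lambda>s. real n * s / (1 + real n * s)) has_real_derivative real n / (1 + real n * s)\<^sup>2) (at s)"
    if "1 + real n * s > 0" for s
    using that by (auto intro!: derivative_eq_intros simp: field_simps power2_eq_square)
  show "(bump n has_real_derivative real n * (2 * max 0 t) / (1 + real n * (max 0 t)\<^sup>2)\<^sup>2) (at t)" for t
    unfolding bump_def using DERIV_chain2[OF d[OF pos] DERIV_max_sq, of t] by simp
  show "continuous_on UNIV (\<lambda>t. real n * (2 * max 0 t) / (1 + real n * (max 0 t)\<^sup>2)\<^sup>2)"
    using pos by (intro continuous_intros) (auto simp: less_imp_neq[symmetric])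
qed

lemma bump_nonpos: "t \<le> 0 \<Longrightarrow> bump n t = 0"
  by (simp add: bump_def)

lemma bump_range: "0 \<le> bump n t" "bump n t \<le> 1"
proof -
  have "0 \<le> real n * (max 0 t)\<^sup>2" by simp
  then show "0 \<le> bump n t" "bump n t \<le> 1"
    unfolding bump_def by (simp_all add: divide_le_eq not_less add_nonneg_nonneg)
qed

lemma bump_tendsto: "0 < t \<Longrightarrow> (\<lambda>n. bump n t) \<longlonglongrightarrow> 1"
proof -
  assume t: "0 < t"
  define s where "s = (max 0 t)\<^sup>2"
  have s: "0 < s" using t by (simp add: s_def)
  have "filterlim (\<lambda>n. 1 + real n * s) at_top sequentially"
    by (rule filterlim_tendsto_add_at_top[OF tendsto_const
        filterlim_at_top_mult_tendsto_pos[OF tendsto_const s filterlim_real_sequentially]])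
  then have "(\<lambda>n. inverse (1 + real n * s)) \<longlonglongrightarrow> 0"
    by (rule tendsto_inverse_0_at_top)
  then have "(\<lambda>n. 1 - inverse (1 + real n * s)) \<longlonglongrightarrow> 1 - 0" by (intro tendsto_intros)
  moreover have "1 - inverse (1 + real n * s) = bump n t" for n
  proof -
    have "1 + real n * s > 0" using s by (simp add: add_pos_nonneg)
    then show ?thesis unfolding bump_def s_def[symmetric] by (simp add: field_simps)
  qed
  ultimately show ?thesis by simp
qed

text \<open>Each factor pair handles the two faces orthogonal to i. The upper face is written with
  the direction -i, so that both faces are instances of the same affine composition with
  \<open>bump\<close>.\<close>

definition box_bump :: "'a::euclidean_space \<Rightarrow> 'a \<Rightarrow> nat \<Rightarrow> 'a \<Rightarrow> real" where
  "box_bump a b n x = (\<Prod>i\<in>Basis. bump n (x \<bullet> i - a \<bullet> i) * bump n (x \<bullet> (- i) - b \<bullet> (- i)))"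

lemma c1_fun_box_bump: "c1_fun (box_bump a b n)"
  unfolding box_bump_def by (intro c1_fun_prod c1_fun_mult c1_fun_bump) auto

lemma box_bump_range: "0 \<le> box_bump a b n x" "box_bump a b n x \<le> 1"
  unfolding box_bump_def
  by (auto intro!: prod_nonneg prod_le_1 mult_nonneg_nonneg mult_le_one bump_range)

lemma box_bump_outside: "x \<notin> box a b \<Longrightarrow> box_bump a b n x = 0"
  unfolding box_bump_def by (auto simp: box_def not_less intro!: bump_nonpos)

lemma box_bump_tendsto: "(\<lambda>n. box_bump a b n x) \<longlonglongrightarrow> indicator (box a b) x"
proof (cases "x \<in> box a b")
  case True
  then have "(\<lambda>n. box_bump a b n x) \<longlonglongrightarrow> (\<Prod>i\<in>(Basis::'a set). 1 * 1)"
    unfolding box_bump_def by (intro tendsto_intros bump_tendsto) (auto simp: box_def)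
  then show ?thesis using True by simp
qed (simp add: box_bump_outside)

text \<open>Positive and negative part of g are the densities of two measures that agree on open
  boxes, an intersection-stable generator of the Borel sets. The measures are therefore equal, so
  are their densities a.e., and two equal numbers of which one is 0 both vanish.\<close>

lemma box_integrals_zero_imp_AE_zero:
  fixes g :: "'a::euclidean_space \<Rightarrow> real"
  assumes g: "integrable lborel g"
    and zero: "\<And>a b. (LINT x|lborel. g x * indicator (box a b) x) = 0"
  shows "AE x in lborel. g x = 0"
proof -
  note [measurable] = borel_measurable_integrable[OF g]
  let ?p = "\<lambda>x. ennreal (max 0 (g x))" and ?m = "\<lambda>x. ennreal (max 0 (- g x))"
  have int: "integrable lborel (\<lambda>x. max 0 (g x) * indicator A x)"
    "integrable lborel (\<lambda>x. max 0 (- g x) * indicator A x)" if [measurable]: "A \<in> sets borel" for A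
    by (rule Bochner_Integration.integrable_bound[OF g]; auto simp: indicator_def)+
  have em: "emeasure (density lborel ?p) A = ennreal (LINT x|lborel. max 0 (g x) * indicator A x)"
    "emeasure (density lborel ?m) A = ennreal (LINT x|lborel. max 0 (- g x) * indicator A x)"
    if [measurable]: "A \<in> sets borel" for A
    using int[OF that]
    by (subst emeasure_density; simp add: nn_integral_eq_integral[symmetric] ennreal_mult' ennreal_indicator[symmetric])+
  have "density lborel ?p = density lborel ?m"
  proof (rule measure_eqI_generator_eq)
    show "Int_stable (range (\<lambda>(a, b). box a b :: 'a set))"
      by (auto simp: Int_stable_def box_Int_box)
    fix X :: "'a set" assume "X \<in> range (\<lambda>(a, b). box a b)"
    then obtain a b where X: "X = box a b" by auto
    have "(LINT x|lborel. max 0 (g x) * indicator X x) - (LINT x|lborel. max 0 (- g x) * indicator X x)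
      = (LINT x|lborel. max 0 (g x) * indicator X x - max 0 (- g x) * indicator X x)"
      using int[of X] X by (subst Bochner_Integration.integral_diff) auto
    also have "\<dots> = (LINT x|lborel. g x * indicator X x)"
      by (intro Bochner_Integration.integral_cong) (auto simp: indicator_def)
    finally show "emeasure (density lborel ?p) X = emeasure (density lborel ?m) X"
      using zero[of a b] X by (simp add: em)
  next
    show "sets (density lborel ?p) = sigma_sets UNIV (range (\<lambda>(a, b). box a b :: 'a set))"
      "sets (density lborel ?m) = sigma_sets UNIV (range (\<lambda>(a, b). box a b :: 'a set))"
      by (simp_all add: borel_eq_box)
    show "range (\<lambda>n::nat. box (- real n *\<^sub>R One) (real n *\<^sub>R One) :: 'a set) \<subseteq> range (\<lambda>(a, b). box a b)"
      by auto
    show "(\<Union>n::nat. box (- real n *\<^sub>R One) (real n *\<^sub>R One) :: 'a set) = UNIV"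
      using UN_box_eq_UNIV by simp
    show "emeasure (density lborel ?p) (box (- real n *\<^sub>R One) (real n *\<^sub>R One)) \<noteq> \<infinity>" for n
      by (simp add: em)
  qed auto
  then have "AE x in lborel. ?p x = ?m x"
    by (subst (asm) sigma_finite_measure.density_unique_iff[OF sigma_finite_lborel]) auto
  then show ?thesis
    by eventually_elim (auto simp: max_def ennreal_eq_0_iff split: if_splits)
qed

text \<open>The functions \<open>box_bump\<close> converge to the indicator of a box and are bounded
  by 1, so dominated convergence turns vanishing against test functions into vanishing over boxes
  whose closed box lies in D. Countably many such closed boxes exhaust D.\<close>

lemma fundamental_lemma_borel:
  fixes g :: "'a::euclidean_space \<Rightarrow> real"
  assumes D: "open D" and g: "integrable lborel g"
    and zero: "\<And>\<phi> K. c1_fun \<phi> \<Longrightarrow> compact K \<Longrightarrow> K \<subseteq> D \<Longrightarrow> (\<And>x. x \<notin> K \<Longrightarrow> \<phi> x = 0) \<Longrightarrow>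
      (LINT x|lborel. g x * \<phi> x) = 0"
  shows "AE x in lebesgue. x \<in> D \<longrightarrow> g x = 0"
proof -
  note gm[measurable] = borel_measurable_integrable[OF g]
  have box0: "(LINT x|lborel. g x * indicator (box a b) x) = 0" if "cbox a b \<subseteq> D" for a b
  proof -
    have "(\<lambda>n. LINT x|lborel. g x * box_bump a b n x) \<longlonglongrightarrow> (LINT x|lborel. g x * indicator (box a b) x)"
    proof (rule integral_dominated_convergence[where w = "\<lambda>x. \<bar>g x\<bar>"])
      show "(\<lambda>x. g x * box_bump a b n x) \<in> borel_measurable lborel" for n
        using c1_fun_continuous[OF c1_fun_box_bump[of a b n]]
        by (intro borel_measurable_times gm) (auto intro: borel_measurable_continuous_onI)
      show "AE x in lborel. norm (g x * box_bump a b n x) \<le> \<bar>g x\<bar>" for n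
        using box_bump_range[of a b n]
        by (intro AE_I2) (auto simp: abs_mult intro!: mult_left_le)
    qed (use g in \<open>auto intro!: tendsto_intros box_bump_tendsto\<close>)
    moreover have "(LINT x|lborel. g x * box_bump a b n x) = 0" for n
      by (rule zero[OF c1_fun_box_bump compact_cbox that])
        (use box_subset_cbox[of a b] in \<open>auto intro: box_bump_outside\<close>)
    ultimately show ?thesis by (simp add: LIMSEQ_const_iff)
  qed
  \<comment> \<open>Localisation: g cut off to one box integrates to 0 over every box, since
    intersections of boxes are boxes. The boundary of the box, on which the cut-off loses g, is
    negligible.\<close>
  have ae: "AE x in lebesgue. x \<in> cbox c d \<longrightarrow> g x = 0" if cd: "cbox c d \<subseteq> D" for c d
  proof -
    have "AE x in lborel. g x * indicator (box c d) x = 0"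
    proof (rule box_integrals_zero_imp_AE_zero)
      show "integrable lborel (\<lambda>x. g x * indicator (box c d) x)"
        using g by (rule integrable_real_mult_indicator[rotated]) simp
      fix a b
      obtain a' b' where ab: "box a b \<inter> box c d = box a' b'" by (auto simp: box_Int_box)
      have "(LINT x|lborel. g x * indicator (box c d) x * indicator (box a b) x) =
        (LINT x|lborel. g x * indicator (box a' b') x)"
        unfolding ab[symmetric] by (intro Bochner_Integration.integral_cong) (auto simp: indicator_def)
      also have "\<dots> = 0"
      \<comment> \<open>Only for a nonempty open box is \<open>cbox a' b'\<close> its closure and
        hence contained in D; a degenerate closed box could stick out of it.\<close>
      proof (cases "box a' b' = {}")
        case False
        then have "cbox a' b' = closure (box a' b')" by simp
        also have "\<dots> \<subseteq> closure (box c d)" using ab by (intro closure_mono) auto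
        also have "\<dots> \<subseteq> cbox c d" by (meson box_subset_cbox closed_cbox closure_minimal)
        finally show ?thesis using cd by (intro box0) auto
      qed simp
      finally show "(LINT x|lborel. g x * indicator (box c d) x * indicator (box a b) x) = 0" .
    qed
    then have "AE x in lebesgue. g x * indicator (box c d) x = 0" by (rule AE_completion)
    moreover have "AE x in lebesgue. x \<notin> cbox c d - box c d"
      by (intro AE_not_in) (use negligible_frontier_interval negligible_iff_null_sets in blast)
    ultimately show ?thesis by eventually_elim (auto simp: indicator_def split: if_splits)
  qed
  obtain \<D> where \<D>: "countable \<D>" "\<D> \<subseteq> Pow D" "\<And>X. X \<in> \<D> \<Longrightarrow> \<exists>a b. X = cbox a b" "\<Union>\<D> = D"
    using open_countable_Union_open_cbox[OF D] by metis
  have "AE x in lebesgue. x \<in> X \<longrightarrow> g x = 0" if "X \<in> \<D>" for X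
    using \<D>(3)[OF that] \<D>(2) that ae by blast
  then have "AE x in lebesgue. \<forall>X\<in>\<D>. x \<in> X \<longrightarrow> g x = 0"
    by (subst AE_ball_countable[OF \<D>(1)]) auto
  then show ?thesis by eventually_elim (use \<D>(4) in auto)
qed

text \<open>Functions on \<open>lebesgue_on D\<close> are merely Lebesgue measurable, while the
  density argument lives on Borel sets. The extension of g by zero is therefore replaced by a Borel
  function h equal to it a.e.; integrals against continuous test functions do not change.\<close>

lemma fundamental_lemma:
  fixes g :: "'a::euclidean_space \<Rightarrow> real"
  assumes D: "open D" and g: "integrable (lebesgue_on D) g"
    and zero: "\<And>\<phi> K. c1_fun \<phi> \<Longrightarrow> compact K \<Longrightarrow> K \<subseteq> D \<Longrightarrow> (\<And>x. x \<notin> K \<Longrightarrow> \<phi> x = 0) \<Longrightarrow>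
      (LINT x|lebesgue_on D. g x * \<phi> x) = 0"
  shows "AE x in lebesgue_on D. g x = 0"
proof -
  have Ds: "D \<inter> space lebesgue \<in> sets lebesgue" using D by (simp add: borel_open sets_completionI_sets)
  have g0: "integrable lebesgue (\<lambda>x. indicator D x *\<^sub>R g x)"
    using g integrable_restrict_space[OF Ds] by blast
  then obtain h where h[measurable]: "h \<in> borel_measurable lborel"
    and gh': "AE x in lborel. indicator D x *\<^sub>R g x = h x"
    using completion_ex_borel_measurable_real[OF borel_measurable_integrable] by blast
  have gh: "AE x in lebesgue. indicator D x *\<^sub>R g x = h x" using gh' by (rule AE_completion)
  have hm: "h \<in> borel_measurable lebesgue" using h by (rule measurable_completion)
  have "integrable lebesgue h"
    using integrable_cong_AE_imp[OF g0 hm] gh by (simp add: eq_commute)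
  then have hi: "integrable lborel h" using integrable_completion[OF h] by blast
  have "AE x in lebesgue. x \<in> D \<longrightarrow> h x = 0"
  proof (rule fundamental_lemma_borel[OF D hi])
    fix \<phi> :: "'a \<Rightarrow> real" and K assume \<phi>: "c1_fun \<phi>" and K: "compact K" "K \<subseteq> D" "\<And>x. x \<notin> K \<Longrightarrow> \<phi> x = 0"
    have \<phi>m[measurable]: "\<phi> \<in> borel_measurable lborel"
      using c1_fun_continuous[OF \<phi>] by (auto intro: borel_measurable_continuous_onI)
    then have \<phi>l: "\<phi> \<in> borel_measurable lebesgue" by (rule measurable_completion)
    have "(LINT x|lborel. h x * \<phi> x) = (LINT x|lebesgue. h x * \<phi> x)"
      by (rule integral_completion[symmetric]) measurable
    also have "\<dots> = (LINT x|lebesgue. indicator D x *\<^sub>R (g x * \<phi> x))"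
    proof (rule integral_cong_AE)
      show "AE x in lebesgue. h x * \<phi> x = indicator D x *\<^sub>R (g x * \<phi> x)"
        using gh by eventually_elim (simp flip: mult.assoc)
      show "(\<lambda>x. indicator D x *\<^sub>R (g x * \<phi> x)) \<in> borel_measurable lebesgue"
        using borel_measurable_times[OF borel_measurable_integrable[OF g0] \<phi>l] by (simp add: mult.assoc)
    qed (use hm \<phi>l in measurable)
    also have "\<dots> = (LINT x|lebesgue_on D. g x * \<phi> x)" by (rule integral_restrict_space[OF Ds, symmetric])
    also have "\<dots> = 0" using zero[OF \<phi> K] by simp
    finally show "(LINT x|lborel. h x * \<phi> x) = 0" .
  qed
  with gh have "AE x in lebesgue. x \<in> D \<longrightarrow> g x = 0" by eventually_elim auto
  then show ?thesis by (subst AE_restrict_space_iff[OF Ds])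
qed

subsection \<open>Weak gradients\<close>

locale bounded_open =
  fixes D :: "(real ^ 'd) set"
  assumes open_D: "open D" and bounded_D: "bounded D"
begin

lemma sets_D: "D \<in> sets lebesgue"
  using open_D by (simp add: borel_open sets_completionI_sets)

lemma finite_measure_D: "finite_measure (lebesgue_on D)"
proof
  have "D \<in> lmeasurable" using bounded_D sets_D by (rule bounded_set_imp_lmeasurable)
  then show "emeasure (lebesgue_on D) (space (lebesgue_on D)) \<noteq> \<infinity>"
    using sets_D by (auto simp: space_restrict_space emeasure_restrict_space fmeasurable_def)
qed

lemma AE_D: "(\<And>x. x \<in> D \<Longrightarrow> P x) \<Longrightarrow> AE x in lebesgue_on D. P x"
  by (intro AE_I2) (simp add: space_restrict_space)

lemma continuous_measurable_D:
  fixes h :: "real ^ 'd \<Rightarrow> 'b::topological_space"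
  shows "continuous_on UNIV h \<Longrightarrow> h \<in> borel_measurable (lebesgue_on D)"
  by (rule continuous_imp_measurable_on_sets_lebesgue[OF _ sets_D]) (rule continuous_on_subset, auto)

lemma continuous_bounded_D:
  assumes "continuous_on UNIV (h :: real ^ 'd \<Rightarrow> 'b::real_normed_vector)"
  obtains B where "0 \<le> B" "\<And>x. x \<in> closure D \<Longrightarrow> norm (h x) \<le> B"
proof -
  have "compact (closure D)" using bounded_D by simp
  then have "bounded (h ` closure D)"
    by (intro compact_imp_bounded compact_continuous_image continuous_on_subset[OF assms]) auto
  then obtain B where B: "B > 0" "\<forall>x\<in>h ` closure D. norm x \<le> B" by (auto simp: bounded_pos)
  then show thesis using that[of B] by auto
qed

lemma l2_integrable:
  fixes v :: "real ^ 'd \<Rightarrow> 'b::euclidean_space"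
  assumes "v \<in> l2_space D" shows "integrable (lebesgue_on D) v"
proof (rule Bochner_Integration.integrable_bound)
  interpret finite_measure "lebesgue_on D" by (rule finite_measure_D)
  show "integrable (lebesgue_on D) (\<lambda>x. 1 + (norm (v x))\<^sup>2)"
    using l2_spaceD(2)[OF assms] by simp
  have "norm (v x) \<le> norm (1 + (norm (v x))\<^sup>2)" for x
    using sum_squares_bound[of 1 "norm (v x)"] norm_ge_zero[of "v x"] by (simp del: norm_ge_zero)
  then show "AE x in lebesgue_on D. norm (v x) \<le> norm (1 + (norm (v x))\<^sup>2)" by simp
qed (rule l2_spaceD(1)[OF assms])

lemma l2_mult_continuous:
  fixes v :: "real ^ 'd \<Rightarrow> real"
  assumes "v \<in> l2_space D" "continuous_on UNIV h"
  shows "(\<lambda>x. v x * h x) \<in> l2_space D"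
proof -
  obtain B where B: "0 \<le> B" "\<And>x. x \<in> closure D \<Longrightarrow> norm (h x) \<le> B"
    using continuous_bounded_D[OF assms(2)] by metis
  have "AE x in lebesgue_on D. \<bar>h x\<bar> \<le> B"
    using B(2) closure_subset by (intro AE_D) fastforce
  from l2_bounded_mult(1)[OF assms(1) continuous_measurable_D[OF assms(2)] this]
  show ?thesis by (simp add: mult.commute)
qed

lemma l2_vec_nth:
  fixes v :: "real ^ 'd \<Rightarrow> 'b::euclidean_space ^ 'n"
  shows "v \<in> l2_space D \<Longrightarrow> (\<lambda>x. v x $ i) \<in> l2_space D"
  using l2_bounded_linear(1)[of v D "\<lambda>z. z $ i" 1] by (simp add: bounded_linear_vec_nth Finite_Cartesian_Product.norm_nth_le)

lemma weak_grad_integrable: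
  fixes v :: "real ^ 'd \<Rightarrow> real ^ 'd" and G :: "real ^ 'd \<Rightarrow> real ^ 'd ^ 'd"
  assumes "v \<in> l2_space D" "G \<in> l2_space D"
    and "\<And>x. GDERIV \<phi> x :> \<phi>' x" "continuous_on UNIV \<phi>'"
  shows "integrable (lebesgue_on D) (\<lambda>x. v x $ i * \<phi>' x $ j)"
    and "integrable (lebesgue_on D) (\<lambda>x. G x $ i $ j * \<phi> x)"
proof -
  have "continuous_on UNIV \<phi>" using assms(3,4) by (intro c1_fun_continuous) (auto simp: c1_fun_def)
  then show "integrable (lebesgue_on D) (\<lambda>x. G x $ i $ j * \<phi> x)"
    by (rule l2_integrable[OF l2_mult_continuous[OF l2_vec_nth[OF l2_vec_nth[OF assms(2)]]]])
  have "continuous_on UNIV (\<lambda>x. \<phi>' x $ j)" using assms(4) by (intro continuous_intros)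
  then show "integrable (lebesgue_on D) (\<lambda>x. v x $ i * \<phi>' x $ j)"
    by (rule l2_integrable[OF l2_mult_continuous[OF l2_vec_nth[OF assms(1)]]])
qed

lemma is_weak_gradD:
  assumes "is_weak_grad D v G" "\<And>x. GDERIV \<phi> x :> \<phi>' x" "continuous_on UNIV \<phi>'"
    "compact K" "K \<subseteq> D" "\<And>x. x \<notin> K \<Longrightarrow> \<phi> x = 0"
  shows "(LINT x|lebesgue_on D. v x $ i * \<phi>' x $ j) = - (LINT x|lebesgue_on D. G x $ i $ j * \<phi> x)"
  using assms unfolding is_weak_grad_def by blast

lemma is_weak_gradI:
  assumes "\<And>\<phi> \<phi>' K i j. (\<And>x. GDERIV \<phi> x :> \<phi>' x) \<Longrightarrow> continuous_on UNIV \<phi>' \<Longrightarrow>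
    compact K \<Longrightarrow> K \<subseteq> D \<Longrightarrow> (\<And>x. x \<notin> K \<Longrightarrow> \<phi> x = 0) \<Longrightarrow>
    (LINT x|lebesgue_on D. v x $ i * \<phi>' x $ j) = - (LINT x|lebesgue_on D. G x $ i $ j * \<phi> x)"
  shows "is_weak_grad D v G"
  using assms unfolding is_weak_grad_def by blast

text \<open>Integration by parts turns the integral of an entry of \<open>G - G'\<close> against a
  test function into an integral of a component of \<open>v' - v\<close>, which vanishes. The
  fundamental lemma then applies entry by entry.\<close>

lemma weak_grad_unique:
  fixes v v' :: "real ^ 'd \<Rightarrow> real ^ 'd" and G G' :: "real ^ 'd \<Rightarrow> real ^ 'd ^ 'd"
  assumes "v \<in> l2_space D" "v' \<in> l2_space D" "AE x in lebesgue_on D. v x = v' x"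
    and G: "G \<in> l2_space D" "G' \<in> l2_space D" "is_weak_grad D v G" "is_weak_grad D v' G'"
  shows "AE x in lebesgue_on D. G x = G' x"
proof -
  have comp: "AE x in lebesgue_on D. G x $ i $ j - G' x $ i $ j = 0" for i j
  proof (rule fundamental_lemma[OF open_D])
    show "integrable (lebesgue_on D) (\<lambda>x. G x $ i $ j - G' x $ i $ j)"
      using G(1,2) by (intro Bochner_Integration.integrable_diff l2_integrable l2_vec_nth)
    fix \<phi> :: "real ^ 'd \<Rightarrow> real" and K
    assume "c1_fun \<phi>" and K: "compact K" "K \<subseteq> D" "\<And>x. x \<notin> K \<Longrightarrow> \<phi> x = 0"
    then obtain \<phi>' where \<phi>': "\<And>x. GDERIV \<phi> x :> \<phi>' x" "continuous_on UNIV \<phi>'"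
      by (auto simp: c1_fun_def)
    have "(LINT x|lebesgue_on D. (G x $ i $ j - G' x $ i $ j) * \<phi> x) =
      (LINT x|lebesgue_on D. G x $ i $ j * \<phi> x) - (LINT x|lebesgue_on D. G' x $ i $ j * \<phi> x)"
      using weak_grad_integrable[OF assms(1) G(1) \<phi>'] weak_grad_integrable[OF assms(1) G(2) \<phi>']
      by (simp add: left_diff_distrib)
    then have "(LINT x|lebesgue_on D. (G x $ i $ j - G' x $ i $ j) * \<phi> x) =
      (LINT x|lebesgue_on D. v' x $ i * \<phi>' x $ j) - (LINT x|lebesgue_on D. v x $ i * \<phi>' x $ j)"
      using is_weak_gradD[OF G(3) \<phi>' K] is_weak_gradD[OF G(4) \<phi>' K] by simp
    moreover have AE_ij: "AE x in lebesgue_on D. v' x $ i * \<phi>' x $ j = v x $ i * \<phi>' x $ j"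
      using assms(3) by eventually_elim simp
    have "(LINT x|lebesgue_on D. v' x $ i * \<phi>' x $ j) = (LINT x|lebesgue_on D. v x $ i * \<phi>' x $ j)"
      using weak_grad_integrable(1)[OF assms(1) G(1) \<phi>'] weak_grad_integrable(1)[OF assms(2) G(1) \<phi>'] AE_ij
      by (intro integral_cong_AE) blast+
    ultimately show "(LINT x|lebesgue_on D. (G x $ i $ j - G' x $ i $ j) * \<phi> x) = 0" by simp
  qed
  then have "AE x in lebesgue_on D. \<forall>i j. G x $ i $ j - G' x $ i $ j = 0"
    unfolding AE_all_countable by blast
  then show ?thesis by eventually_elim (simp add: vec_eq_iff)
qed

lemma is_weak_grad_add:
  fixes v w :: "real ^ 'd \<Rightarrow> real ^ 'd" and G H :: "real ^ 'd \<Rightarrow> real ^ 'd ^ 'd"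
  assumes "v \<in> l2_space D" "w \<in> l2_space D" "G \<in> l2_space D" "H \<in> l2_space D"
    and "is_weak_grad D v G" "is_weak_grad D w H"
  shows "is_weak_grad D (\<lambda>x. v x + w x) (\<lambda>x. G x + H x)"
proof (rule is_weak_gradI)
  fix \<phi> \<phi>' K i j
  assume t: "\<And>x. GDERIV \<phi> x :> \<phi>' x" "continuous_on UNIV \<phi>'" "compact K" "K \<subseteq> D" "\<And>x. x \<notin> K \<Longrightarrow> \<phi> x = 0"
  show "(LINT x|lebesgue_on D. (v x + w x) $ i * \<phi>' x $ j) =
    - (LINT x|lebesgue_on D. (G x + H x) $ i $ j * \<phi> x)"
    using weak_grad_integrable[OF assms(1,3) t(1,2)] weak_grad_integrable[OF assms(2,4) t(1,2)]
      is_weak_gradD[OF assms(5) t] is_weak_gradD[OF assms(6) t]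
    by (simp add: distrib_right)
qed

lemma is_weak_grad_scale:
  assumes "is_weak_grad D v G"
  shows "is_weak_grad D (\<lambda>x. c *\<^sub>R v x) (\<lambda>x. c *\<^sub>R G x)"
proof (rule is_weak_gradI)
  fix \<phi> \<phi>' K i j
  assume t: "\<And>x. GDERIV \<phi> x :> \<phi>' x" "continuous_on UNIV \<phi>'" "compact K" "K \<subseteq> D" "\<And>x. x \<notin> K \<Longrightarrow> \<phi> x = 0"
  show "(LINT x|lebesgue_on D. (c *\<^sub>R v x) $ i * \<phi>' x $ j) =
    - (LINT x|lebesgue_on D. (c *\<^sub>R G x) $ i $ j * \<phi> x)"
    using is_weak_gradD[OF assms t] by (simp add: mult.assoc)
qed

lemma h1_l2: "v \<in> h1_space D \<Longrightarrow> v \<in> l2_space D"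
  by (simp add: h1_space_def)

lemma weak_grad:
  assumes "v \<in> h1_space D"
  shows "weak_grad D v \<in> l2_space D" "is_weak_grad D v (weak_grad D v)"
  using someI_ex[of "\<lambda>G. G \<in> l2_space D \<and> is_weak_grad D v G"] assms
  by (auto simp: h1_space_def weak_grad_def)

text \<open>Makes the choice inside \<open>weak_grad\<close> harmless: a square-integrable weak
  gradient found by computation may replace the chosen one under any integral.\<close>

lemma weak_grad_eqI:
  assumes "v \<in> l2_space D" "G \<in> l2_space D" "is_weak_grad D v G"
  shows "v \<in> h1_space D" "AE x in lebesgue_on D. weak_grad D v x = G x"
proof -
  show v: "v \<in> h1_space D" using assms by (auto simp: h1_space_def)
  show "AE x in lebesgue_on D. weak_grad D v x = G x"
    using weak_grad_unique[OF assms(1,1) _ weak_grad(1)[OF v] assms(2) weak_grad(2)[OF v] assms(3)] by simp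
qed

lemma weak_grad_add:
  assumes "v \<in> h1_space D" "w \<in> h1_space D"
  shows "(\<lambda>x. v x + w x) \<in> h1_space D"
    and "AE x in lebesgue_on D. weak_grad D (\<lambda>x. v x + w x) x = weak_grad D v x + weak_grad D w x"
proof -
  note v = h1_l2[OF assms(1)] weak_grad[OF assms(1)] and w = h1_l2[OF assms(2)] weak_grad[OF assms(2)]
  note * = weak_grad_eqI[OF l2_add[OF v(1) w(1)] l2_add[OF v(2) w(2)]
      is_weak_grad_add[OF v(1) w(1) v(2) w(2) v(3) w(3)]]
  show "(\<lambda>x. v x + w x) \<in> h1_space D" by (rule *)
  show "AE x in lebesgue_on D. weak_grad D (\<lambda>x. v x + w x) x = weak_grad D v x + weak_grad D w x"
    by (rule *)
qed

lemma weak_grad_scale: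
  assumes "v \<in> h1_space D"
  shows "(\<lambda>x. c *\<^sub>R v x) \<in> h1_space D"
    and "AE x in lebesgue_on D. weak_grad D (\<lambda>x. c *\<^sub>R v x) x = c *\<^sub>R weak_grad D v x"
proof -
  note v = h1_l2[OF assms] weak_grad[OF assms]
  note * = weak_grad_eqI[OF l2_scale[OF v(1)] l2_scale[OF v(2)] is_weak_grad_scale[OF v(3)]]
  show "(\<lambda>x. c *\<^sub>R v x) \<in> h1_space D" by (rule *)
  show "AE x in lebesgue_on D. weak_grad D (\<lambda>x. c *\<^sub>R v x) x = c *\<^sub>R weak_grad D v x" by (rule *)
qed

lemma h1_zero: "(\<lambda>x. 0) \<in> h1_space D"
  using weak_grad_eqI(1)[OF l2_zero l2_zero] by (simp add: is_weak_grad_def)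

lemma h1_norm_nonneg: "0 \<le> h1_norm D v"
  by (simp add: h1_norm_def)

lemma h1_norm_ge: "l2_norm D v \<le> h1_norm D v" "l2_norm D (weak_grad D v) \<le> h1_norm D v"
  unfolding h1_norm_def by (rule real_le_rsqrt, simp)+

lemma h1_seminormed: "seminormed (h1_space D) (h1_norm D)"
proof
  interpret L: seminormed "l2_space D :: (real ^ 'd \<Rightarrow> real ^ 'd) set" "l2_norm D" by (rule l2_seminormed)
  interpret M: seminormed "l2_space D :: (real ^ 'd \<Rightarrow> real ^ 'd ^ 'd) set" "l2_norm D" by (rule l2_seminormed)
  fix v w :: "real ^ 'd \<Rightarrow> real ^ 'd" and c :: real
  assume v: "v \<in> h1_space D"
  have gs: "l2_norm D (weak_grad D (\<lambda>x. c *\<^sub>R v x)) = l2_norm D (\<lambda>x. c *\<^sub>R weak_grad D v x)"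
    using weak_grad_scale[OF v] weak_grad[OF v] by (intro l2_norm_cong_AE) (auto intro: weak_grad l2_scale)
  show "h1_norm D (\<lambda>x. c *\<^sub>R v x) = \<bar>c\<bar> * h1_norm D v"
    unfolding h1_norm_def gs L.N_scale[OF h1_l2[OF v]] M.N_scale[OF weak_grad(1)[OF v]]
      power_mult_distrib power2_abs distrib_left[symmetric] real_sqrt_mult by simp
  assume w: "w \<in> h1_space D"
  have "l2_norm D (weak_grad D (\<lambda>x. v x + w x)) = l2_norm D (\<lambda>x. weak_grad D v x + weak_grad D w x)"
    using weak_grad_add[OF v w] weak_grad[OF v] weak_grad[OF w]
    by (intro l2_norm_cong_AE) (auto intro: weak_grad l2_add)
  also have "\<dots> \<le> l2_norm D (weak_grad D v) + l2_norm D (weak_grad D w)"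
    using v w by (intro M.N_add weak_grad)
  finally have g: "l2_norm D (weak_grad D (\<lambda>x. v x + w x)) \<le> l2_norm D (weak_grad D v) + l2_norm D (weak_grad D w)" .
  have "h1_norm D (\<lambda>x. v x + w x) \<le> sqrt ((l2_norm D v + l2_norm D w)\<^sup>2 +
      (l2_norm D (weak_grad D v) + l2_norm D (weak_grad D w))\<^sup>2)"
    unfolding h1_norm_def using g L.N_add[OF h1_l2[OF v] h1_l2[OF w]]
    by (intro real_sqrt_le_mono add_mono power_mono l2_norm_nonneg)
  also have "\<dots> \<le> h1_norm D v + h1_norm D w"
    unfolding h1_norm_def by (rule real_sqrt_sum_squares_triangle_ineq)
  finally show "h1_norm D (\<lambda>x. v x + w x) \<le> h1_norm D v + h1_norm D w" .
qed (use h1_zero weak_grad_add(1) weak_grad_scale(1) in auto)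

end

subsection \<open>Traces and the space with Dirichlet condition\<close>

definition boundary_sq :: "(real ^ 'd) set \<Rightarrow> (real ^ 'd \<Rightarrow> real ^ 'd) \<Rightarrow> ennreal" where
  "boundary_sq D h = (\<integral>\<^sup>+x\<in>frontier D. ennreal ((norm (h x))\<^sup>2) \<partial>surface_measure)"

text \<open>The approximants of a trace are continuous on the closure of D but arbitrary outside, so
  they become Borel only after being cut off to the frontier.\<close>

definition boundary_measurable :: "(real ^ 'd) set \<Rightarrow> (real ^ 'd \<Rightarrow> real ^ 'd) \<Rightarrow> bool" where
  "boundary_measurable D h \<longleftrightarrow> (\<lambda>x. indicator (frontier D) x *\<^sub>R h x) \<in> borel_measurable borel"

lemma sets_surface_measure: "sets surface_measure = sets borel"
  using sets.sigma_sets_eq[of borel] by (simp add: surface_measure_def)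

lemma boundary_measurable_continuous:
  assumes "continuous_on (closure D) h" shows "boundary_measurable D h"
  unfolding boundary_measurable_def
  using assms by (intro borel_measurable_continuous_on_indicator)
    (auto simp: frontier_def intro: continuous_on_subset)

lemma boundary_measurable_borel: "h \<in> borel_measurable borel \<Longrightarrow> boundary_measurable D h"
  unfolding boundary_measurable_def
  by (intro borel_measurable_scaleR borel_measurable_indicator) auto

lemma boundary_measurable_diff:
  assumes "boundary_measurable D h" "boundary_measurable D k"
  shows "boundary_measurable D (\<lambda>x. h x - k x)"
  using borel_measurable_diff[OF assms[unfolded boundary_measurable_def]]
  by (simp add: boundary_measurable_def scaleR_diff_right)

lemma boundary_measurable_integrand:
  assumes "boundary_measurable D h"
  shows "(\<lambda>x. ennreal ((norm (h x))\<^sup>2) * indicator (frontier D) x) \<in> borel_measurable surface_measure"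
proof -
  have "(\<lambda>x. ennreal ((norm (indicator (frontier D) x *\<^sub>R h x))\<^sup>2)) \<in> borel_measurable borel"
    using assms unfolding boundary_measurable_def by measurable
  also have "(\<lambda>x. ennreal ((norm (indicator (frontier D) x *\<^sub>R h x))\<^sup>2)) =
    (\<lambda>x. ennreal ((norm (h x))\<^sup>2) * indicator (frontier D) x)"
    by (auto simp: indicator_def)
  finally show ?thesis by (simp add: measurable_cong_sets[OF sets_surface_measure refl])
qed

lemma boundary_sq_dominated:
  assumes "boundary_measurable D k" "\<And>x. x \<in> frontier D \<Longrightarrow> norm (h x) \<le> C * norm (k x)"
  shows "boundary_sq D h \<le> ennreal (C\<^sup>2) * boundary_sq D k"
proof -
  have "boundary_sq D h \<le> (\<integral>\<^sup>+x. ennreal (C\<^sup>2) * (ennreal ((norm (k x))\<^sup>2) * indicator (frontier D) x) \<partial>surface_measure)"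
    unfolding boundary_sq_def
  proof (rule nn_integral_mono)
    fix x
    show "ennreal ((norm (h x))\<^sup>2) * indicator (frontier D) x \<le>
      ennreal (C\<^sup>2) * (ennreal ((norm (k x))\<^sup>2) * indicator (frontier D) x)"
    proof (cases "x \<in> frontier D")
      case True
      have "(norm (h x))\<^sup>2 \<le> C\<^sup>2 * (norm (k x))\<^sup>2"
        using power_mono[OF assms(2)[OF True], of 2] by (simp add: power_mult_distrib)
      then show ?thesis using True by (simp add: ennreal_mult[symmetric])
    qed simp
  qed
  also have "\<dots> = ennreal (C\<^sup>2) * boundary_sq D k"
    unfolding boundary_sq_def by (rule nn_integral_cmult[OF boundary_measurable_integrand[OF assms(1)]])
  finally show ?thesis .
qed

text \<open>The crude factor 2 replaces Minkowski's inequality and keeps everything in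
  \<open>ennreal\<close> without square roots; it does no harm, as the lemma serves finiteness and
  convergence to 0.\<close>

lemma boundary_sq_add:
  assumes "boundary_measurable D h" "boundary_measurable D k"
  shows "boundary_sq D (\<lambda>x. h x + k x) \<le> 2 * boundary_sq D h + 2 * boundary_sq D k"
proof -
  note m = boundary_measurable_integrand[OF assms(1)] boundary_measurable_integrand[OF assms(2)]
  have "boundary_sq D (\<lambda>x. h x + k x) \<le>
    (\<integral>\<^sup>+x. 2 * (ennreal ((norm (h x))\<^sup>2) * indicator (frontier D) x) +
      2 * (ennreal ((norm (k x))\<^sup>2) * indicator (frontier D) x) \<partial>surface_measure)"
    unfolding boundary_sq_def
  proof (rule nn_integral_mono)
    fix x
    have "(norm (h x + k x))\<^sup>2 \<le> (norm (h x) + norm (k x))\<^sup>2"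
      by (intro power_mono norm_triangle_ineq) simp
    also have "\<dots> \<le> 2 * (norm (h x))\<^sup>2 + 2 * (norm (k x))\<^sup>2"
      using sum_squares_bound[of "norm (h x)" "norm (k x)"] by (simp add: power2_sum)
    finally have "ennreal ((norm (h x + k x))\<^sup>2) \<le> ennreal (2 * (norm (h x))\<^sup>2 + 2 * (norm (k x))\<^sup>2)"
      by (rule ennreal_leI)
    also have "\<dots> = 2 * ennreal ((norm (h x))\<^sup>2) + 2 * ennreal ((norm (k x))\<^sup>2)"
      by (simp add: ennreal_plus ennreal_mult)
    finally show "ennreal ((norm (h x + k x))\<^sup>2) * indicator (frontier D) x \<le>
      2 * (ennreal ((norm (h x))\<^sup>2) * indicator (frontier D) x) +
      2 * (ennreal ((norm (k x))\<^sup>2) * indicator (frontier D) x)"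
      by (simp add: indicator_def)
  qed
  also have "\<dots> = 2 * boundary_sq D h + 2 * boundary_sq D k"
    unfolding boundary_sq_def using m by (simp add: nn_integral_add nn_integral_cmult)
  finally show ?thesis .
qed

lemma is_traceD:
  assumes "is_trace D v g"
  shows "g \<in> borel_measurable borel" "boundary_sq D g < \<infinity>"
    "\<exists>\<phi>. (\<forall>n. \<phi> n \<in> h1_space D \<and> continuous_on (closure D) (\<phi> n)) \<and>
      (\<lambda>n. h1_norm D (\<lambda>x. \<phi> n x - v x)) \<longlonglongrightarrow> 0 \<and>
      (\<lambda>n. boundary_sq D (\<lambda>x. \<phi> n x - g x)) \<longlonglongrightarrow> 0"
  using assms unfolding is_trace_def boundary_sq_def by auto

lemma is_traceI:
  assumes "g \<in> borel_measurable borel" "boundary_sq D g < \<infinity>"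
    "\<And>n. \<phi> n \<in> h1_space D" "\<And>n. continuous_on (closure D) (\<phi> n)"
    "(\<lambda>n. h1_norm D (\<lambda>x. \<phi> n x - v x)) \<longlonglongrightarrow> 0"
    "(\<lambda>n. boundary_sq D (\<lambda>x. \<phi> n x - g x)) \<longlonglongrightarrow> 0"
  shows "is_trace D v g"
  using assms unfolding is_trace_def boundary_sq_def by blast

lemma ennreal_tendsto_0_le:
  fixes a b :: "nat \<Rightarrow> ennreal"
  assumes "\<And>n. a n \<le> b n" "b \<longlonglongrightarrow> 0" shows "a \<longlonglongrightarrow> 0"
  using assms by (intro tendsto_sandwich[of "\<lambda>_. 0" a sequentially b 0]) auto

lemma real_tendsto_0_le:
  fixes a b :: "nat \<Rightarrow> real"
  assumes "\<And>n. 0 \<le> a n" "\<And>n. a n \<le> b n" "b \<longlonglongrightarrow> 0" shows "a \<longlonglongrightarrow> 0"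
  using assms by (intro tendsto_sandwich[of "\<lambda>_. 0" a sequentially b 0]) auto

context bounded_open
begin

lemma is_trace_zero: "is_trace D (\<lambda>x. 0) (\<lambda>x. 0)"
proof (rule is_traceI)
  interpret H: seminormed "h1_space D" "h1_norm D" by (rule h1_seminormed)
  show "(\<lambda>n. h1_norm D (\<lambda>x. 0 - 0)) \<longlonglongrightarrow> 0" by (simp add: H.N_zero)
qed (auto simp: h1_zero boundary_sq_def)

lemma is_trace_add:
  assumes v: "v \<in> h1_space D" "is_trace D v g" and w: "w \<in> h1_space D" "is_trace D w k"
  shows "is_trace D (\<lambda>x. v x + w x) (\<lambda>x. g x + k x)"
proof -
  interpret H: seminormed "h1_space D" "h1_norm D" by (rule h1_seminormed)
  note g = is_traceD[OF v(2)] and k = is_traceD[OF w(2)]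
  obtain \<phi> where \<phi>: "\<And>n. \<phi> n \<in> h1_space D" "\<And>n. continuous_on (closure D) (\<phi> n)"
    "(\<lambda>n. h1_norm D (\<lambda>x. \<phi> n x - v x)) \<longlonglongrightarrow> 0" "(\<lambda>n. boundary_sq D (\<lambda>x. \<phi> n x - g x)) \<longlonglongrightarrow> 0"
    using g(3) by auto
  obtain \<psi> where \<psi>: "\<And>n. \<psi> n \<in> h1_space D" "\<And>n. continuous_on (closure D) (\<psi> n)"
    "(\<lambda>n. h1_norm D (\<lambda>x. \<psi> n x - w x)) \<longlonglongrightarrow> 0" "(\<lambda>n. boundary_sq D (\<lambda>x. \<psi> n x - k x)) \<longlonglongrightarrow> 0"
    using k(3) by auto
  have split: "(\<lambda>x. (a x + b x) - (c x + d x)) = (\<lambda>x. (a x - c x) + (b x - d x))"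
    for a b c d :: "real ^ 'd \<Rightarrow> real ^ 'd" by (simp add: algebra_simps)
  show ?thesis
  proof (rule is_traceI)
    show "(\<lambda>x. g x + k x) \<in> borel_measurable borel" using g(1) k(1) by measurable
    have "boundary_sq D (\<lambda>x. g x + k x) \<le> 2 * boundary_sq D g + 2 * boundary_sq D k"
      using g(1) k(1) by (intro boundary_sq_add boundary_measurable_borel)
    also have "\<dots> < \<infinity>" using g(2) k(2) by (simp add: ennreal_mult_less_top)
    finally show "boundary_sq D (\<lambda>x. g x + k x) < \<infinity>" .
    show "(\<lambda>x. \<phi> n x + \<psi> n x) \<in> h1_space D" for n using \<phi>(1) \<psi>(1) by (rule H.add_mem)
    show "continuous_on (closure D) (\<lambda>x. \<phi> n x + \<psi> n x)" for n
      using \<phi>(2) \<psi>(2) by (intro continuous_on_add)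
    show "(\<lambda>n. h1_norm D (\<lambda>x. \<phi> n x + \<psi> n x - (v x + w x))) \<longlonglongrightarrow> 0"
      unfolding split
    proof (rule real_tendsto_0_le)
      show "h1_norm D (\<lambda>x. \<phi> n x - v x + (\<psi> n x - w x)) \<le>
        h1_norm D (\<lambda>x. \<phi> n x - v x) + h1_norm D (\<lambda>x. \<psi> n x - w x)" for n
        using \<phi>(1) \<psi>(1) v(1) w(1) by (intro H.N_add H.diff_mem)
      show "(\<lambda>n. h1_norm D (\<lambda>x. \<phi> n x - v x) + h1_norm D (\<lambda>x. \<psi> n x - w x)) \<longlonglongrightarrow> 0"
        using tendsto_add[OF \<phi>(3) \<psi>(3)] by simp
    qed (rule h1_norm_nonneg)
    show "(\<lambda>n. boundary_sq D (\<lambda>x. \<phi> n x + \<psi> n x - (g x + k x))) \<longlonglongrightarrow> 0"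
      unfolding split
    proof (rule ennreal_tendsto_0_le)
      show "boundary_sq D (\<lambda>x. \<phi> n x - g x + (\<psi> n x - k x)) \<le>
        2 * boundary_sq D (\<lambda>x. \<phi> n x - g x) + 2 * boundary_sq D (\<lambda>x. \<psi> n x - k x)" for n
        using \<phi>(2) \<psi>(2) g(1) k(1)
        by (intro boundary_sq_add boundary_measurable_diff boundary_measurable_continuous boundary_measurable_borel)
      show "(\<lambda>n. 2 * boundary_sq D (\<lambda>x. \<phi> n x - g x) + 2 * boundary_sq D (\<lambda>x. \<psi> n x - k x)) \<longlonglongrightarrow> 0"
        using tendsto_add[OF ennreal_tendsto_cmult[OF _ \<phi>(4)] ennreal_tendsto_cmult[OF _ \<psi>(4)], of 2 2] by simp
    qed
  qed
qed

text \<open>The same operator \<open>T\<close> acts on the field, on its approximants and on the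
  boundary values. Since \<open>T\<close> respects differences and is bounded both in H^1 and
  pointwise, it carries an approximating sequence for g to one for \<open>T g\<close>. Covers scalar
  multiples and \<open>linear_mult\<close>.\<close>

lemma is_trace_transform:
  assumes v: "is_trace D v g" "v \<in> h1_space D"
    and T_diff: "\<And>w z. T (\<lambda>x. w x - z x) = (\<lambda>x. T w x - T z x)"
    and T_h1: "\<And>w. w \<in> h1_space D \<Longrightarrow> T w \<in> h1_space D"
    and T_norm: "\<And>w. w \<in> h1_space D \<Longrightarrow> h1_norm D (T w) \<le> C * h1_norm D w"
    and T_cont: "\<And>w. continuous_on (closure D) w \<Longrightarrow> continuous_on (closure D) (T w)"
    and T_meas: "\<And>w. w \<in> borel_measurable borel \<Longrightarrow> T w \<in> borel_measurable borel"
    and T_bound: "\<And>w x. x \<in> closure D \<Longrightarrow> norm (T w x) \<le> C * norm (w x)"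
  shows "is_trace D (T v) (T g)"
proof -
  interpret H: seminormed "h1_space D" "h1_norm D" by (rule h1_seminormed)
  note g = is_traceD[OF v(1)]
  obtain \<phi> where \<phi>: "\<And>n. \<phi> n \<in> h1_space D" "\<And>n. continuous_on (closure D) (\<phi> n)"
    "(\<lambda>n. h1_norm D (\<lambda>x. \<phi> n x - v x)) \<longlonglongrightarrow> 0" "(\<lambda>n. boundary_sq D (\<lambda>x. \<phi> n x - g x)) \<longlonglongrightarrow> 0"
    using g(3) by auto
  have fr: "x \<in> closure D" if "x \<in> frontier D" for x using that by (simp add: frontier_def)
  show ?thesis
  proof (rule is_traceI)
    show "T g \<in> borel_measurable borel" using g(1) by (rule T_meas)
    have "boundary_sq D (T g) \<le> ennreal (C\<^sup>2) * boundary_sq D g"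
      using T_bound fr by (intro boundary_sq_dominated boundary_measurable_borel g(1)) auto
    also have "\<dots> < \<infinity>" using g(2) by (simp add: ennreal_mult_less_top)
    finally show "boundary_sq D (T g) < \<infinity>" .
    show "T (\<phi> n) \<in> h1_space D" for n by (intro T_h1 \<phi>)
    show "continuous_on (closure D) (T (\<phi> n))" for n by (intro T_cont \<phi>)
    show "(\<lambda>n. h1_norm D (\<lambda>x. T (\<phi> n) x - T v x)) \<longlonglongrightarrow> 0"
      unfolding T_diff[symmetric]
    proof (rule real_tendsto_0_le)
      show "h1_norm D (T (\<lambda>x. \<phi> n x - v x)) \<le> C * h1_norm D (\<lambda>x. \<phi> n x - v x)" for n
        by (intro T_norm H.diff_mem \<phi> v)
      show "(\<lambda>n. C * h1_norm D (\<lambda>x. \<phi> n x - v x)) \<longlonglongrightarrow> 0"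
        using tendsto_mult_right_zero[OF \<phi>(3)] .
    qed (rule h1_norm_nonneg)
    show "(\<lambda>n. boundary_sq D (\<lambda>x. T (\<phi> n) x - T g x)) \<longlonglongrightarrow> 0"
      unfolding T_diff[symmetric]
    proof (rule ennreal_tendsto_0_le)
      show "boundary_sq D (T (\<lambda>x. \<phi> n x - g x)) \<le> ennreal (C\<^sup>2) * boundary_sq D (\<lambda>x. \<phi> n x - g x)" for n
        using T_bound fr by (intro boundary_sq_dominated boundary_measurable_diff
            boundary_measurable_continuous boundary_measurable_borel g(1) \<phi>(2)) auto
      show "(\<lambda>n. ennreal (C\<^sup>2) * boundary_sq D (\<lambda>x. \<phi> n x - g x)) \<longlonglongrightarrow> 0"
        using ennreal_tendsto_cmult[OF _ \<phi>(4), of "ennreal (C\<^sup>2)"] by simp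
    qed
  qed
qed

lemma h1_E0_D:
  assumes "v \<in> h1_E0 D dD"
  obtains g where "v \<in> h1_space D" "is_trace D v g" "AE x in surface_measure. x \<in> dD \<longrightarrow> g x = 0"
  using assms by (auto simp: h1_E0_def)

lemma h1_E0_h1: "v \<in> h1_E0 D dD \<Longrightarrow> v \<in> h1_space D"
  by (simp add: h1_E0_def)

lemma h1_E0_seminormed: "seminormed (h1_E0 D dD) (h1_norm D)"
proof
  interpret H: seminormed "h1_space D" "h1_norm D" by (rule h1_seminormed)
  show "(\<lambda>x. 0) \<in> h1_E0 D dD"
    unfolding h1_E0_def using is_trace_zero h1_zero by auto
  fix v w and c :: real
  assume "v \<in> h1_E0 D dD"
  then obtain g where v: "v \<in> h1_space D" "is_trace D v g" "AE x in surface_measure. x \<in> dD \<longrightarrow> g x = 0"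
    by (rule h1_E0_D)
  show "h1_norm D (\<lambda>x. c *\<^sub>R v x) = \<bar>c\<bar> * h1_norm D v" using v(1) by (rule H.N_scale)
  have "is_trace D (\<lambda>x. c *\<^sub>R v x) (\<lambda>x. c *\<^sub>R g x)"
    by (rule is_trace_transform[OF v(2,1), where T = "\<lambda>w x. c *\<^sub>R w x" and C = "\<bar>c\<bar>"])
      (auto intro!: continuous_intros H.scale_mem simp: H.N_scale scaleR_diff_right)
  moreover have "AE x in surface_measure. x \<in> dD \<longrightarrow> c *\<^sub>R g x = 0" using v(3) by eventually_elim simp
  ultimately show "(\<lambda>x. c *\<^sub>R v x) \<in> h1_E0 D dD"
    unfolding h1_E0_def using H.scale_mem[OF v(1)] by blast
  assume "w \<in> h1_E0 D dD"
  then obtain k where w: "w \<in> h1_space D" "is_trace D w k" "AE x in surface_measure. x \<in> dD \<longrightarrow> k x = 0"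
    by (rule h1_E0_D)
  show "h1_norm D (\<lambda>x. v x + w x) \<le> h1_norm D v + h1_norm D w" using v(1) w(1) by (rule H.N_add)
  have "AE x in surface_measure. x \<in> dD \<longrightarrow> g x + k x = 0" using v(3) w(3) by eventually_elim simp
  with is_trace_add[OF v(1,2) w(1,2)] show "(\<lambda>x. v x + w x) \<in> h1_E0 D dD"
    unfolding h1_E0_def using H.add_mem[OF v(1) w(1)] by blast
qed

section \<open>Multiplication of a component by a linear vector field\<close>

definition linear_mult :: "real ^ 'd ^ 'd \<Rightarrow> 'd \<Rightarrow> (real ^ 'd \<Rightarrow> real ^ 'd) \<Rightarrow> real ^ 'd \<Rightarrow> real ^ 'd" where
  "linear_mult A i v x = (v x $ i) *\<^sub>R (A *v x)"

text \<open>The product rule for the Jacobian of x |-> v_i(x) A x: the outer product of A x with the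
  gradient of v_i, plus v_i A. For vanishing gradient only the multiple of A survives.\<close>

definition linear_mult_grad :: "real ^ 'd ^ 'd \<Rightarrow> 'd \<Rightarrow> (real ^ 'd \<Rightarrow> real ^ 'd) \<Rightarrow> real ^ 'd \<Rightarrow> real ^ 'd ^ 'd" where
  "linear_mult_grad A i v x = (\<chi> a. ((A *v x) $ a) *\<^sub>R (weak_grad D v x $ i)) + (v x $ i) *\<^sub>R A"

lemma continuous_matrix_vector: "continuous_on S (\<lambda>x. A *v (x :: real ^ 'd) :: real ^ 'd)"
  by (rule linear_continuous_on) simp

lemma norm_outer: "norm (\<chi> a. p $ a *\<^sub>R (q :: real ^ 'd) :: real ^ 'd ^ 'd) = norm (p :: real ^ 'd) * norm q"
  unfolding norm_vec_def[of "\<chi> a. p $ a *\<^sub>R q"] norm_vec_def[of p]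
  by (simp add: L2_set_left_distrib)

text \<open>The multiplier is moved to the other side: \<phi> times a component of A x is again a
  C^1 test function supported in K, so the weak gradient of v can be tested with it directly, with
  no approximation of v by smooth fields.\<close>

lemma linear_mult_weak_grad:
  assumes v: "v \<in> h1_space D"
  shows "is_weak_grad D (linear_mult A i v) (linear_mult_grad A i v)"
proof (rule is_weak_gradI)
  note G = weak_grad[OF v]
  fix \<phi> \<phi>' K a b
  assume \<phi>: "\<And>x. GDERIV \<phi> x :> \<phi>' x" "continuous_on UNIV \<phi>'" and
    K: "compact K" "K \<subseteq> D" "\<And>x. x \<notin> K \<Longrightarrow> \<phi> x = 0"
  define \<psi> where "\<psi> x = (A *v x) $ a * \<phi> x" for x
  define \<psi>' where "\<psi>' x = (A *v x) $ a *\<^sub>R \<phi>' x + \<phi> x *\<^sub>R A $ a" for x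
  have \<phi>c: "continuous_on UNIV \<phi>" using \<phi> by (intro c1_fun_continuous) (auto simp: c1_fun_def)
  have "GDERIV (\<lambda>x. (A *v x) $ a) x :> A $ a" for x
    unfolding gderiv_def matrix_vector_mul_component
    by (auto intro!: derivative_eq_intros simp: inner_commute)
  then have \<psi>: "GDERIV \<psi> x :> \<psi>' x" for x
    unfolding \<psi>_def \<psi>'_def using \<phi>(1) by (rule GDERIV_mult)
  have \<psi>c: "continuous_on UNIV \<psi>'"
    unfolding \<psi>'_def by (intro continuous_intros continuous_matrix_vector \<phi>(2) \<phi>c)
  have eq: "(LINT x|lebesgue_on D. v x $ i * \<psi>' x $ b) = - (LINT x|lebesgue_on D. weak_grad D v x $ i $ b * \<psi> x)"
    by (rule is_weak_gradD[OF G(2) \<psi> \<psi>c K(1,2)]) (simp add: \<psi>_def K(3))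
  have int1: "integrable (lebesgue_on D) (\<lambda>x. v x $ i * ((A *v x) $ a * \<phi>' x $ b))"
    by (intro l2_integrable l2_mult_continuous l2_vec_nth h1_l2 v continuous_intros continuous_matrix_vector \<phi>(2))
  have int2: "integrable (lebesgue_on D) (\<lambda>x. v x $ i * (\<phi> x * A $ a $ b))"
    by (intro l2_integrable l2_mult_continuous l2_vec_nth h1_l2 v continuous_intros \<phi>c)
  have int3: "integrable (lebesgue_on D) (\<lambda>x. weak_grad D v x $ i $ b * ((A *v x) $ a * \<phi> x))"
    by (intro l2_integrable l2_mult_continuous l2_vec_nth G continuous_intros continuous_matrix_vector \<phi>c)
  have "(LINT x|lebesgue_on D. linear_mult A i v x $ a * \<phi>' x $ b) =
    (LINT x|lebesgue_on D. v x $ i * \<psi>' x $ b) - (LINT x|lebesgue_on D. v x $ i * (\<phi> x * A $ a $ b))"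
    using int1 int2 by (simp add: linear_mult_def \<psi>'_def distrib_left mult.assoc)
  also have "\<dots> = - (LINT x|lebesgue_on D. linear_mult_grad A i v x $ a $ b * \<phi> x)"
  proof -
    have *: "linear_mult_grad A i v x $ a $ b * \<phi> x =
      weak_grad D v x $ i $ b * ((A *v x) $ a * \<phi> x) + v x $ i * (\<phi> x * A $ a $ b)" for x
      by (simp add: linear_mult_grad_def algebra_simps)
    show ?thesis unfolding * eq \<psi>_def using int2 int3 by simp
  qed
  finally show "(LINT x|lebesgue_on D. linear_mult A i v x $ a * \<phi>' x $ b) =
    - (LINT x|lebesgue_on D. linear_mult_grad A i v x $ a $ b * \<phi> x)" .
qed

lemma linear_mult_h1:
  obtains C where "0 \<le> C" "\<And>w x. x \<in> closure D \<Longrightarrow> norm (linear_mult A i w x) \<le> C * norm (w x)"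
    "\<And>v. v \<in> h1_space D \<Longrightarrow> linear_mult_grad A i v \<in> l2_space D"
    "\<And>v. v \<in> h1_space D \<Longrightarrow> linear_mult A i v \<in> h1_space D"
    "\<And>v. v \<in> h1_space D \<Longrightarrow> AE x in lebesgue_on D. weak_grad D (linear_mult A i v) x = linear_mult_grad A i v x"
    "\<And>v. v \<in> h1_space D \<Longrightarrow> h1_norm D (linear_mult A i v) \<le> C * h1_norm D v"
proof -
  interpret M: seminormed "l2_space D :: (real ^ 'd \<Rightarrow> real ^ 'd ^ 'd) set" "l2_norm D" by (rule l2_seminormed)
  obtain B where B: "0 \<le> B" "\<And>x. x \<in> closure D \<Longrightarrow> norm (A *v x) \<le> B"
    using continuous_bounded_D[OF continuous_matrix_vector[of UNIV A]] by metis
  have bound: "norm (linear_mult A i w x) \<le> B * norm (w x)" if "x \<in> closure D" for w x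
  proof -
    have "norm (linear_mult A i w x) = \<bar>w x $ i\<bar> * norm (A *v x)" by (simp add: linear_mult_def)
    also have "\<dots> \<le> norm (w x) * B"
      using B(2)[OF that] component_le_norm_cart by (intro mult_mono) auto
    finally show ?thesis by (simp add: mult.commute)
  qed
  have bound_D: "AE x in lebesgue_on D. norm (linear_mult A i w x) \<le> B * norm (w x)" for w
    using bound closure_subset by (intro AE_D) blast
  \<comment> \<open>\<open>B\<close> from the function and \<open>B + norm A\<close> from its
    gradient. A single constant has to serve both the pointwise and the H^1 bound in
    \<open>is_trace_transform\<close>.\<close>
  define C where "C = 2 * B + norm A"
  have BC: "0 \<le> C" "B \<le> C" using B(1) by (auto simp: C_def)
  have main: "linear_mult_grad A i v \<in> l2_space D \<and> linear_mult A i v \<in> h1_space D \<and>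
    (AE x in lebesgue_on D. weak_grad D (linear_mult A i v) x = linear_mult_grad A i v x) \<and>
    h1_norm D (linear_mult A i v) \<le> C * h1_norm D v" if v: "v \<in> h1_space D" for v
  proof -
    note vl = h1_l2[OF v] and G = weak_grad[OF v]
    have [measurable]: "(\<lambda>x. A *v x) \<in> borel_measurable (lebesgue_on D)"
      by (rule continuous_measurable_D[OF continuous_matrix_vector])
    have vi[measurable]: "(\<lambda>x. v x $ i) \<in> borel_measurable (lebesgue_on D)"
      by (rule l2_spaceD(1)[OF l2_vec_nth[OF vl]])
    have m1: "linear_mult A i v \<in> borel_measurable (lebesgue_on D)"
      unfolding linear_mult_def[abs_def] by measurable
    note w1 = l2_dominated[OF vl m1 bound_D[of v]]
    have m2: "(\<lambda>x. \<chi> a. ((A *v x) $ a) *\<^sub>R (weak_grad D v x $ i)) \<in> borel_measurable (lebesgue_on D)"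
      by (rule borel_measurable_continuous_Pair[where H = "\<lambda>p q. \<chi> a. p $ a *\<^sub>R q"])
        (auto intro!: continuous_intros l2_spaceD(1)[OF l2_vec_nth[OF G(1)]])
    have d2: "AE x in lebesgue_on D. norm (\<chi> a. ((A *v x) $ a) *\<^sub>R (weak_grad D v x $ i) :: real ^ 'd ^ 'd)
      \<le> B * norm (weak_grad D v x)"
    proof (rule AE_D)
      fix x assume "x \<in> D"
      then have "norm (A *v x) \<le> B" using B(2) closure_subset by blast
      then show "norm (\<chi> a. ((A *v x) $ a) *\<^sub>R (weak_grad D v x $ i) :: real ^ 'd ^ 'd) \<le> B * norm (weak_grad D v x)"
        unfolding norm_outer by (intro mult_mono Finite_Cartesian_Product.norm_nth_le B(1)) auto
    qed
    note w2 = l2_dominated[OF G(1) m2 d2]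
    have m3: "(\<lambda>x. (v x $ i) *\<^sub>R A) \<in> borel_measurable (lebesgue_on D)" by measurable
    have d3: "AE x in lebesgue_on D. norm ((v x $ i) *\<^sub>R A) \<le> norm A * norm (v x)"
      using component_le_norm_cart[of "v _" i] by (intro AE_I2) (simp add: mult.commute mult_left_mono)
    note w3 = l2_dominated[OF vl m3 d3]
    have Hl: "linear_mult_grad A i v \<in> l2_space D"
      unfolding linear_mult_grad_def[abs_def] using w2(1) w3(1) by (rule l2_add)
    note eq = weak_grad_eqI[OF w1(1) Hl linear_mult_weak_grad[OF v]]
    have "l2_norm D (weak_grad D (linear_mult A i v)) = l2_norm D (linear_mult_grad A i v)"
      using weak_grad(1)[OF eq(1)] Hl eq(2) by (rule l2_norm_cong_AE)
    also have "\<dots> \<le> B * l2_norm D (weak_grad D v) + norm A * l2_norm D v"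
      unfolding linear_mult_grad_def[abs_def] using M.N_add[OF w2(1) w3(1)] w2(2)[OF B(1)] w3(2) by simp
    also have "\<dots> \<le> B * h1_norm D v + norm A * h1_norm D v"
      using h1_norm_ge[of v] B(1) by (intro add_mono mult_left_mono) auto
    finally have g: "l2_norm D (weak_grad D (linear_mult A i v)) \<le> (B + norm A) * h1_norm D v"
      by (simp add: distrib_right)
    have l: "l2_norm D (linear_mult A i v) \<le> B * h1_norm D v"
      using w1(2)[OF B(1)] mult_left_mono[OF h1_norm_ge(1)[of v] B(1)] by linarith
    have "h1_norm D (linear_mult A i v) \<le> l2_norm D (linear_mult A i v) + l2_norm D (weak_grad D (linear_mult A i v))"
      unfolding h1_norm_def by (rule sqrt_sum_squares_le_sum) (rule l2_norm_nonneg)+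
    also have "\<dots> \<le> C * h1_norm D v"
      using g l by (simp add: C_def algebra_simps)
    finally show ?thesis using eq Hl by blast
  qed
  show thesis
  proof (rule that[OF BC(1)])
    show "norm (linear_mult A i w x) \<le> C * norm (w x)" if "x \<in> closure D" for w x
      using bound[OF that, of w] mult_right_mono[OF BC(2) norm_ge_zero[of "w x"]] by linarith
  qed (use main in blast)+
qed

text \<open>
  If \<open>v\<close> satisfies the Dirichlet condition and has gradient zero, then so does \<open>v\<^sub>i\<close> times an
  infinitesimal rotation, and this product has strain zero. No trace theorem or Poincare inequality
  is needed, only Korn's inequality.
\<close>

lemma korn_grad_zero_imp_zero:
  assumes dim: "CARD('d) \<ge> 2" and korn: "korn_const D dD CK"
    and v: "v \<in> h1_E0 D dD" and G0: "AE x in lebesgue_on D. weak_grad D v x = 0"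
  shows "AE x in lebesgue_on D. v x = 0"
proof -
  \<comment> \<open>Dimension at least 2 provides two distinct coordinates, hence a nonzero
    antisymmetric matrix.\<close>
  have "\<exists>j k :: 'd. j \<noteq> k"
  proof (rule ccontr)
    assume "\<not> ?thesis"
    then have "CARD('d) \<le> 1" by (metis One_nat_def UNIV_I card_le_Suc0_iff_eq finite_code)
    then show False using dim by simp
  qed
  then obtain j k :: 'd where jk: "j \<noteq> k" by blast
  define A :: "real ^ 'd ^ 'd" where
    "A = (\<chi> a b. if a = j \<and> b = k then 1 else if a = k \<and> b = j then - 1 else 0)"
  have A: "transpose A = - A" "A \<noteq> 0"
  proof -
    show "transpose A = - A" using jk by (auto simp: A_def transpose_def vec_eq_iff)
    have "A $ j $ k = 1" by (simp add: A_def)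
    then show "A \<noteq> 0" by auto
  qed
  have vh: "v \<in> h1_space D" using v by (rule h1_E0_h1)
  have "AE x in lebesgue_on D. v x $ i = 0" for i
  proof -
    obtain C where C: "0 \<le> C" "\<And>w x. x \<in> closure D \<Longrightarrow> norm (linear_mult A i w x) \<le> C * norm (w x)"
      "\<And>v. v \<in> h1_space D \<Longrightarrow> linear_mult_grad A i v \<in> l2_space D"
      "\<And>v. v \<in> h1_space D \<Longrightarrow> linear_mult A i v \<in> h1_space D"
      "\<And>v. v \<in> h1_space D \<Longrightarrow> AE x in lebesgue_on D. weak_grad D (linear_mult A i v) x = linear_mult_grad A i v x"
      "\<And>v. v \<in> h1_space D \<Longrightarrow> h1_norm D (linear_mult A i v) \<le> C * h1_norm D v"
      by (rule linear_mult_h1[of A i]) (rule that)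
    obtain g where g: "is_trace D v g" "AE x in surface_measure. x \<in> dD \<longrightarrow> g x = 0"
      using v by (auto simp: h1_E0_def)
    let ?w = "linear_mult A i v"
    have "is_trace D ?w (linear_mult A i g)"
    proof (rule is_trace_transform[OF g(1) vh, where C = C])
      show "linear_mult A i (\<lambda>x. w x - z x) = (\<lambda>x. linear_mult A i w x - linear_mult A i z x)" for w z
        by (simp add: linear_mult_def[abs_def] scaleR_diff_left)
      show "continuous_on (closure D) (linear_mult A i w)" if "continuous_on (closure D) w" for w
        unfolding linear_mult_def[abs_def] using that by (intro continuous_intros continuous_matrix_vector)
      show "linear_mult A i w \<in> borel_measurable borel" if [measurable]: "w \<in> borel_measurable borel" for w
      proof -
        have "(\<lambda>x. w x $ i) \<in> borel_measurable borel"
          by (rule borel_measurable_continuous_on[where f = "\<lambda>z. z $ i"]) (auto intro!: continuous_intros that)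
        moreover have "(\<lambda>x. A *v x) \<in> borel_measurable borel"
          by (rule borel_measurable_continuous_onI[OF continuous_matrix_vector])
        ultimately show ?thesis unfolding linear_mult_def[abs_def] by (rule borel_measurable_scaleR)
      qed
    qed (fact C(2,4,6))+
    moreover have "AE x in surface_measure. x \<in> dD \<longrightarrow> linear_mult A i g x = 0"
      using g(2) by eventually_elim (simp add: linear_mult_def)
    ultimately have w: "?w \<in> h1_E0 D dD" unfolding h1_E0_def using C(4)[OF vh] by blast
    have Gw: "AE x in lebesgue_on D. weak_grad D ?w x = (v x $ i) *\<^sub>R A"
      using C(5)[OF vh] G0
      by eventually_elim (simp add: linear_mult_grad_def vec_eq_iff)
    then have "AE x in lebesgue_on D. strain D ?w x \<bullet> strain D ?w x = 0"
    proof eventually_elim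
      case (elim x)
      have "transpose ((v x $ i) *\<^sub>R A) = (v x $ i) *\<^sub>R transpose A"
        by (simp add: transpose_def vec_eq_iff)
      also have "\<dots> = - ((v x $ i) *\<^sub>R A)" by (simp add: A(1))
      finally show ?case by (simp add: strain_def elim)
    qed
    then have "(LINT x|lebesgue_on D. strain D ?w x \<bullet> strain D ?w x) = 0"
      by (rule integral_eq_zero_AE)
    moreover have "CK * (l2_norm D (weak_grad D ?w))\<^sup>2 \<le> (LINT x|lebesgue_on D. strain D ?w x \<bullet> strain D ?w x)"
      using korn w unfolding korn_const_def by blast
    \<comment> \<open>Korn's inequality forces the gradient of the product to vanish as well; that
      gradient is v_i A, and \<open>A\<close> is nonzero.\<close>
    ultimately have "CK * (l2_norm D (weak_grad D ?w))\<^sup>2 \<le> 0" "0 < CK"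
      using korn unfolding korn_const_def by simp_all
    then have "l2_norm D (weak_grad D ?w) = 0" by (simp add: mult_le_0_iff)
    then have "AE x in lebesgue_on D. weak_grad D ?w x = 0"
      by (rule l2_norm_eq_0[OF weak_grad(1)[OF C(4)[OF vh]]])
    with Gw show ?thesis by eventually_elim (use A(2) in simp)
  qed
  then have "AE x in lebesgue_on D. \<forall>i. v x $ i = 0" unfolding AE_all_countable by blast
  then show ?thesis by eventually_elim (simp add: vec_eq_iff)
qed

end

subsection \<open>Bochner spaces and pairings\<close>

definition strongly_measurable ::
    "'y measure \<Rightarrow> ('x \<Rightarrow> 'b::real_vector) set \<Rightarrow> (('x \<Rightarrow> 'b) \<Rightarrow> real) \<Rightarrow> ('y \<Rightarrow> 'x \<Rightarrow> 'b) \<Rightarrow> bool" where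
  "strongly_measurable P X N v \<longleftrightarrow> (\<forall>y\<in>space P. v y \<in> X) \<and>
     (\<exists>s. (\<forall>n :: nat. simple_function P (s n) \<and> s n ` space P \<subseteq> X) \<and>
          (\<forall>y\<in>space P. (\<lambda>n. N (\<lambda>x. s n y x - v y x)) \<longlonglongrightarrow> 0))"

lemma bochner_L2_iff:
  "v \<in> bochner_L2 P X N \<longleftrightarrow> strongly_measurable P X N v \<and> integrable P (\<lambda>y. (N (v y))\<^sup>2)"
  by (simp add: bochner_L2_def strongly_measurable_def)

lemma strongly_measurableE:
  assumes "strongly_measurable P X N v"
  obtains s where "\<And>n. simple_function P (s n)" "\<And>n y. y \<in> space P \<Longrightarrow> s n y \<in> X"
    "\<And>y. y \<in> space P \<Longrightarrow> (\<lambda>n. N (\<lambda>x. s n y x - v y x)) \<longlonglongrightarrow> 0"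
proof -
  from assms obtain s where "\<forall>n :: nat. simple_function P (s n) \<and> s n ` space P \<subseteq> X"
    "\<forall>y\<in>space P. (\<lambda>n. N (\<lambda>x. s n y x - v y x)) \<longlonglongrightarrow> 0"
    unfolding strongly_measurable_def by blast
  then show thesis by (intro that[of s]) (auto simp: image_subset_iff)
qed

lemma strongly_measurableI:
  assumes "\<And>y. y \<in> space P \<Longrightarrow> v y \<in> X" "\<And>n. simple_function P (s n)"
    "\<And>n y. y \<in> space P \<Longrightarrow> s n y \<in> X"
    "\<And>y. y \<in> space P \<Longrightarrow> (\<lambda>n. N (\<lambda>x. s n y x - v y x)) \<longlonglongrightarrow> 0"
  shows "strongly_measurable P X N v"
  unfolding strongly_measurable_def
  using assms by (intro conjI ballI exI[of _ s] allI) auto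

lemma strongly_measurable_mem: "strongly_measurable P X N v \<Longrightarrow> y \<in> space P \<Longrightarrow> v y \<in> X"
  by (simp add: strongly_measurable_def)

lemma bochner_L2_mem: "v \<in> bochner_L2 P X N \<Longrightarrow> y \<in> space P \<Longrightarrow> v y \<in> X"
  by (simp add: bochner_L2_def)

text \<open>A Lipschitz estimate for differences is used in place of linearity, because the
  operators of interest, such as \<open>weak_div D\<close>, are linear only up to null sets. Simple
  approximants are mapped to simple approximants.\<close>

lemma strongly_measurable_transform:
  assumes X: "seminormed X N" and Y: "seminormed Y N'" and v: "strongly_measurable P X N v"
    and T_mem: "\<And>z. z \<in> X \<Longrightarrow> T z \<in> Y"
    and T_lip: "\<And>z z'. z \<in> X \<Longrightarrow> z' \<in> X \<Longrightarrow> N' (\<lambda>x. T z x - T z' x) \<le> C * N (\<lambda>x. z x - z' x)"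
  shows "strongly_measurable P Y N' (\<lambda>y. T (v y))"
proof -
  interpret Y: seminormed Y N' by fact
  obtain s where s: "\<And>n. simple_function P (s n)" "\<And>n y. y \<in> space P \<Longrightarrow> s n y \<in> X"
    "\<And>y. y \<in> space P \<Longrightarrow> (\<lambda>n. N (\<lambda>x. s n y x - v y x)) \<longlonglongrightarrow> 0"
    by (rule strongly_measurableE[OF v]) (rule that)
  note vX = strongly_measurable_mem[OF v]
  show ?thesis
  proof (rule strongly_measurableI)
    show "simple_function P (\<lambda>y. T (s n y))" for n
      using simple_function_compose[OF s(1), of T n] by (simp add: comp_def)
    show "(\<lambda>n. N' (\<lambda>x. T (s n y) x - T (v y) x)) \<longlonglongrightarrow> 0" if "y \<in> space P" for y
    proof (rule real_tendsto_0_le)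
      show "0 \<le> N' (\<lambda>x. T (s n y) x - T (v y) x)" for n
        by (intro Y.N_nonneg Y.diff_mem T_mem s vX that)
      show "N' (\<lambda>x. T (s n y) x - T (v y) x) \<le> C * N (\<lambda>x. s n y x - v y x)" for n
        by (intro T_lip s vX that)
      show "(\<lambda>n. C * N (\<lambda>x. s n y x - v y x)) \<longlonglongrightarrow> 0"
        by (rule tendsto_mult_right_zero[OF s(3)[OF that]])
    qed
  qed (intro T_mem s vX; assumption)+
qed

lemma tensor_space_induct [consumes 1, case_names zero step]:
  assumes "u \<in> tensor_space V S" and zero: "Q (\<lambda>y x. 0)"
    and step: "\<And>u s v. s \<in> S \<Longrightarrow> v \<in> V \<Longrightarrow> u \<in> tensor_space V S \<Longrightarrow> Q u \<Longrightarrow>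
      Q (\<lambda>y x. u y x + s y *\<^sub>R v x)"
  shows "Q u"
proof -
  obtain n :: nat and s v where u: "u = (\<lambda>y x. \<Sum>i<n. s i y *\<^sub>R v i x)"
    and sv: "\<forall>i<n. s i \<in> S" "\<forall>i<n. v i \<in> V"
    using assms(1) unfolding tensor_space_def by blast
  have "m \<le> n \<Longrightarrow> Q (\<lambda>y x. \<Sum>i<m. s i y *\<^sub>R v i x)" for m
  proof (induction m)
    case 0
    then show ?case using zero by simp
  next
    case (Suc m)
    have "(\<lambda>y x. \<Sum>i<m. s i y *\<^sub>R v i x) \<in> tensor_space V S"
      unfolding tensor_space_def using sv Suc.prems
      by (intro CollectI exI[of _ m] exI[of _ s] exI[of _ v]) auto
    then show ?case using step[of "s m" "v m"] sv Suc by simp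
  qed
  then show ?thesis unfolding u by simp
qed

context seminormed
begin

lemma strongly_measurable_norm:
  assumes "strongly_measurable P X N v"
  shows "(\<lambda>y. N (v y)) \<in> borel_measurable P"
proof -
  obtain s where s: "\<And>n. simple_function P (s n)" "\<And>n y. y \<in> space P \<Longrightarrow> s n y \<in> X"
    "\<And>y. y \<in> space P \<Longrightarrow> (\<lambda>n. N (\<lambda>x. s n y x - v y x)) \<longlonglongrightarrow> 0"
    by (rule strongly_measurableE[OF assms]) (rule that)
  note vX = strongly_measurable_mem[OF assms]
  show ?thesis
  proof (rule borel_measurable_LIMSEQ_real)
    show "(\<lambda>y. N (s n y)) \<in> borel_measurable P" for n
      using simple_function_compose[OF s(1), of N n]
      by (intro borel_measurable_simple_function) (simp add: comp_def)
    fix y assume y: "y \<in> space P"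
    have "(\<lambda>n. N (s n y) - N (v y)) \<longlonglongrightarrow> 0"
      by (rule Lim_null_comparison[OF _ s(3)[OF y]]) (use N_diff_bound s(2) vX y in auto)
    then show "(\<lambda>n. N (s n y)) \<longlonglongrightarrow> N (v y)" by (simp add: LIM_zero_iff)
  qed
qed

lemma bochner_L2_dominated:
  assumes "strongly_measurable P X N v" "integrable P g" "\<And>y. y \<in> space P \<Longrightarrow> (N (v y))\<^sup>2 \<le> g y"
  shows "v \<in> bochner_L2 P X N"
  unfolding bochner_L2_iff
proof
  have [measurable]: "(\<lambda>y. N (v y)) \<in> borel_measurable P"
    using assms(1) by (rule strongly_measurable_norm)
  show "integrable P (\<lambda>y. (N (v y))\<^sup>2)"
  proof (rule Bochner_Integration.integrable_bound[OF assms(2)])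
    show "AE y in P. norm ((N (v y))\<^sup>2) \<le> norm (g y)"
      using assms(3) by (intro AE_I2) (auto intro: order_trans[OF _ abs_ge_self])
  qed measurable
qed (fact assms(1))

lemma strongly_measurable_add:
  assumes v: "strongly_measurable P X N v" and w: "strongly_measurable P X N w"
  shows "strongly_measurable P X N (\<lambda>y x. v y x + w y x)"
proof -
  obtain s where s: "\<And>n. simple_function P (s n)" "\<And>n y. y \<in> space P \<Longrightarrow> s n y \<in> X"
    "\<And>y. y \<in> space P \<Longrightarrow> (\<lambda>n. N (\<lambda>x. s n y x - v y x)) \<longlonglongrightarrow> 0"
    by (rule strongly_measurableE[OF v]) (rule that)
  obtain t where t: "\<And>n. simple_function P (t n)" "\<And>n y. y \<in> space P \<Longrightarrow> t n y \<in> X"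
    "\<And>y. y \<in> space P \<Longrightarrow> (\<lambda>n. N (\<lambda>x. t n y x - w y x)) \<longlonglongrightarrow> 0"
    by (rule strongly_measurableE[OF w]) (rule that)
  note vX = strongly_measurable_mem[OF v] and wX = strongly_measurable_mem[OF w]
  show ?thesis
  proof (rule strongly_measurableI)
    show "simple_function P (\<lambda>y x. s n y x + t n y x)" for n
      by (rule simple_function_compose2[OF s(1) t(1), where h = "\<lambda>a b x. a x + b x"])
    fix y assume y: "y \<in> space P"
    have split: "(\<lambda>x. s n y x + t n y x - (v y x + w y x)) = (\<lambda>x. (s n y x - v y x) + (t n y x - w y x))" for n
      by (simp add: algebra_simps)
    show "(\<lambda>n. N (\<lambda>x. s n y x + t n y x - (v y x + w y x))) \<longlonglongrightarrow> 0"
      unfolding split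
    proof (rule real_tendsto_0_le)
      show "0 \<le> N (\<lambda>x. (s n y x - v y x) + (t n y x - w y x))" for n
        by (intro N_nonneg add_mem diff_mem s t vX wX y)
      show "N (\<lambda>x. (s n y x - v y x) + (t n y x - w y x)) \<le>
        N (\<lambda>x. s n y x - v y x) + N (\<lambda>x. t n y x - w y x)" for n
        by (intro N_add diff_mem s t vX wX y)
      show "(\<lambda>n. N (\<lambda>x. s n y x - v y x) + N (\<lambda>x. t n y x - w y x)) \<longlonglongrightarrow> 0"
        using tendsto_add[OF s(3)[OF y] t(3)[OF y]] by simp
    qed
  qed (intro add_mem s t vX wX; assumption)+
qed

lemma bochner_L2_add:
  assumes v: "v \<in> bochner_L2 P X N" and w: "w \<in> bochner_L2 P X N"
  shows "(\<lambda>y x. v y x + w y x) \<in> bochner_L2 P X N"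
proof (rule bochner_L2_dominated)
  show "strongly_measurable P X N (\<lambda>y x. v y x + w y x)"
    using v w by (auto simp: bochner_L2_iff intro: strongly_measurable_add)
  show "integrable P (\<lambda>y. 2 * (N (v y))\<^sup>2 + 2 * (N (w y))\<^sup>2)"
    using v w by (simp add: bochner_L2_iff)
  fix y assume y: "y \<in> space P"
  note vw = bochner_L2_mem[OF v y] bochner_L2_mem[OF w y]
  have "(N (\<lambda>x. v y x + w y x))\<^sup>2 \<le> (N (v y) + N (w y))\<^sup>2"
    using N_add[OF vw] N_nonneg[OF add_mem[OF vw]] by (rule power_mono)
  also have "\<dots> \<le> 2 * (N (v y))\<^sup>2 + 2 * (N (w y))\<^sup>2"
    using sum_squares_bound[of "N (v y)" "N (w y)"] by (simp add: power2_sum)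
  finally show "(N (\<lambda>x. v y x + w y x))\<^sup>2 \<le> 2 * (N (v y))\<^sup>2 + 2 * (N (w y))\<^sup>2" .
qed

lemma bochner_L2_scale:
  assumes v: "v \<in> bochner_L2 P X N"
  shows "(\<lambda>y x. c *\<^sub>R v y x) \<in> bochner_L2 P X N"
proof (rule bochner_L2_dominated)
  show "strongly_measurable P X N (\<lambda>y x. c *\<^sub>R v y x)"
    using seminormed_axioms seminormed_axioms
  proof (rule strongly_measurable_transform[where T = "\<lambda>z x. c *\<^sub>R z x" and C = "\<bar>c\<bar>"])
    show "strongly_measurable P X N v" using v by (simp add: bochner_L2_iff)
    show "N (\<lambda>x. c *\<^sub>R z x - c *\<^sub>R z' x) \<le> \<bar>c\<bar> * N (\<lambda>x. z x - z' x)" if "z \<in> X" "z' \<in> X" for z z'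
      using N_scale[OF diff_mem[OF that], of c] by (simp add: scaleR_diff_right)
  qed (rule scale_mem)
  show "integrable P (\<lambda>y. c\<^sup>2 * (N (v y))\<^sup>2)" using v by (simp add: bochner_L2_iff)
  show "(N (\<lambda>x. c *\<^sub>R v y x))\<^sup>2 \<le> c\<^sup>2 * (N (v y))\<^sup>2" if "y \<in> space P" for y
    using N_scale[OF bochner_L2_mem[OF v that]] by (simp add: power_mult_distrib)
qed

lemma bochner_L2_diff:
  assumes "v \<in> bochner_L2 P X N" "w \<in> bochner_L2 P X N"
  shows "(\<lambda>y x. v y x - w y x) \<in> bochner_L2 P X N"
  using bochner_L2_add[OF assms(1) bochner_L2_scale[OF assms(2), of "- 1"]] by simp

text \<open>Real simple functions approximating s, multiplied by the fixed v, are simple functions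
  into \<open>X\<close>, and their error is the scalar error times N v.\<close>

lemma bochner_L2_product:
  assumes P: "finite_measure P" and s: "s \<in> borel_measurable P"
    and b: "\<And>y. y \<in> space P \<Longrightarrow> \<bar>s y\<bar> \<le> b" and v: "v \<in> X"
  shows "(\<lambda>y x. s y *\<^sub>R v x) \<in> bochner_L2 P X N"
proof (rule bochner_L2_dominated)
  obtain F where F: "\<And>i. simple_function P (F i)" "\<And>y. y \<in> space P \<Longrightarrow> (\<lambda>i. F i y) \<longlonglongrightarrow> s y"
    using borel_measurable_implies_sequence_metric[OF s, of 0] by blast
  show "strongly_measurable P X N (\<lambda>y x. s y *\<^sub>R v x)"
  proof (rule strongly_measurableI[where s = "\<lambda>i y x. F i y *\<^sub>R v x"])
    show "simple_function P (\<lambda>y x. F i y *\<^sub>R v x)" for i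
      using simple_function_compose[OF F(1), of "\<lambda>a x. a *\<^sub>R v x" i] by (simp add: comp_def)
    show "(\<lambda>i. N (\<lambda>x. F i y *\<^sub>R v x - s y *\<^sub>R v x)) \<longlonglongrightarrow> 0" if "y \<in> space P" for y
    proof -
      have "(\<lambda>i. \<bar>F i y - s y\<bar> * N v) \<longlonglongrightarrow> \<bar>s y - s y\<bar> * N v"
        by (intro tendsto_intros F that)
      then show ?thesis using N_scale[OF v] by (simp flip: scaleR_diff_left)
    qed
  qed (intro scale_mem v)+
  show "integrable P (\<lambda>y. b\<^sup>2 * (N v)\<^sup>2)" using P by (simp add: finite_measure.integrable_const)
  show "(N (\<lambda>x. s y *\<^sub>R v x))\<^sup>2 \<le> b\<^sup>2 * (N v)\<^sup>2" if "y \<in> space P" for y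
    using power_mono[OF b[OF that], of 2] by (simp add: N_scale[OF v] power_mult_distrib mult_right_mono)
qed

lemma bochner_L2_const: "finite_measure P \<Longrightarrow> v \<in> X \<Longrightarrow> (\<lambda>y. v) \<in> bochner_L2 P X N"
  using bochner_L2_product[of P "\<lambda>y. 1" 1 v] by simp

lemma tensor_space_subset_bochner_L2:
  assumes P: "finite_measure P" and V: "V \<subseteq> X"
    and S: "\<And>s. s \<in> S \<Longrightarrow> s \<in> borel_measurable P \<and> (\<exists>b. \<forall>y\<in>space P. \<bar>s y\<bar> \<le> b)"
    and u: "u \<in> tensor_space V S"
  shows "u \<in> bochner_L2 P X N"
  using u
proof (induction rule: tensor_space_induct)
  case zero
  show ?case using P zero_mem by (rule bochner_L2_const)
next
  case (step u s v)
  then obtain b where b: "s \<in> borel_measurable P" "\<And>y. y \<in> space P \<Longrightarrow> \<bar>s y\<bar> \<le> b" "v \<in> X"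
    using S[of s] V by auto
  show ?case using step(4) bochner_L2_product[OF P b] by (rule bochner_L2_add)
qed

end

lemma bochner_L2_transform:
  assumes X: "seminormed X N" and Y: "seminormed Y N'" and v: "v \<in> bochner_L2 P X N"
    and T_mem: "\<And>z. z \<in> X \<Longrightarrow> T z \<in> Y"
    and T_lip: "\<And>z z'. z \<in> X \<Longrightarrow> z' \<in> X \<Longrightarrow> N' (\<lambda>x. T z x - T z' x) \<le> C * N (\<lambda>x. z x - z' x)"
    and T_norm: "\<And>z. z \<in> X \<Longrightarrow> N' (T z) \<le> C * N z"
  shows "(\<lambda>y. T (v y)) \<in> bochner_L2 P Y N'"
proof (rule seminormed.bochner_L2_dominated[OF Y])
  show "strongly_measurable P Y N' (\<lambda>y. T (v y))"
    using v by (intro strongly_measurable_transform[OF X Y _ T_mem T_lip]) (auto simp: bochner_L2_iff)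
  show "integrable P (\<lambda>y. C\<^sup>2 * (N (v y))\<^sup>2)" using v by (simp add: bochner_L2_iff)
  show "(N' (T (v y)))\<^sup>2 \<le> C\<^sup>2 * (N (v y))\<^sup>2" if "y \<in> space P" for y
    using power_mono[OF T_norm seminormed.N_nonneg[OF Y T_mem], of "v y" 2] bochner_L2_mem[OF v that]
    by (simp add: power_mult_distrib)
qed

text \<open>A bilinear form that depends on the parameter and is bounded uniformly in it. The forms
  a, a0, b and the inner product of W are all integrals of such pairings. Measurability in y is
  demanded only for fixed arguments; for arguments moving with y it is derived below.\<close>

locale bochner_pairing = X: seminormed X N + Y: seminormed Y N'
  for X :: "('x \<Rightarrow> 'b::real_vector) set" and N and Y :: "('z \<Rightarrow> 'c::real_vector) set" and N' +
  fixes P :: "'y measure" and B :: "'y \<Rightarrow> ('x \<Rightarrow> 'b) \<Rightarrow> ('z \<Rightarrow> 'c) \<Rightarrow> real" and K :: real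
  assumes B_add_left: "y \<in> space P \<Longrightarrow> v \<in> X \<Longrightarrow> v' \<in> X \<Longrightarrow> w \<in> Y \<Longrightarrow>
      B y (\<lambda>x. v x + v' x) w = B y v w + B y v' w"
    and B_scale_left: "y \<in> space P \<Longrightarrow> v \<in> X \<Longrightarrow> w \<in> Y \<Longrightarrow> B y (\<lambda>x. c *\<^sub>R v x) w = c * B y v w"
    and B_add_right: "y \<in> space P \<Longrightarrow> v \<in> X \<Longrightarrow> w \<in> Y \<Longrightarrow> w' \<in> Y \<Longrightarrow>
      B y v (\<lambda>x. w x + w' x) = B y v w + B y v w'"
    and B_scale_right: "y \<in> space P \<Longrightarrow> v \<in> X \<Longrightarrow> w \<in> Y \<Longrightarrow> B y v (\<lambda>x. c *\<^sub>R w x) = c * B y v w"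
    and B_bound: "y \<in> space P \<Longrightarrow> v \<in> X \<Longrightarrow> w \<in> Y \<Longrightarrow> \<bar>B y v w\<bar> \<le> K * (N v * N' w)"
    and B_measurable: "v \<in> X \<Longrightarrow> w \<in> Y \<Longrightarrow> (\<lambda>y. B y v w) \<in> borel_measurable P"
    and K_nonneg: "0 \<le> K"
begin

lemma B_diff_left:
  assumes "y \<in> space P" "v \<in> X" "v' \<in> X" "w \<in> Y"
  shows "B y (\<lambda>x. v x - v' x) w = B y v w - B y v' w"
  using B_add_left[OF assms(1,2) X.scale_mem[OF assms(3), of "- 1"] assms(4)]
    B_scale_left[OF assms(1,3,4), of "- 1"] by simp

lemma B_diff_right:
  assumes "y \<in> space P" "v \<in> X" "w \<in> Y" "w' \<in> Y"
  shows "B y v (\<lambda>x. w x - w' x) = B y v w - B y v w'"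
  using B_add_right[OF assms(1-3) Y.scale_mem[OF assms(4), of "- 1"]]
    B_scale_right[OF assms(1,2,4), of "- 1"] by simp

text \<open>For simple arguments the pair takes finitely many values, and on each piece
  \<open>B_measurable\<close> applies. For the limit, B(s,t) - B(v,w) = B(s-v,t) + B(v,t-w) tends to
  0 at every y by the uniform bound, because N' (t n y) stays bounded.\<close>

lemma pairing_measurable:
  assumes v: "strongly_measurable P X N v" and w: "strongly_measurable P Y N' w"
  shows "(\<lambda>y. B y (v y) (w y)) \<in> borel_measurable P"
proof -
  obtain s where s: "\<And>n. simple_function P (s n)" "\<And>n y. y \<in> space P \<Longrightarrow> s n y \<in> X"
    "\<And>y. y \<in> space P \<Longrightarrow> (\<lambda>n. N (\<lambda>x. s n y x - v y x)) \<longlonglongrightarrow> 0"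
    by (rule strongly_measurableE[OF v]) (rule that)
  obtain t where t: "\<And>n. simple_function P (t n)" "\<And>n y. y \<in> space P \<Longrightarrow> t n y \<in> Y"
    "\<And>y. y \<in> space P \<Longrightarrow> (\<lambda>n. N' (\<lambda>x. t n y x - w y x)) \<longlonglongrightarrow> 0"
    by (rule strongly_measurableE[OF w]) (rule that)
  note vX = strongly_measurable_mem[OF v] and wY = strongly_measurable_mem[OF w]
  show ?thesis
  proof (rule borel_measurable_LIMSEQ_real)
    fix n
    let ?st = "\<lambda>y. (s n y, t n y)" and ?I = "(\<lambda>y. (s n y, t n y)) ` space P"
    have st: "simple_function P ?st"
      by (rule simple_function_compose2[OF s(1) t(1), where h = Pair])
    have fin: "finite ?I" using st by (rule simple_functionD(1))
    have m: "?st \<in> measurable P (count_space ?I)"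
      unfolding measurable_count_space_eq2[OF fin]
      by (intro conjI ballI simple_functionD(2)[OF st]) blast
    have "(\<lambda>y. (\<lambda>ab y. B y (fst ab) (snd ab)) (?st y) y) \<in> borel_measurable P"
      by (rule measurable_compose_countable'[OF _ m countable_finite[OF fin]])
        (rule B_measurable; use s(2) t(2) in auto)
    then show "(\<lambda>y. B y (s n y) (t n y)) \<in> borel_measurable P" by simp
  next
    fix y assume y: "y \<in> space P"
    let ?d = "\<lambda>n. N (\<lambda>x. s n y x - v y x)" and ?e = "\<lambda>n. N' (\<lambda>x. t n y x - w y x)"
    have bd: "\<bar>B y (s n y) (t n y) - B y (v y) (w y)\<bar> \<le> K * (?d n * (N' (w y) + ?e n)) + K * (N (v y) * ?e n)" for n
    proof -
      have "B y (s n y) (t n y) - B y (v y) (w y) =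
        B y (\<lambda>x. s n y x - v y x) (t n y) + B y (v y) (\<lambda>x. t n y x - w y x)"
        using B_diff_left[OF y s(2)[OF y] vX[OF y] t(2)[OF y], of n n]
          B_diff_right[OF y vX[OF y] t(2)[OF y] wY[OF y], of n] by linarith
      moreover have "\<bar>B y (\<lambda>x. s n y x - v y x) (t n y)\<bar> \<le> K * (?d n * N' (t n y))"
        by (rule B_bound[OF y X.diff_mem[OF s(2)[OF y] vX[OF y]] t(2)[OF y]])
      moreover have "K * (?d n * N' (t n y)) \<le> K * (?d n * (N' (w y) + ?e n))"
        using Y.N_triangle[OF t(2)[OF y] wY[OF y]] X.N_nonneg[OF X.diff_mem[OF s(2)[OF y] vX[OF y]]] K_nonneg
        by (intro mult_left_mono)
      moreover have "\<bar>B y (v y) (\<lambda>x. t n y x - w y x)\<bar> \<le> K * (N (v y) * ?e n)"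
        by (rule B_bound[OF y vX[OF y] Y.diff_mem[OF t(2)[OF y] wY[OF y]]])
      ultimately show ?thesis by linarith
    qed
    have "(\<lambda>n. K * (?d n * (N' (w y) + ?e n)) + K * (N (v y) * ?e n)) \<longlonglongrightarrow>
      K * (0 * (N' (w y) + 0)) + K * (N (v y) * 0)"
      using s(3)[OF y] t(3)[OF y] by (intro tendsto_add tendsto_mult tendsto_const)
    then have lim: "(\<lambda>n. K * (?d n * (N' (w y) + ?e n)) + K * (N (v y) * ?e n)) \<longlonglongrightarrow> 0"
      by (simp only: mult_zero_left mult_zero_right add_0_left)
    have "(\<lambda>n. B y (s n y) (t n y) - B y (v y) (w y)) \<longlonglongrightarrow> 0"
      by (rule Lim_null_comparison[OF _ lim]) (unfold real_norm_def, intro always_eventually allI bd)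
    then show "(\<lambda>n. B y (s n y) (t n y)) \<longlonglongrightarrow> B y (v y) (w y)" by (simp add: LIM_zero_iff)
  qed
qed

lemma pairing_integrable:
  assumes v: "v \<in> bochner_L2 P X N" and w: "w \<in> bochner_L2 P Y N'"
  shows "integrable P (\<lambda>y. B y (v y) (w y))"
proof (rule Bochner_Integration.integrable_bound)
  show "integrable P (\<lambda>y. K * ((N (v y))\<^sup>2 + (N' (w y))\<^sup>2))"
    using v w by (simp add: bochner_L2_iff)
  show "(\<lambda>y. B y (v y) (w y)) \<in> borel_measurable P"
    by (rule pairing_measurable) (use v w in \<open>simp_all add: bochner_L2_iff\<close>)
  have "\<bar>B y (v y) (w y)\<bar> \<le> \<bar>K * ((N (v y))\<^sup>2 + (N' (w y))\<^sup>2)\<bar>" if y: "y \<in> space P" for y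
  proof -
    note vX = bochner_L2_mem[OF v y] and wY = bochner_L2_mem[OF w y]
    have "N (v y) * N' (w y) \<le> (N (v y))\<^sup>2 + (N' (w y))\<^sup>2"
      using sum_squares_bound[of "N (v y)" "N' (w y)"]
        mult_nonneg_nonneg[OF X.N_nonneg[OF vX] Y.N_nonneg[OF wY]] by linarith
    then have "K * (N (v y) * N' (w y)) \<le> K * ((N (v y))\<^sup>2 + (N' (w y))\<^sup>2)"
      using K_nonneg by (rule mult_left_mono)
    with B_bound[OF y vX wY] show ?thesis by linarith
  qed
  then show "AE y in P. norm (B y (v y) (w y)) \<le> norm (K * ((N (v y))\<^sup>2 + (N' (w y))\<^sup>2))"
    by (intro AE_I2) simp
qed

lemma pairing_add_left:
  assumes "v \<in> bochner_L2 P X N" "v' \<in> bochner_L2 P X N" "w \<in> bochner_L2 P Y N'"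
  shows "(LINT y|P. B y (\<lambda>x. v y x + v' y x) (w y)) = (LINT y|P. B y (v y) (w y)) + (LINT y|P. B y (v' y) (w y))"
proof -
  have "(LINT y|P. B y (\<lambda>x. v y x + v' y x) (w y)) = (LINT y|P. B y (v y) (w y) + B y (v' y) (w y))"
    using assms by (intro Bochner_Integration.integral_cong B_add_left) (auto intro: bochner_L2_mem)
  then show ?thesis using assms by (simp add: pairing_integrable)
qed

lemma pairing_scale_left:
  assumes "v \<in> bochner_L2 P X N" "w \<in> bochner_L2 P Y N'"
  shows "(LINT y|P. B y (\<lambda>x. c *\<^sub>R v y x) (w y)) = c * (LINT y|P. B y (v y) (w y))"
proof -
  have "(LINT y|P. B y (\<lambda>x. c *\<^sub>R v y x) (w y)) = (LINT y|P. c * B y (v y) (w y))"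
    using assms by (intro Bochner_Integration.integral_cong B_scale_left) (auto intro: bochner_L2_mem)
  then show ?thesis by simp
qed

lemma pairing_add_right:
  assumes "v \<in> bochner_L2 P X N" "w \<in> bochner_L2 P Y N'" "w' \<in> bochner_L2 P Y N'"
  shows "(LINT y|P. B y (v y) (\<lambda>x. w y x + w' y x)) = (LINT y|P. B y (v y) (w y)) + (LINT y|P. B y (v y) (w' y))"
proof -
  have "(LINT y|P. B y (v y) (\<lambda>x. w y x + w' y x)) = (LINT y|P. B y (v y) (w y) + B y (v y) (w' y))"
    using assms by (intro Bochner_Integration.integral_cong B_add_right) (auto intro: bochner_L2_mem)
  then show ?thesis using assms by (simp add: pairing_integrable)
qed

lemma pairing_scale_right:
  assumes "v \<in> bochner_L2 P X N" "w \<in> bochner_L2 P Y N'"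
  shows "(LINT y|P. B y (v y) (\<lambda>x. c *\<^sub>R w y x)) = c * (LINT y|P. B y (v y) (w y))"
proof -
  have "(LINT y|P. B y (v y) (\<lambda>x. c *\<^sub>R w y x)) = (LINT y|P. c * B y (v y) (w y))"
    using assms by (intro Bochner_Integration.integral_cong B_scale_right) (auto intro: bochner_L2_mem)
  then show ?thesis by simp
qed

lemma pairing_diff_left:
  assumes "v \<in> bochner_L2 P X N" "v' \<in> bochner_L2 P X N" "w \<in> bochner_L2 P Y N'"
  shows "(LINT y|P. B y (\<lambda>x. v y x - v' y x) (w y)) = (LINT y|P. B y (v y) (w y)) - (LINT y|P. B y (v' y) (w y))"
proof -
  have "(LINT y|P. B y (\<lambda>x. v y x - v' y x) (w y)) = (LINT y|P. B y (v y) (w y) - B y (v' y) (w y))"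
    using assms by (intro Bochner_Integration.integral_cong B_diff_left) (auto intro: bochner_L2_mem)
  then show ?thesis using assms by (simp add: pairing_integrable)
qed

lemma pairing_diff_right:
  assumes "v \<in> bochner_L2 P X N" "w \<in> bochner_L2 P Y N'" "w' \<in> bochner_L2 P Y N'"
  shows "(LINT y|P. B y (v y) (\<lambda>x. w y x - w' y x)) = (LINT y|P. B y (v y) (w y)) - (LINT y|P. B y (v y) (w' y))"
proof -
  have "(LINT y|P. B y (v y) (\<lambda>x. w y x - w' y x)) = (LINT y|P. B y (v y) (w y) - B y (v y) (w' y))"
    using assms by (intro Bochner_Integration.integral_cong B_diff_right) (auto intro: bochner_L2_mem)
  then show ?thesis using assms by (simp add: pairing_integrable)
qed

text \<open>On elementary tensors a pairing independent of y splits into a parameter integral times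
  a spatial value, and the parameter integral is 0 whatever the spatial factors are. Two nested
  inductions over sums of elementary tensors extend this to both arguments.\<close>

lemma pairing_tensor_zero:
  assumes P: "finite_measure P" and V: "V \<subseteq> X" and W: "W \<subseteq> Y"
    and S: "\<And>s. s \<in> S \<Longrightarrow> s \<in> borel_measurable P \<and> (\<exists>b. \<forall>y\<in>space P. \<bar>s y\<bar> \<le> b)"
    and S': "\<And>s. s \<in> S' \<Longrightarrow> s \<in> borel_measurable P \<and> (\<exists>b. \<forall>y\<in>space P. \<bar>s y\<bar> \<le> b)"
    and B: "\<And>y y' v w. B y v w = B y' v w"
    and orth: "\<And>s t. s \<in> S \<Longrightarrow> t \<in> S' \<Longrightarrow> (LINT y|P. s y * t y) = 0"
    and v: "v \<in> tensor_space V S" and w: "w \<in> tensor_space W S'"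
  shows "(LINT y|P. B y (v y) (w y)) = 0"
  using v
proof (induction rule: tensor_space_induct)
  note wL = Y.tensor_space_subset_bochner_L2[OF P W S' w]
  case zero
  have "(LINT y|P. B y (\<lambda>x. 0 *\<^sub>R 0) (w y)) = 0"
    using pairing_scale_left[OF X.bochner_L2_const[OF P X.zero_mem] wL, of 0] by simp
  then show ?case by simp
next
  note wL = Y.tensor_space_subset_bochner_L2[OF P W S' w]
  case (step u s a)
  then obtain b where s: "s \<in> borel_measurable P" "\<And>y. y \<in> space P \<Longrightarrow> \<bar>s y\<bar> \<le> b" and a: "a \<in> X"
    using S[of s] V by auto
  note sa = X.bochner_L2_product[OF P s a]
  have "(LINT y|P. B y (\<lambda>x. s y *\<^sub>R a x) (w y)) = 0"
    using w
  proof (induction rule: tensor_space_induct)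
    case zero
    have "(LINT y|P. B y (\<lambda>x. s y *\<^sub>R a x) (\<lambda>x. 0 *\<^sub>R 0)) = 0"
      using pairing_scale_right[OF sa Y.bochner_L2_const[OF P Y.zero_mem], of 0] by simp
    then show ?case by simp
  next
    case (step w t c)
    note w = Y.tensor_space_subset_bochner_L2[OF P W S' step(3)]
    obtain b' where t: "t \<in> borel_measurable P" "\<And>y. y \<in> space P \<Longrightarrow> \<bar>t y\<bar> \<le> b'" and c: "c \<in> Y"
      using S'[of t] step(1,2) W by auto
    note tc = Y.bochner_L2_product[OF P t c]
    \<comment> \<open>\<open>undefined\<close> stands for some fixed parameter value; by assumption
      \<open>B\<close> takes the same value at all of them.\<close>
    have "B y (\<lambda>x. s y *\<^sub>R a x) (\<lambda>x. t y *\<^sub>R c x) = (s y * t y) * B undefined a c" if "y \<in> space P" for y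
      using B_scale_left[OF that a Y.scale_mem[OF c]] B_scale_right[OF that a c] B[of y a c undefined]
      by simp
    then have "(LINT y|P. B y (\<lambda>x. s y *\<^sub>R a x) (\<lambda>x. t y *\<^sub>R c x)) = (LINT y|P. (s y * t y) * B undefined a c)"
      by (intro Bochner_Integration.integral_cong) auto
    also have "\<dots> = 0" using orth[OF \<open>s \<in> S\<close> \<open>t \<in> S'\<close>] by simp
    finally show ?case using pairing_add_right[OF sa w tc] step(4) by simp
  qed
  then show ?case
    using pairing_add_left[OF X.tensor_space_subset_bochner_L2[OF P V S step(3)] sa wL] step(4) by simp
qed

end

subsection \<open>Forms on the parametric spaces\<close>

interpretation param: product_prob_space "\<lambda>k::nat. uniform_measure (restrict_space lborel {-1..1::real}) {-1..1}" UNIV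
proof (rule product_prob_spaceI)
  show "prob_space (uniform_measure (restrict_space lborel {-1..1::real}) {-1..1})" for k :: nat
    by (rule prob_space_uniform_measure) (auto simp: emeasure_restrict_space)
qed

lemma prob_space_param: "prob_space param_measure"
  unfolding param_measure_def by (rule param.P.prob_space_axioms)

interpretation PM: prob_space param_measure by (rule prob_space_param)

lemma finite_measure_param: "finite_measure param_measure" by (rule PM.finite_measure_axioms)

lemma space_param: "y \<in> space param_measure \<longleftrightarrow> (\<forall>k. y k \<in> {-1..1})"
  by (auto simp: param_measure_def space_PiM space_restrict_space)

lemma component_measurable: "(\<lambda>y. y k) \<in> borel_measurable param_measure"
proof -
  have "(\<lambda>y. y k) \<in> measurable param_measure (uniform_measure (restrict_space lborel {-1..1::real}) {-1..1})"
    unfolding param_measure_def by (rule measurable_component_singleton) simp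
  moreover have "(\<lambda>x. x) \<in> borel_measurable (uniform_measure (restrict_space lborel {-1..1::real}) {-1..1})"
    by (subst measurable_cong_sets[OF sets_uniform_measure refl], rule measurable_restrict_space1) simp
  ultimately show ?thesis by (rule measurable_compose)
qed

text \<open>Cauchy-Schwarz for semidefinite forms, so that it holds for functions identified only up
  to null sets. Instances are a, a0 and the inner product of W.\<close>

locale psd_form =
  fixes V :: "('y \<Rightarrow> 'x \<Rightarrow> 'b::real_vector) set" and F :: "('y \<Rightarrow> 'x \<Rightarrow> 'b) \<Rightarrow> ('y \<Rightarrow> 'x \<Rightarrow> 'b) \<Rightarrow> real"
  assumes add_V: "v \<in> V \<Longrightarrow> w \<in> V \<Longrightarrow> (\<lambda>y x. v y x + w y x) \<in> V"
    and scale_V: "v \<in> V \<Longrightarrow> (\<lambda>y x. c *\<^sub>R v y x) \<in> V"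
    and F_add: "u \<in> V \<Longrightarrow> v \<in> V \<Longrightarrow> w \<in> V \<Longrightarrow> F (\<lambda>y x. u y x + v y x) w = F u w + F v w"
    and F_scale: "v \<in> V \<Longrightarrow> w \<in> V \<Longrightarrow> F (\<lambda>y x. c *\<^sub>R v y x) w = c * F v w"
    and F_sym: "v \<in> V \<Longrightarrow> w \<in> V \<Longrightarrow> F v w = F w v"
    and F_nonneg: "v \<in> V \<Longrightarrow> 0 \<le> F v v"
begin

lemma F_quadratic:
  assumes "v \<in> V" "w \<in> V"
  shows "F (\<lambda>y x. v y x + t *\<^sub>R w y x) (\<lambda>y x. v y x + t *\<^sub>R w y x) = F v v + 2 * t * F v w + t\<^sup>2 * F w w"
proof -
  let ?z = "\<lambda>y x. v y x + t *\<^sub>R w y x"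
  have tw: "(\<lambda>y x. t *\<^sub>R w y x) \<in> V" using assms(2) by (rule scale_V)
  have z: "?z \<in> V" using assms(1) tw by (rule add_V)
  have expand: "F ?z u = F v u + t * F w u" if "u \<in> V" for u
    using F_add[OF assms(1) tw that] F_scale[OF assms(2) that, of t] by simp
  have "F ?z ?z = F ?z v + t * F ?z w"
    using expand[OF z] F_sym[OF z assms(1)] F_sym[OF z assms(2)] by simp
  then show ?thesis
    using expand[OF assms(1)] expand[OF assms(2)] F_sym[OF assms]
    by (simp add: power2_eq_square algebra_simps)
qed

lemma F_cauchy_schwarz:
  assumes "v \<in> V" "w \<in> V" shows "\<bar>F v w\<bar> \<le> sqrt (F v v) * sqrt (F w w)"
proof (rule psd_cauchy_schwarz)
  show "0 \<le> F v v + 2 * t * F v w + t\<^sup>2 * F w w" for t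
    unfolding F_quadratic[OF assms, symmetric] by (intro F_nonneg add_V scale_V assms)
qed (intro F_nonneg assms)

end

definition inner_W where
  "inner_W D p q = (LINT y|param_measure. l2_inner D (p y) (q y))"

lemma norm_W_eq: "norm_W D q = sqrt (inner_W D q q)"
  by (simp add: norm_W_def inner_W_def l2_inner_def power2_norm_eq_inner)

lemma inner_W_nonneg: "0 \<le> inner_W D q q"
  unfolding inner_W_def l2_inner_def by simp

lemma norm_W_nonneg: "0 \<le> norm_W D q"
  by (simp add: norm_W_eq inner_W_nonneg)

section \<open>Linear maps on matrices applied to gradients\<close>

lemma norm_transpose: "norm (transpose (A :: real ^ 'd ^ 'd)) = norm A"
proof -
  have "transpose A \<bullet> transpose A = A \<bullet> A"
    unfolding inner_vec_def by (subst sum.swap) (simp add: transpose_def)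
  then show ?thesis by (simp add: norm_eq_sqrt_inner)
qed

text \<open>The strain as a linear map of the matrix alone, so that it can be composed with the weak
  gradient like the trace and the identity.\<close>

definition sym_part :: "real ^ 'd ^ 'd \<Rightarrow> real ^ 'd ^ 'd" where
  "sym_part A = (1 / 2) *\<^sub>R (A + transpose A)"

lemma strain_eq: "strain D v x = sym_part (weak_grad D v x)"
  by (simp add: strain_def sym_part_def)

lemma norm_sym_part: "norm (sym_part A) \<le> norm A"
  using norm_triangle_ineq[of A "transpose A"] by (simp add: sym_part_def norm_transpose)

lemma bounded_linear_sym_part: "bounded_linear sym_part"
proof (rule bounded_linear_intro[where K = 1])
  show "norm (sym_part A) \<le> norm A * 1" for A :: "real ^ 'd ^ 'd" using norm_sym_part[of A] by simp
qed (simp_all add: sym_part_def transpose_def vec_eq_iff algebra_simps)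

text \<open>The trace is the Frobenius product with the identity, whose Frobenius norm is sqrt d.
  This is the origin of sqrt d in \<open>C6\<close>.\<close>

lemma trace_bound: "\<bar>trace (A :: real ^ 'd ^ 'd)\<bar> \<le> sqrt CARD('d) * norm A"
proof -
  have "trace A = A \<bullet> mat 1"
    by (simp add: trace_def inner_vec_def mat_def if_distrib[of "(*) _"] cong: if_cong)
  moreover have "norm (mat 1 :: real ^ 'd ^ 'd) = sqrt CARD('d)"
    by (simp add: norm_eq_sqrt_inner inner_vec_def mat_def if_distrib[of "\<lambda>z. z * _"] cong: if_cong)
  ultimately show ?thesis using Cauchy_Schwarz_ineq2[of A "mat 1"] by (simp add: mult.commute)
qed

lemma bounded_linear_trace: "bounded_linear (trace :: real ^ 'd ^ 'd \<Rightarrow> real)"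
proof (rule bounded_linear_intro[where K = "sqrt CARD('d)"])
  show "norm (trace A) \<le> norm A * sqrt CARD('d)" for A :: "real ^ 'd ^ 'd"
    using trace_bound[of A] by (simp add: mult.commute)
qed (simp_all add: trace_def sum.distrib sum_distrib_left)

context bounded_open
begin

lemma sigma_finite_D: "sigma_finite_measure (lebesgue_on D)"
  using finite_measure_D by (simp add: finite_measure_def)

lemma l2_pairing:
  "bochner_pairing (l2_space D) (l2_norm D) (l2_space D) (l2_norm D) param_measure
     (\<lambda>y v w. l2_inner D v (w :: real ^ 'd \<Rightarrow> 'b::euclidean_space)) 1"
proof -
  interpret L: seminormed "l2_space D :: (real ^ 'd \<Rightarrow> 'b) set" "l2_norm D" by (rule l2_seminormed)
  show ?thesis
    by unfold_locales
      (simp_all add: l2_inner_add_left l2_inner_add_right l2_inner_scale_left l2_inner_scale_right l2_cauchy_schwarz)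
qed

lemma linear_grad_l2:
  assumes T: "bounded_linear (T :: real ^ 'd ^ 'd \<Rightarrow> 'b::euclidean_space)"
    and K: "\<And>z. norm (T z) \<le> K * norm z" "0 \<le> K" and v: "v \<in> h1_space D"
  shows "(\<lambda>x. T (weak_grad D v x)) \<in> l2_space D"
    and "l2_norm D (\<lambda>x. T (weak_grad D v x)) \<le> K * l2_norm D (weak_grad D v)"
  using l2_bounded_linear[OF weak_grad(1)[OF v] T K] by auto

lemma linear_grad_add:
  assumes "bounded_linear T" "v \<in> h1_space D" "w \<in> h1_space D"
  shows "AE x in lebesgue_on D. T (weak_grad D (\<lambda>x. v x + w x) x) = T (weak_grad D v x) + T (weak_grad D w x)"
proof -
  interpret bounded_linear T by fact
  show ?thesis using weak_grad_add(2)[OF assms(2,3)] by eventually_elim (simp add: add)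
qed

lemma linear_grad_scale:
  assumes "bounded_linear T" "v \<in> h1_space D"
  shows "AE x in lebesgue_on D. T (weak_grad D (\<lambda>x. c *\<^sub>R v x) x) = c *\<^sub>R T (weak_grad D v x)"
proof -
  interpret bounded_linear T by fact
  show ?thesis using weak_grad_scale(2)[OF assms(2), of c] by eventually_elim (simp add: scaleR)
qed

lemma joint_measurable_swap:
  assumes "(\<lambda>(x, y). m x y) \<in> borel_measurable (lebesgue_on D \<Otimes>\<^sub>M param_measure)"
  shows "(\<lambda>z. m (snd z) (fst z)) \<in> borel_measurable (param_measure \<Otimes>\<^sub>M lebesgue_on D)"
  using measurable_pair_swap[OF assms] by (simp add: case_prod_beta')

lemma joint_measurable_section:
  assumes "(\<lambda>(x, y). m x y) \<in> borel_measurable (lebesgue_on D \<Otimes>\<^sub>M param_measure)"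
    and "y \<in> space param_measure"
  shows "(\<lambda>x. m x y) \<in> borel_measurable (lebesgue_on D)"
  using measurable_Pair2[OF joint_measurable_swap[OF assms(1)] assms(2)] by simp

lemma weighted_integral_measurable:
  fixes m :: "real ^ 'd \<Rightarrow> (nat \<Rightarrow> real) \<Rightarrow> real" and h :: "real ^ 'd \<Rightarrow> real"
  assumes m: "(\<lambda>(x, y). m x y) \<in> borel_measurable (lebesgue_on D \<Otimes>\<^sub>M param_measure)"
    and h: "h \<in> borel_measurable (lebesgue_on D)"
  shows "(\<lambda>y. LINT x|lebesgue_on D. m x y * h x) \<in> borel_measurable param_measure"
proof -
  interpret sigma_finite_measure "lebesgue_on D" by (rule sigma_finite_D)
  have "(\<lambda>z. m (snd z) (fst z) * h (snd z)) \<in> borel_measurable (param_measure \<Otimes>\<^sub>M lebesgue_on D)"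
    by (rule borel_measurable_times[OF joint_measurable_swap[OF m] measurable_compose[OF measurable_snd h]])
  then have "(\<lambda>(y, x). m x y * h x) \<in> borel_measurable (param_measure \<Otimes>\<^sub>M lebesgue_on D)"
    by (simp add: case_prod_beta')
  then show ?thesis by (rule borel_measurable_lebesgue_integral)
qed

text \<open>The common shape of a (\<open>T\<close> the symmetric part, weight E) and of a0
  (\<open>T\<close> the identity, weight 1). Additivity of \<open>T (weak_grad D v x)\<close> in v
  holds only for a.e. x, but after integration over D the form is exactly bilinear at each
  y.\<close>

lemma weighted_grad_pairing:
  fixes T :: "real ^ 'd ^ 'd \<Rightarrow> 'b::euclidean_space"
  assumes T: "bounded_linear T" and K: "\<And>z. norm (T z) \<le> norm z"
    and m: "(\<lambda>(x, y). m x y) \<in> borel_measurable (lebesgue_on D \<Otimes>\<^sub>M param_measure)"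
    and M: "\<And>y. y \<in> space param_measure \<Longrightarrow> AE x in lebesgue_on D. \<bar>m x y\<bar> \<le> M" "0 \<le> M"
  shows "bochner_pairing (h1_E0 D dD) (h1_norm D) (h1_E0 D dD) (h1_norm D) param_measure
     (\<lambda>y v w. LINT x|lebesgue_on D. m x y * (T (weak_grad D v x) \<bullet> T (weak_grad D w x))) M"
proof -
  interpret H: seminormed "h1_E0 D dD" "h1_norm D" by (rule h1_E0_seminormed)
  let ?B = "\<lambda>y v w. LINT x|lebesgue_on D. m x y * (T (weak_grad D v x) \<bullet> T (weak_grad D w x))"
  have TG: "(\<lambda>x. T (weak_grad D v x)) \<in> l2_space D"
    "l2_norm D (\<lambda>x. T (weak_grad D v x)) \<le> h1_norm D v" if "v \<in> h1_E0 D dD" for v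
    using linear_grad_l2[OF T, of 1 v] K h1_norm_ge(2)[of v] h1_E0_h1[OF that] by auto
  have int: "integrable (lebesgue_on D) (\<lambda>x. m x y * (T (weak_grad D v x) \<bullet> T (weak_grad D w x)))"
    if "y \<in> space param_measure" "v \<in> h1_E0 D dD" "w \<in> h1_E0 D dD" for y v w
    by (rule l2_weighted_bound(1)[OF TG(1)[OF that(2)] TG(1)[OF that(3)]
        joint_measurable_section[OF m that(1)] M(1)[OF that(1)] M(2)])
  have sym: "?B y v w = ?B y w v" for y v w by (simp add: inner_commute)
  have add: "?B y (\<lambda>x. v x + v' x) w = ?B y v w + ?B y v' w"
    if y: "y \<in> space param_measure" and v: "v \<in> h1_E0 D dD" and v': "v' \<in> h1_E0 D dD" and w: "w \<in> h1_E0 D dD"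
    for y v v' w
  proof -
    have "?B y (\<lambda>x. v x + v' x) w = (LINT x|lebesgue_on D. m x y * (T (weak_grad D v x) \<bullet> T (weak_grad D w x)) +
      m x y * (T (weak_grad D v' x) \<bullet> T (weak_grad D w x)))"
    proof (rule integral_cong_AE)
      show "AE x in lebesgue_on D. m x y * (T (weak_grad D (\<lambda>x. v x + v' x) x) \<bullet> T (weak_grad D w x)) =
        m x y * (T (weak_grad D v x) \<bullet> T (weak_grad D w x)) + m x y * (T (weak_grad D v' x) \<bullet> T (weak_grad D w x))"
        using linear_grad_add[OF T h1_E0_h1[OF v] h1_E0_h1[OF v']]
        by eventually_elim (simp add: inner_add_left distrib_left)
    qed (intro borel_measurable_add borel_measurable_integrable int H.add_mem y v v' w)+
    then show ?thesis using int[OF y v w] int[OF y v' w] by simp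
  qed
  have scale: "?B y (\<lambda>x. c *\<^sub>R v x) w = c * ?B y v w"
    if y: "y \<in> space param_measure" and v: "v \<in> h1_E0 D dD" and w: "w \<in> h1_E0 D dD" for y v w c
  proof -
    have "?B y (\<lambda>x. c *\<^sub>R v x) w = (LINT x|lebesgue_on D. c * (m x y * (T (weak_grad D v x) \<bullet> T (weak_grad D w x))))"
    proof (rule integral_cong_AE)
      show "AE x in lebesgue_on D. m x y * (T (weak_grad D (\<lambda>x. c *\<^sub>R v x) x) \<bullet> T (weak_grad D w x)) =
        c * (m x y * (T (weak_grad D v x) \<bullet> T (weak_grad D w x)))"
        using linear_grad_scale[OF T h1_E0_h1[OF v], of c]
        by eventually_elim simp
    qed (intro borel_measurable_times borel_measurable_const borel_measurable_integrable int H.scale_mem y v w)+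
    then show ?thesis by simp
  qed
  show ?thesis
  proof unfold_locales
    fix y v w w' and c :: real
    assume y: "y \<in> space param_measure" and v: "v \<in> h1_E0 D dD" and w: "w \<in> h1_E0 D dD"
    show "?B y (\<lambda>x. c *\<^sub>R v x) w = c * ?B y v w" by (rule scale[OF y v w])
    show "?B y v (\<lambda>x. c *\<^sub>R w x) = c * ?B y v w"
      unfolding sym[of y v] by (rule scale[OF y w v])
    have "\<bar>?B y v w\<bar> \<le> M * (l2_norm D (\<lambda>x. T (weak_grad D v x)) * l2_norm D (\<lambda>x. T (weak_grad D w x)))"
      by (rule l2_weighted_bound(2)[OF TG(1)[OF v] TG(1)[OF w]
        joint_measurable_section[OF m y] M(1)[OF y] M(2)])
    also have "\<dots> \<le> M * (h1_norm D v * h1_norm D w)"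
      by (intro mult_left_mono mult_mono TG(2) v w M(2) l2_norm_nonneg h1_norm_nonneg)
    finally show "\<bar>?B y v w\<bar> \<le> M * (h1_norm D v * h1_norm D w)" .
    assume w': "w' \<in> h1_E0 D dD"
    show "?B y (\<lambda>x. v x + w x) w' = ?B y v w' + ?B y w w'" by (rule add[OF y v w w'])
    show "?B y v (\<lambda>x. w x + w' x) = ?B y v w + ?B y v w'"
      unfolding sym[of y v] by (rule add[OF y w w' v])
  next
    fix v w assume "v \<in> h1_E0 D dD" "w \<in> h1_E0 D dD"
    then show "(\<lambda>y. ?B y v w) \<in> borel_measurable param_measure"
      by (intro weighted_integral_measurable[OF m] borel_measurable_integrable l2_inner_integrable TG(1))
  qed (rule M(2))
qed

lemma weak_div_l2:
  assumes v: "v \<in> h1_space D"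
  shows "weak_div D v \<in> l2_space D" "l2_norm D (weak_div D v) \<le> sqrt CARD('d) * l2_norm D (weak_grad D v)"
  using linear_grad_l2[OF bounded_linear_trace _ _ v, of "sqrt CARD('d)"] trace_bound
  unfolding weak_div_def[abs_def] by auto

lemma weak_div_pairing:
  "bochner_pairing (h1_E0 D dD) (h1_norm D) (l2_space D) (l2_norm D) param_measure
     (\<lambda>y v q. LINT x|lebesgue_on D. q x * weak_div D v x) (sqrt CARD('d))"
proof -
  interpret H: seminormed "h1_E0 D dD" "h1_norm D" by (rule h1_E0_seminormed)
  interpret L: seminormed "l2_space D :: (real ^ 'd \<Rightarrow> real) set" "l2_norm D" by (rule l2_seminormed)
  have eq: "(LINT x|lebesgue_on D. q x * weak_div D v x) = l2_inner D q (weak_div D v)" for v q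
    by (simp add: l2_inner_def)
  note div = weak_div_l2(1)[OF h1_E0_h1[where dD = dD]]
  show ?thesis
    unfolding eq
  proof unfold_locales
    fix v w :: "real ^ 'd \<Rightarrow> real ^ 'd" and q r :: "real ^ 'd \<Rightarrow> real" and c
    assume v: "v \<in> h1_E0 D dD" and q: "q \<in> l2_space D"
    have "l2_inner D q (weak_div D (\<lambda>x. c *\<^sub>R v x)) = l2_inner D q (\<lambda>x. c *\<^sub>R weak_div D v x)"
      using linear_grad_scale[OF bounded_linear_trace h1_E0_h1[OF v], of c]
      by (intro l2_inner_cong_AE q div H.scale_mem l2_scale v) (simp_all add: weak_div_def)
    then show "l2_inner D q (weak_div D (\<lambda>x. c *\<^sub>R v x)) = c * l2_inner D q (weak_div D v)"
      by (simp only: l2_inner_scale_right)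
    show "l2_inner D (\<lambda>x. c *\<^sub>R q x) (weak_div D v) = c * l2_inner D q (weak_div D v)"
      by (rule l2_inner_scale_left)
    show "r \<in> l2_space D \<Longrightarrow> l2_inner D (\<lambda>x. q x + r x) (weak_div D v) = l2_inner D q (weak_div D v) + l2_inner D r (weak_div D v)"
      by (intro l2_inner_add_left q div v)
    have "\<bar>l2_inner D q (weak_div D v)\<bar> \<le> l2_norm D q * l2_norm D (weak_div D v)"
      by (intro l2_cauchy_schwarz q div v)
    also have "\<dots> \<le> l2_norm D q * (sqrt CARD('d) * h1_norm D v)"
      using weak_div_l2(2)[OF h1_E0_h1[OF v]] h1_norm_ge(2)[of v]
      by (intro mult_left_mono l2_norm_nonneg) (auto intro: order_trans mult_left_mono)
    finally show "\<bar>l2_inner D q (weak_div D v)\<bar> \<le> sqrt CARD('d) * (h1_norm D v * l2_norm D q)"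
      by (simp add: mult_ac)
    assume w: "w \<in> h1_E0 D dD"
    have "l2_inner D q (weak_div D (\<lambda>x. v x + w x)) = l2_inner D q (\<lambda>x. weak_div D v x + weak_div D w x)"
      using linear_grad_add[OF bounded_linear_trace h1_E0_h1[OF v] h1_E0_h1[OF w]]
      by (intro l2_inner_cong_AE q div H.add_mem l2_add v w) (simp_all add: weak_div_def)
    then show "l2_inner D q (weak_div D (\<lambda>x. v x + w x)) = l2_inner D q (weak_div D v) + l2_inner D q (weak_div D w)"
      using l2_inner_add_right[OF div[OF v] div[OF w] q] by simp
  qed simp_all
qed

end

subsection \<open>Legendre polynomials\<close>

definition poly_int :: "real poly \<Rightarrow> real" where
  "poly_int p = (LINT t|lborel. poly p t * indicator {-1..1} t)"

lemma poly_integrable: "integrable lborel (\<lambda>t. poly p t * indicator {-1..1} (t::real))"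
proof -
  have "integrable lborel (\<lambda>t. indicator {-1..1} t *\<^sub>R poly p t)"
    using borel_integrable_compact[of "{-1..1::real}" "poly p"] by (simp add: continuous_on_poly)
  then show ?thesis by (simp add: mult.commute)
qed

lemma poly_int_add: "poly_int (p + q) = poly_int p + poly_int q"
  unfolding poly_int_def using poly_integrable[of p] poly_integrable[of q]
  by (simp add: distrib_right)

lemma poly_int_pderiv: "poly_int (pderiv p) = poly p 1 - poly p (- 1)"
  unfolding poly_int_def by (rule integral_FTC_Icc_real) (auto intro: poly_DERIV)

abbreviation "rodrigues n \<equiv> (pderiv ^^ n) ([:-1, 0, 1::real:] ^ n)"

text \<open>Each differentiation lowers the multiplicity of the factor \<open>w\<close> by at most
  one. For Rodrigues' formula this leaves zeros at both endpoints as long as fewer than n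
  derivatives are taken.\<close>

lemma power_dvd_iterated_pderiv:
  fixes w :: "real poly"
  shows "j \<le> n \<Longrightarrow> w ^ (n - j) dvd (pderiv ^^ j) (w ^ n)"
proof (induction j)
  case (Suc j)
  then obtain g where g: "(pderiv ^^ j) (w ^ n) = w ^ (n - j) * g" by (auto elim: dvdE)
  have "n - j = Suc (n - Suc j)" using Suc.prems by simp
  then have "w ^ (n - Suc j) dvd pderiv (w ^ (n - j))"
    by (metis dvd_smult dvd_triv_left mult_smult_left pderiv_power_Suc)
  moreover have "w ^ (n - Suc j) dvd w ^ (n - j)" by (rule le_imp_power_dvd) simp
  ultimately show ?case by (simp add: g pderiv_mult)
qed simp

lemma rodrigues_boundary:
  assumes "j < n" "t \<in> {-1, 1}" shows "poly ((pderiv ^^ j) ([:-1, 0, 1::real:] ^ n)) t = 0"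
proof -
  obtain g where "(pderiv ^^ j) ([:-1, 0, 1::real:] ^ n) = [:-1, 0, 1:] ^ (n - j) * g"
    using power_dvd_iterated_pderiv[of j n "[:-1, 0, 1::real:]"] assms(1) by (auto elim: dvdE)
  moreover have "poly [:-1, 0, 1::real:] t = 0" using assms(2) by auto
  ultimately show ?thesis using assms(1) by (simp add: poly_power)
qed

text \<open>Repeated integration by parts. Every boundary term contains a derivative of (t^2 - 1)^n
  of order below n and so vanishes at 1 and -1.\<close>

lemma rodrigues_by_parts:
  "k \<le> n \<Longrightarrow> poly_int (rodrigues n * r) =
     (- 1) ^ k * poly_int ((pderiv ^^ (n - k)) ([:-1, 0, 1:] ^ n) * (pderiv ^^ k) r)"
proof (induction k)
  case (Suc k)
  let ?p = "(pderiv ^^ (n - Suc k)) ([:-1, 0, 1::real:] ^ n)" and ?q = "(pderiv ^^ k) r"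
  have nk: "n - k = Suc (n - Suc k)" using Suc.prems by simp
  have "poly_int (?p * pderiv ?q) + poly_int (?q * pderiv ?p) = poly_int (pderiv (?p * ?q))"
    by (simp add: pderiv_mult poly_int_add)
  also have "\<dots> = 0"
    unfolding poly_int_pderiv using Suc.prems by (simp add: rodrigues_boundary)
  finally have "poly_int (pderiv ?p * ?q) = - poly_int (?p * pderiv ?q)" by (simp add: mult.commute)
  then show ?case using Suc by (simp add: nk)
qed simp

lemma degree_iterated_pderiv: "degree ((pderiv ^^ k) (p :: real poly)) = degree p - k"
  by (induction k) (simp_all add: degree_pderiv)

lemma iterated_pderiv_eq_0:
  assumes "degree p < n" shows "(pderiv ^^ n) (p :: real poly) = 0"
proof -
  obtain k where n: "n = Suc k" using assms by (cases n) auto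
  have "degree ((pderiv ^^ k) p) = 0" using assms by (simp add: degree_iterated_pderiv n)
  then show ?thesis by (simp add: n pderiv_eq_0_iff)
qed

text \<open>After n integrations by parts, n derivatives fall on \<open>rodrigues m\<close>, whose
  degree is at most 2 m - m = m < n.\<close>

lemma rodrigues_orthogonal:
  assumes "m < n" shows "poly_int (rodrigues n * rodrigues m) = 0"
proof -
  have "degree ([:-1, 0, 1::real:] ^ m) \<le> 2 * m"
    using degree_power_le[of "[:-1, 0, 1::real:]" m] by simp
  then have "(pderiv ^^ n) (rodrigues m) = 0"
    using assms by (intro iterated_pderiv_eq_0) (simp add: degree_iterated_pderiv)
  then show ?thesis using rodrigues_by_parts[of n n "rodrigues m"] by (simp add: poly_int_def)
qed

section \<open>Legendre polynomials in one and in many parameters\<close>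

abbreviation "uniform_pm1 \<equiv> uniform_measure (restrict_space lborel {-1..1::real}) {-1..1}"

lemma integral_uniform_pm1:
  fixes f :: "real \<Rightarrow> real"
  assumes "continuous_on UNIV f"
  shows "(LINT t|uniform_pm1. f t) = (LINT t|lborel. f t * indicator {-1..1} t) / 2"
proof -
  have f[measurable]: "f \<in> borel_measurable (restrict_space lborel {-1..1})"
    by (rule measurable_restrict_space1) (use assms in \<open>auto intro: borel_measurable_continuous_onI\<close>)
  have "uniform_pm1 = density (restrict_space lborel {-1..1}) (\<lambda>x. ennreal (1 / 2))"
  proof -
    have e: "emeasure (restrict_space lborel {-1..1::real}) {-1..1} = 2"
      by (simp add: emeasure_restrict_space)
    have h: "1 / 2 = ennreal (1 / 2)" using divide_ennreal[of 1 2] by simp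
    show ?thesis
      unfolding uniform_measure_def e
    proof (rule density_cong)
      show "(\<lambda>x. indicator {-1..1} x / 2 :: ennreal) \<in> borel_measurable (restrict_space lborel {-1..1::real})"
        by (rule measurable_restrict_space1) measurable
      show "AE x in restrict_space lborel {-1..1::real}. indicator {-1..1} x / 2 = ennreal (1 / 2)"
        unfolding h[symmetric] by (rule AE_I2) (simp add: space_restrict_space)
    qed simp
  qed
  then have "(LINT t|uniform_pm1. f t) = (LINT t|restrict_space lborel {-1..1}. (1 / 2) *\<^sub>R f t)"
    by (simp only:) (rule integral_density, auto)
  also have "\<dots> = (LINT t|lborel. f t * indicator {-1..1} t) / 2"
    by (subst integral_restrict_space) (auto simp: mult.commute)
  finally show ?thesis .
qed

lemma continuous_legendre: "continuous_on S (legendre n)"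
  unfolding legendre_def[abs_def] by (intro continuous_intros)

lemma legendre_orthogonal:
  assumes "m \<noteq> n" shows "(LINT t|uniform_pm1. legendre m t * legendre n t) = 0"
proof -
  have "poly_int (rodrigues m * rodrigues n) = 0"
    using assms rodrigues_orthogonal[of m n] rodrigues_orthogonal[of n m]
    by (cases "m < n") (auto simp: mult.commute)
  moreover have "legendre m t * legendre n t * indicator {-1..1} t =
    (sqrt (2 * real m + 1) * (1 / (2 ^ m * fact m)) * (sqrt (2 * real n + 1) * (1 / (2 ^ n * fact n)))) *
    (poly (rodrigues m * rodrigues n) t * indicator {-1..1} t)" for t
    by (simp add: legendre_def)
  ultimately show ?thesis
    by (subst integral_uniform_pm1) (auto intro!: continuous_intros continuous_legendre simp: poly_int_def)
qed

lemma legendre_0: "legendre 0 t = 1"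
  by (simp add: legendre_def)

lemma legendre_multi_measurable: "legendre_multi \<mu> \<in> borel_measurable param_measure"
  unfolding legendre_multi_def[abs_def]
  by (intro borel_measurable_prod borel_measurable_continuous_on[OF continuous_legendre] component_measurable)

lemma legendre_multi_bounded: "\<exists>b. \<forall>y\<in>space param_measure. \<bar>legendre_multi \<mu> y\<bar> \<le> b"
proof -
  have "\<exists>b. \<forall>t\<in>{-1..1}. \<bar>legendre n t\<bar> \<le> b" for n
    using compact_imp_bounded[OF compact_continuous_image[OF continuous_legendre[of "{-1..1}" n] compact_Icc]]
    by (auto simp: bounded_iff)
  then obtain b where "\<And>n t. t \<in> {-1..1} \<Longrightarrow> \<bar>legendre n t\<bar> \<le> b n" by metis
  then have "\<forall>y\<in>space param_measure. \<bar>legendre_multi \<mu> y\<bar> \<le> (\<Prod>i\<in>{i. \<mu> i \<noteq> 0}. b (\<mu> i))"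
    unfolding legendre_multi_def abs_prod by (auto intro!: prod_mono simp: space_param)
  then show ?thesis by blast
qed

lemma bounded_span:
  assumes "\<And>i. i \<in> I \<Longrightarrow> \<exists>b. \<forall>y\<in>A. \<bar>f i y :: real\<bar> \<le> b"
  shows "\<exists>b. \<forall>y\<in>A. \<bar>\<Sum>i\<in>I. c i * f i y\<bar> \<le> b"
proof -
  obtain b where b: "\<And>i y. i \<in> I \<Longrightarrow> y \<in> A \<Longrightarrow> \<bar>f i y\<bar> \<le> b i" using assms by metis
  have "\<bar>\<Sum>i\<in>I. c i * f i y\<bar> \<le> (\<Sum>i\<in>I. \<bar>c i\<bar> * b i)" if "y \<in> A" for y
    by (rule order_trans[OF sum_abs]) (auto simp: abs_mult intro!: sum_mono mult_left_mono b that)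
  then show ?thesis by blast
qed

lemma legendre_span_bounded_measurable:
  assumes "s \<in> legendre_span \<Lambda>"
  shows "s \<in> borel_measurable param_measure \<and> (\<exists>b. \<forall>y\<in>space param_measure. \<bar>s y\<bar> \<le> b)"
proof -
  obtain c where s: "s = (\<lambda>y. \<Sum>\<mu>\<in>\<Lambda>. c \<mu> * legendre_multi \<mu> y)"
    using assms by (auto simp: legendre_span_def)
  show ?thesis unfolding s
    by (intro conjI borel_measurable_sum borel_measurable_times borel_measurable_const
        legendre_multi_measurable bounded_span legendre_multi_bounded)
qed

text \<open>Only the finitely many coordinates in the two supports matter. The image of the infinite
  product measure on them is a finite product, so the integral factorises, and the factor at a
  coordinate where the indices differ is 0.\<close>

lemma legendre_multi_orthogonal:
  assumes \<mu>: "\<mu> \<in> multi_indices" and \<nu>: "\<nu> \<in> multi_indices" and ne: "\<mu> \<noteq> \<nu>"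
  shows "(LINT y|param_measure. legendre_multi \<mu> y * legendre_multi \<nu> y) = 0"
proof -
  define J where "J = {i. \<mu> i \<noteq> 0} \<union> {i. \<nu> i \<noteq> 0}"
  have J: "finite J" using \<mu> \<nu> by (simp add: J_def multi_indices_def)
  obtain k where k: "\<mu> k \<noteq> \<nu> k" using ne by auto
  have kJ: "k \<in> J" using k by (auto simp: J_def)
  let ?g = "\<lambda>i t. legendre (\<mu> i) t * legendre (\<nu> i) t"
  \<comment> \<open>Both products are extended to the common index set \<open>J\<close>, the added
    factors being the constant polynomial 1 of degree 0.\<close>
  have ext: "legendre_multi \<kappa> y = (\<Prod>i\<in>J. legendre (\<kappa> i) (y i))" if "{i. \<kappa> i \<noteq> 0} \<subseteq> J" for \<kappa> y
    unfolding legendre_multi_def using that J by (intro prod.mono_neutral_left) (auto simp: legendre_0)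
  have eq: "legendre_multi \<mu> y * legendre_multi \<nu> y = (\<Prod>i\<in>J. ?g i (restrict y J i))" for y
    using ext[of \<mu>] ext[of \<nu>] by (simp add: J_def prod.distrib)
  have g: "continuous_on S (?g i)" for S i by (intro continuous_intros continuous_legendre)
  have gm: "?g i \<in> borel_measurable uniform_pm1" for i
    by (subst measurable_cong_sets[OF sets_uniform_measure refl], rule measurable_restrict_space1)
      (use borel_measurable_continuous_onI[OF g] in simp)
  have gi: "integrable uniform_pm1 (?g i)" for i
  proof -
    have "\<exists>b. \<forall>t\<in>{-1..1}. \<bar>?g i t\<bar> \<le> b"
      using compact_imp_bounded[OF compact_continuous_image[OF g compact_Icc]]
      by (auto simp: bounded_iff)
    then obtain b where b: "\<forall>t\<in>{-1..1}. \<bar>?g i t\<bar> \<le> b" by blast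
    show ?thesis
      by (rule param.M.integrable_const_bound[where B = b])
        (use gm b in \<open>auto simp: space_restrict_space intro!: AE_I2\<close>)
  qed
  have m: "(\<lambda>z. \<Prod>i\<in>J. ?g i (z i)) \<in> borel_measurable (PiM J (\<lambda>k. uniform_pm1))"
  proof (rule borel_measurable_prod)
    show "(\<lambda>z. ?g i (z i)) \<in> borel_measurable (PiM J (\<lambda>k. uniform_pm1))" if "i \<in> J" for i
      using measurable_component_singleton[OF that] gm[of i] by (rule measurable_compose)
  qed
  have "(LINT y|param_measure. legendre_multi \<mu> y * legendre_multi \<nu> y) =
    (LINT z|distr param_measure (PiM J (\<lambda>k. uniform_pm1)) (\<lambda>y. restrict y J). (\<Prod>i\<in>J. ?g i (z i)))"
    unfolding eq param_measure_def by (rule integral_distr[OF measurable_restrict_subset m, symmetric]) simp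
  also have "distr param_measure (PiM J (\<lambda>k. uniform_pm1)) (\<lambda>y. restrict y J) = PiM J (\<lambda>k. uniform_pm1)"
    unfolding param_measure_def by (rule param.distr_PiM_restrict_finite[OF J]) simp
  also have "(LINT z|PiM J (\<lambda>k. uniform_pm1). (\<Prod>i\<in>J. ?g i (z i))) = (\<Prod>i\<in>J. LINT t|uniform_pm1. ?g i t)"
    using J gi by (rule param.product_integral_prod)
  also have "\<dots> = 0"
    using J kJ legendre_orthogonal[OF k] by (auto simp: prod_zero_iff)
  finally show ?thesis .
qed

lemma legendre_span_orthogonal:
  assumes "\<Lambda> \<subseteq> multi_indices" "Q \<subseteq> multi_indices" "\<Lambda> \<inter> Q = {}"
    and s: "s \<in> legendre_span \<Lambda>" and t: "t \<in> legendre_span Q"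
  shows "(LINT y|param_measure. s y * t y) = 0"
proof -
  obtain c where s: "s = (\<lambda>y. \<Sum>\<mu>\<in>\<Lambda>. c \<mu> * legendre_multi \<mu> y)"
    using s by (auto simp: legendre_span_def)
  obtain d where t: "t = (\<lambda>y. \<Sum>\<nu>\<in>Q. d \<nu> * legendre_multi \<nu> y)"
    using t by (auto simp: legendre_span_def)
  have int: "integrable param_measure (\<lambda>y. legendre_multi \<mu> y * legendre_multi \<nu> y)" for \<mu> \<nu>
  proof -
    obtain b where b: "\<And>y. y \<in> space param_measure \<Longrightarrow> \<bar>legendre_multi \<mu> y\<bar> \<le> b"
      using legendre_multi_bounded by blast
    obtain b' where b': "\<And>y. y \<in> space param_measure \<Longrightarrow> \<bar>legendre_multi \<nu> y\<bar> \<le> b'"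
      using legendre_multi_bounded by blast
    show ?thesis
    proof (rule PM.integrable_const_bound[where B = "b * b'"])
      show "AE y in param_measure. norm (legendre_multi \<mu> y * legendre_multi \<nu> y) \<le> b * b'"
        using b b' by (intro AE_I2) (auto simp: abs_mult intro!: mult_mono order_trans[OF abs_ge_zero])
    qed (intro borel_measurable_times legendre_multi_measurable)
  qed
  have "(LINT y|param_measure. s y * t y) =
    (LINT y|param_measure. (\<Sum>\<mu>\<in>\<Lambda>. (\<Sum>\<nu>\<in>Q. (c \<mu> * d \<nu>) * (legendre_multi \<mu> y * legendre_multi \<nu> y))))"
    unfolding s t by (simp add: sum_product mult_ac)
  also have "\<dots> = (\<Sum>\<mu>\<in>\<Lambda>. \<Sum>\<nu>\<in>Q. (c \<mu> * d \<nu>) * (LINT y|param_measure. legendre_multi \<mu> y * legendre_multi \<nu> y))"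
    using int by (simp add: Bochner_Integration.integral_sum Bochner_Integration.integrable_sum)
  also have "\<dots> = 0"
    using assms(1-3) by (intro sum.neutral ballI) (auto intro!: legendre_multi_orthogonal)
  finally show ?thesis .
qed

subsection \<open>Bounds for the Young's modulus\<close>

text \<open>A bound at every parameter value, in contrast to \<open>Emin\<close> and
  \<open>Emax\<close>, which are valid for almost every one. The exceptional null set in x comes
  from the essential suprema of all e_k together and does not depend on y; |y_k| \<le> 1 does the
  rest. The absolute value of \<open>e0max\<close> makes the constant visibly nonnegative.\<close>

lemma young_bounded:
  assumes e0: "0 < e0min" "AE x in lebesgue_on D. e0min \<le> e0 x \<and> e0 x \<le> e0max"
    and decay: "ereal (1 / e0min) * (\<Sum>k. esssup (lebesgue_on D) (\<lambda>x. ereal \<bar>e k x\<bar>)) < 1"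
    and y: "y \<in> space param_measure"
  shows "AE x in lebesgue_on D. \<bar>young e0 e x y\<bar> \<le> \<bar>e0max\<bar> + e0min"
proof -
  let ?c = "\<lambda>k. esssup (lebesgue_on D) (\<lambda>x. ereal \<bar>e k x\<bar>)"
  have "AE x in lebesgue_on D. \<forall>k. ereal \<bar>e k x\<bar> \<le> ?c k"
    unfolding AE_all_countable by (intro allI esssup_AE)
  with e0(2) show ?thesis
  proof eventually_elim
    case (elim x)
    have "(\<Sum>k. ereal \<bar>e k x\<bar>) \<le> suminf ?c" using elim by (intro suminf_le_pos) auto
    then have "ereal (1 / e0min) * (\<Sum>k. ereal \<bar>e k x\<bar>) \<le> ereal (1 / e0min) * suminf ?c"
      using e0(1) by (intro ereal_mult_left_mono) auto
    with decay have lt: "ereal (1 / e0min) * (\<Sum>k. ereal \<bar>e k x\<bar>) < 1" by (rule order.strict_trans1[rotated])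
    \<comment> \<open>An infinite series times the positive factor 1 / e0min would be infinite and
      not below 1.\<close>
    then have fin: "(\<Sum>k. ereal \<bar>e k x\<bar>) \<noteq> \<infinity>" using e0(1) by auto
    have sm: "summable (\<lambda>k. \<bar>e k x\<bar>)" using fin by (intro summable_ereal) auto
    have "(\<Sum>k. ereal \<bar>e k x\<bar>) = ereal (\<Sum>k. \<bar>e k x\<bar>)" using sm by (rule suminf_ereal')
    with lt have s: "(\<Sum>k. \<bar>e k x\<bar>) \<le> e0min" using e0(1) by (simp add: one_ereal_def field_simps)
    have le: "\<bar>e k x * y k\<bar> \<le> \<bar>e k x\<bar>" for k
      using y mult_left_mono[of "\<bar>y k\<bar>" 1 "\<bar>e k x\<bar>"] by (auto simp: space_param abs_mult abs_le_iff)
    have sm': "summable (\<lambda>k. \<bar>e k x * y k\<bar>)"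
      by (rule summable_comparison_test'[OF sm, of 0]) (use le in simp)
    have "\<bar>\<Sum>k. e k x * y k\<bar> \<le> (\<Sum>k. \<bar>e k x * y k\<bar>)" using sm' by (rule summable_rabs)
    also have "\<dots> \<le> (\<Sum>k. \<bar>e k x\<bar>)" by (rule suminf_le[OF le sm' sm])
    finally show ?case using elim s e0(1) unfolding young_def by linarith
  qed
qed

subsection \<open>The energy norm and the discrete spaces\<close>

lemma norm_a0_nonneg: "0 \<le> \<alpha> \<Longrightarrow> 0 \<le> norm_a0 D \<alpha> v"
  unfolding norm_a0_def form_a0_def by (intro real_sqrt_ge_zero mult_nonneg_nonneg integral_nonneg_AE AE_I2) auto

lemma finite_dim_space_combination:
  assumes "finite_dim_space V"
  shows "(\<lambda>x. 0) \<in> V" "u \<in> V \<Longrightarrow> v \<in> V \<Longrightarrow> (\<lambda>x. u x + s *\<^sub>R v x) \<in> V"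
proof -
  obtain n :: nat and b where V: "V = {\<lambda>x. \<Sum>i<n. c i *\<^sub>R b i x | c :: nat \<Rightarrow> real. True}"
    using assms by (auto simp: finite_dim_space_def)
  show "(\<lambda>x. 0) \<in> V" unfolding V by (intro CollectI exI[of _ "\<lambda>i. 0"]) simp
  assume "u \<in> V" "v \<in> V"
  then obtain c d where u: "u = (\<lambda>x. \<Sum>i<n. c i *\<^sub>R b i x)" and v: "v = (\<lambda>x. \<Sum>i<n. d i *\<^sub>R b i x)"
    unfolding V by auto
  show "(\<lambda>x. u x + s *\<^sub>R v x) \<in> V"
    unfolding V u v
    by (intro CollectI exI[of _ "\<lambda>i. c i + s * d i"])
      (simp add: scaleR_add_left sum.distrib scaleR_sum_right)
qed

lemma tensor_space_pointwise:
  assumes "finite_dim_space V" "u \<in> tensor_space V S" shows "u y \<in> V"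
  using assms(2)
  by (induction rule: tensor_space_induct) (auto intro: finite_dim_space_combination[OF assms(1)])

text \<open>Two kinds of bounds on E coexist: \<open>M\<close> holds at every parameter value and
  makes a a pairing, that is, measurable and integrable; \<open>Emin\<close> and \<open>Emax\<close>
  hold for a.e. parameter and determine the constants of the estimates. The condition on the
  dimension feeds the definiteness of the energy norm.\<close>

locale stokes_forms = bounded_open D for D :: "(real ^ 'd) set" +
  fixes dD :: "(real ^ 'd) set" and \<alpha> Emin Emax M CK :: real
    and E :: "real ^ 'd \<Rightarrow> (nat \<Rightarrow> real) \<Rightarrow> real"
  assumes alpha_pos: "0 < \<alpha>"
    and E_meas: "(\<lambda>(x, y). E x y) \<in> borel_measurable (lebesgue_on D \<Otimes>\<^sub>M param_measure)"
    and E_bounded: "y \<in> space param_measure \<Longrightarrow> AE x in lebesgue_on D. \<bar>E x y\<bar> \<le> M" "0 \<le> M"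
    and E_AE: "AE y in param_measure. AE x in lebesgue_on D. Emin \<le> E x y \<and> E x y \<le> Emax"
    and Emin_pos: "0 < Emin"
    and korn: "korn_const D dD CK"
    and dim: "CARD('d) \<ge> 2"
begin

abbreviation "V \<equiv> space_V D dD"
abbreviation "W \<equiv> space_W D"

sublocale H: seminormed "h1_E0 D dD" "h1_norm D" by (rule h1_E0_seminormed)
sublocale L: seminormed "l2_space D :: (real ^ 'd \<Rightarrow> real) set" "l2_norm D" by (rule l2_seminormed)

sublocale A: bochner_pairing "h1_E0 D dD" "h1_norm D" "h1_E0 D dD" "h1_norm D" param_measure
  "\<lambda>y v w. LINT x|lebesgue_on D. E x y * (sym_part (weak_grad D v x) \<bullet> sym_part (weak_grad D w x))" M
  by (rule weighted_grad_pairing[OF bounded_linear_sym_part norm_sym_part E_meas E_bounded])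

lemma grad_pairing: "bochner_pairing (h1_E0 D dD) (h1_norm D) (h1_E0 D dD) (h1_norm D) param_measure
  (\<lambda>y v w. l2_inner D (weak_grad D v) (weak_grad D w)) 1"
  using weighted_grad_pairing[of "\<lambda>z. z" "\<lambda>x y. 1" 1 dD] by (simp add: l2_inner_def)

sublocale G: bochner_pairing "h1_E0 D dD" "h1_norm D" "h1_E0 D dD" "h1_norm D" param_measure
  "\<lambda>y v w. l2_inner D (weak_grad D v) (weak_grad D w)" 1
  by (rule grad_pairing)

sublocale B: bochner_pairing "h1_E0 D dD" "h1_norm D" "l2_space D" "l2_norm D" param_measure
  "\<lambda>y v q. LINT x|lebesgue_on D. q x * weak_div D v x" "sqrt CARD('d)"
  by (rule weak_div_pairing)

sublocale Q: bochner_pairing "l2_space D" "l2_norm D" "l2_space D" "l2_norm D" param_measure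
  "\<lambda>y q (r :: real ^ 'd \<Rightarrow> real). l2_inner D q r" 1
  by (rule l2_pairing)

lemma form_a_eq: "form_a D \<alpha> E u v = \<alpha> * (LINT y|param_measure. LINT x|lebesgue_on D.
    E x y * (sym_part (weak_grad D (u y) x) \<bullet> sym_part (weak_grad D (v y) x)))"
  by (simp add: form_a_def strain_eq)

lemma form_a0_eq: "form_a0 D \<alpha> u v = \<alpha> * (LINT y|param_measure. l2_inner D (weak_grad D (u y)) (weak_grad D (v y)))"
  by (simp add: form_a0_def l2_inner_def)

lemma V_mem: "v \<in> V \<Longrightarrow> y \<in> space param_measure \<Longrightarrow> v y \<in> h1_E0 D dD"
  using bochner_L2_mem[of v param_measure "h1_E0 D dD" "h1_norm D" y] by (simp add: space_V_def)

lemma V_add: "v \<in> V \<Longrightarrow> w \<in> V \<Longrightarrow> (\<lambda>y x. v y x + w y x) \<in> V"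
  unfolding space_V_def by (rule H.bochner_L2_add)

lemma V_diff: "v \<in> V \<Longrightarrow> w \<in> V \<Longrightarrow> (\<lambda>y x. v y x - w y x) \<in> V"
  unfolding space_V_def by (rule H.bochner_L2_diff)

lemma V_scale: "v \<in> V \<Longrightarrow> (\<lambda>y x. c *\<^sub>R v y x) \<in> V"
  unfolding space_V_def by (rule H.bochner_L2_scale)

lemma W_add: "v \<in> W \<Longrightarrow> w \<in> W \<Longrightarrow> (\<lambda>y x. v y x + w y x) \<in> W"
  unfolding space_W_def by (rule L.bochner_L2_add)

lemma W_diff: "v \<in> W \<Longrightarrow> w \<in> W \<Longrightarrow> (\<lambda>y x. v y x - w y x) \<in> W"
  unfolding space_W_def by (rule L.bochner_L2_diff)

lemma W_scale: "v \<in> W \<Longrightarrow> (\<lambda>y x. c *\<^sub>R v y x) \<in> W"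
  unfolding space_W_def by (rule L.bochner_L2_scale)

text \<open>Korn's inequality concerns functions of x, so it is applied for one parameter value at a
  time. The upper bound uses that symmetrising a matrix does not increase its Frobenius
  norm.\<close>

lemma energy_bounds_pointwise:
  assumes y: "y \<in> space param_measure" and v: "v \<in> h1_E0 D dD"
    and E: "AE x in lebesgue_on D. Emin \<le> E x y \<and> E x y \<le> Emax"
  shows "Emin * CK * l2_inner D (weak_grad D v) (weak_grad D v) \<le>
      (LINT x|lebesgue_on D. E x y * (sym_part (weak_grad D v x) \<bullet> sym_part (weak_grad D v x)))"
    and "(LINT x|lebesgue_on D. E x y * (sym_part (weak_grad D v x) \<bullet> sym_part (weak_grad D v x))) \<le>
      Emax * l2_inner D (weak_grad D v) (weak_grad D v)"
proof -
  let ?S = "\<lambda>x. sym_part (weak_grad D v x)"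
  note G = weak_grad(1)[OF h1_E0_h1[OF v]]
  have S: "?S \<in> l2_space D"
    by (rule linear_grad_l2(1)[OF bounded_linear_sym_part _ _ h1_E0_h1[OF v], of 1]) (simp_all add: norm_sym_part)
  note int = l2_weighted_bound(1)[OF S S joint_measurable_section[OF E_meas y] E_bounded(1)[OF y] E_bounded(2)]
  have "CK * l2_inner D (weak_grad D v) (weak_grad D v) \<le> (LINT x|lebesgue_on D. ?S x \<bullet> ?S x)"
    using korn v by (simp add: korn_const_def strain_eq l2_norm_sq)
  then have "Emin * CK * l2_inner D (weak_grad D v) (weak_grad D v) \<le> (LINT x|lebesgue_on D. Emin * (?S x \<bullet> ?S x))"
    using Emin_pos by simp
  also have "\<dots> \<le> (LINT x|lebesgue_on D. E x y * (?S x \<bullet> ?S x))"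
  proof (rule integral_mono_AE)
    show "AE x in lebesgue_on D. Emin * (?S x \<bullet> ?S x) \<le> E x y * (?S x \<bullet> ?S x)"
      using E by eventually_elim (simp add: mult_right_mono)
  qed (use l2_inner_integrable[OF S S] int in simp_all)
  finally show "Emin * CK * l2_inner D (weak_grad D v) (weak_grad D v) \<le>
    (LINT x|lebesgue_on D. E x y * (?S x \<bullet> ?S x))" .
  have "(LINT x|lebesgue_on D. E x y * (?S x \<bullet> ?S x)) \<le>
    (LINT x|lebesgue_on D. Emax * (weak_grad D v x \<bullet> weak_grad D v x))"
  proof (rule integral_mono_AE)
    show "AE x in lebesgue_on D. E x y * (?S x \<bullet> ?S x) \<le> Emax * (weak_grad D v x \<bullet> weak_grad D v x)"
      using E
    proof eventually_elim
      case (elim x)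
      have "?S x \<bullet> ?S x \<le> weak_grad D v x \<bullet> weak_grad D v x"
        unfolding power2_norm_eq_inner[symmetric] by (intro power_mono norm_sym_part norm_ge_zero)
      then show ?case using elim Emin_pos by (intro mult_mono) auto
    qed
  qed (use l2_inner_integrable[OF G G] int in simp_all)
  then show "(LINT x|lebesgue_on D. E x y * (?S x \<bullet> ?S x)) \<le> Emax * l2_inner D (weak_grad D v) (weak_grad D v)"
    by (simp add: l2_inner_def)
qed

lemma form_a_bounds:
  assumes "v \<in> V"
  shows "Emin * CK * form_a0 D \<alpha> v v \<le> form_a D \<alpha> E v v" "form_a D \<alpha> E v v \<le> Emax * form_a0 D \<alpha> v v"
proof -
  have v: "v \<in> bochner_L2 param_measure (h1_E0 D dD) (h1_norm D)" using assms by (simp add: space_V_def)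
  note intA = A.pairing_integrable[OF v v] and intG = G.pairing_integrable[OF v v]
  have "Emin * CK * (LINT y|param_measure. l2_inner D (weak_grad D (v y)) (weak_grad D (v y))) \<le>
    (LINT y|param_measure. LINT x|lebesgue_on D. E x y * (sym_part (weak_grad D (v y) x) \<bullet> sym_part (weak_grad D (v y) x)))"
    unfolding integral_mult_right_zero[symmetric]
  proof (rule integral_mono_AE)
    show "AE y in param_measure. Emin * CK * l2_inner D (weak_grad D (v y)) (weak_grad D (v y)) \<le>
      (LINT x|lebesgue_on D. E x y * (sym_part (weak_grad D (v y) x) \<bullet> sym_part (weak_grad D (v y) x)))"
      using E_AE AE_space by eventually_elim (rule energy_bounds_pointwise(1)[OF _ V_mem[OF assms]])
  qed (use intA intG in simp_all)
  then show "Emin * CK * form_a0 D \<alpha> v v \<le> form_a D \<alpha> E v v"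
    unfolding form_a_eq form_a0_eq mult.left_commute[of "Emin * CK" \<alpha>]
    using alpha_pos by (intro mult_left_mono) auto
  have "(LINT y|param_measure. LINT x|lebesgue_on D. E x y * (sym_part (weak_grad D (v y) x) \<bullet> sym_part (weak_grad D (v y) x)))
    \<le> Emax * (LINT y|param_measure. l2_inner D (weak_grad D (v y)) (weak_grad D (v y)))"
    unfolding integral_mult_right_zero[symmetric]
  proof (rule integral_mono_AE)
    show "AE y in param_measure. (LINT x|lebesgue_on D. E x y * (sym_part (weak_grad D (v y) x) \<bullet> sym_part (weak_grad D (v y) x)))
      \<le> Emax * l2_inner D (weak_grad D (v y)) (weak_grad D (v y))"
      using E_AE AE_space by eventually_elim (rule energy_bounds_pointwise(2)[OF _ V_mem[OF assms]])
  qed (use intA intG in simp_all)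
  then show "form_a D \<alpha> E v v \<le> Emax * form_a0 D \<alpha> v v"
    unfolding form_a_eq form_a0_eq mult.left_commute[of Emax \<alpha>]
    using alpha_pos by (intro mult_left_mono) auto
qed

lemma form_a0_nonneg: "0 \<le> form_a0 D \<alpha> v v"
  unfolding form_a0_def using alpha_pos by (intro mult_nonneg_nonneg integral_nonneg_AE AE_I2) auto

sublocale form_a0: psd_form V "form_a0 D \<alpha>"
proof
  fix u v w and c :: real
  assume v: "v \<in> V" and w: "w \<in> V"
  show "(\<lambda>y x. v y x + w y x) \<in> V" using v w by (rule V_add)
  show "form_a0 D \<alpha> (\<lambda>y x. c *\<^sub>R v y x) w = c * form_a0 D \<alpha> v w"
    unfolding form_a0_eq using v w G.pairing_scale_left[of v w c] by (simp add: space_V_def)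
  show "form_a0 D \<alpha> v w = form_a0 D \<alpha> w v" by (simp add: form_a0_def inner_commute)
  assume u: "u \<in> V"
  show "form_a0 D \<alpha> (\<lambda>y x. u y x + v y x) w = form_a0 D \<alpha> u w + form_a0 D \<alpha> v w"
    unfolding form_a0_eq using u v w G.pairing_add_left[of u v w] by (simp add: space_V_def distrib_left)
qed (rule V_scale form_a0_nonneg; assumption)+

sublocale form_a: psd_form V "form_a D \<alpha> E"
proof
  fix u v w and c :: real
  assume v: "v \<in> V"
  have "0 \<le> Emin * CK * form_a0 D \<alpha> v v"
    using Emin_pos korn form_a0_nonneg by (simp add: korn_const_def)
  also have "\<dots> \<le> form_a D \<alpha> E v v" using v by (rule form_a_bounds)
  finally show "0 \<le> form_a D \<alpha> E v v" .
  assume w: "w \<in> V"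
  show "(\<lambda>y x. v y x + w y x) \<in> V" using v w by (rule V_add)
  show "form_a D \<alpha> E (\<lambda>y x. c *\<^sub>R v y x) w = c * form_a D \<alpha> E v w"
    unfolding form_a_eq using v w A.pairing_scale_left[of v w c] by (simp add: space_V_def)
  show "form_a D \<alpha> E v w = form_a D \<alpha> E w v" by (simp add: form_a_def inner_commute)
  assume u: "u \<in> V"
  show "form_a D \<alpha> E (\<lambda>y x. u y x + v y x) w = form_a D \<alpha> E u w + form_a D \<alpha> E v w"
    unfolding form_a_eq using u v w A.pairing_add_left[of u v w] by (simp add: space_V_def distrib_left)
qed (rule V_scale)

sublocale inner_W: psd_form W "inner_W D"
proof
  fix u v w :: "(nat \<Rightarrow> real) \<Rightarrow> real ^ 'd \<Rightarrow> real" and c :: real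
  assume v: "v \<in> W" and w: "w \<in> W"
  show "(\<lambda>y x. v y x + w y x) \<in> W" using v w by (rule W_add)
  show "inner_W D (\<lambda>y x. c *\<^sub>R v y x) w = c * inner_W D v w"
    unfolding inner_W_def using v w by (intro Q.pairing_scale_left) (simp_all add: space_W_def)
  show "inner_W D v w = inner_W D w v" unfolding inner_W_def by (simp add: l2_inner_commute)
  assume u: "u \<in> W"
  show "inner_W D (\<lambda>y x. u y x + v y x) w = inner_W D u w + inner_W D v w"
    unfolding inner_W_def using u v w by (intro Q.pairing_add_left) (simp_all add: space_W_def)
qed (rule W_scale inner_W_nonneg; assumption)+

lemma norm_a0_sq: "(norm_a0 D \<alpha> v)\<^sup>2 = form_a0 D \<alpha> v v"
  by (simp add: norm_a0_def form_a0_nonneg)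

lemma norm_a0_pos: "0 \<le> norm_a0 D \<alpha> v"
  using alpha_pos by (intro norm_a0_nonneg) simp

lemma norm_a0_eq: "norm_a0 D \<alpha> v = sqrt \<alpha> * grad_norm_W D v"
  by (simp add: norm_a0_def form_a0_def grad_norm_W_def norm_W_def power2_norm_eq_inner real_sqrt_mult)

lemma form_a0_bound: "v \<in> V \<Longrightarrow> w \<in> V \<Longrightarrow> \<bar>form_a0 D \<alpha> v w\<bar> \<le> norm_a0 D \<alpha> v * norm_a0 D \<alpha> w"
  unfolding norm_a0_def by (rule form_a0.F_cauchy_schwarz)

lemma norm_a0_scale:
  assumes "v \<in> V" shows "norm_a0 D \<alpha> (\<lambda>y x. c *\<^sub>R v y x) = \<bar>c\<bar> * norm_a0 D \<alpha> v"
proof -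
  have "form_a0 D \<alpha> (\<lambda>y x. c *\<^sub>R v y x) (\<lambda>y x. c *\<^sub>R v y x) = c\<^sup>2 * form_a0 D \<alpha> v v"
    using form_a0.F_scale[OF assms V_scale[OF assms]] form_a0.F_sym[OF assms V_scale[OF assms]]
      form_a0.F_scale[OF assms assms] by (simp add: power2_eq_square)
  then show ?thesis by (simp add: norm_a0_def real_sqrt_mult)
qed

lemma norm_a0_triangle:
  assumes "v \<in> V" "w \<in> V"
  shows "norm_a0 D \<alpha> (\<lambda>y x. v y x + t *\<^sub>R w y x) \<le> norm_a0 D \<alpha> v + \<bar>t\<bar> * norm_a0 D \<alpha> w"
proof (rule power2_le_imp_le)
  have "t * form_a0 D \<alpha> v w \<le> \<bar>t\<bar> * (norm_a0 D \<alpha> v * norm_a0 D \<alpha> w)"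
    using mult_left_mono[OF form_a0_bound[OF assms], of "\<bar>t\<bar>"] by (simp add: abs_mult[symmetric])
  then show "(norm_a0 D \<alpha> (\<lambda>y x. v y x + t *\<^sub>R w y x))\<^sup>2 \<le> (norm_a0 D \<alpha> v + \<bar>t\<bar> * norm_a0 D \<alpha> w)\<^sup>2"
    unfolding norm_a0_sq form_a0.F_quadratic[OF assms]
    by (simp add: power2_sum power_mult_distrib norm_a0_sq mult.left_commute)
qed (intro add_nonneg_nonneg mult_nonneg_nonneg norm_a0_pos abs_ge_zero)

text \<open>Cauchy-Schwarz is applied to a itself and the diagonal values are then compared with a0,
  which gives the constant \<open>Emax\<close> without further factors.\<close>

lemma form_a_bound:
  assumes "v \<in> V" "w \<in> V" "0 \<le> Emax"
  shows "\<bar>form_a D \<alpha> E v w\<bar> \<le> Emax * (norm_a0 D \<alpha> v * norm_a0 D \<alpha> w)"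
proof -
  have "\<bar>form_a D \<alpha> E v w\<bar> \<le> sqrt (form_a D \<alpha> E v v) * sqrt (form_a D \<alpha> E w w)"
    using assms(1,2) by (rule form_a.F_cauchy_schwarz)
  also have "\<dots> \<le> sqrt (Emax * form_a0 D \<alpha> v v) * sqrt (Emax * form_a0 D \<alpha> w w)"
    by (intro mult_mono real_sqrt_le_mono form_a_bounds assms real_sqrt_ge_zero form_a.F_nonneg
        mult_nonneg_nonneg form_a0_nonneg)
  also have "\<dots> = Emax * (norm_a0 D \<alpha> v * norm_a0 D \<alpha> w)"
    using assms(3) by (simp add: real_sqrt_mult norm_a0_def)
  finally show ?thesis .
qed

text \<open>Places divergences among the admissible pressures, so that the divergence of the
  discrete velocity can itself be inserted as a test function in b.\<close>

lemma div_mem_W: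
  assumes "v \<in> V" shows "(\<lambda>y. weak_div D (v y)) \<in> W"
  unfolding space_W_def
proof (rule bochner_L2_transform[OF H.seminormed_axioms L.seminormed_axioms])
  show "v \<in> bochner_L2 param_measure (h1_E0 D dD) (h1_norm D)" using assms by (simp add: space_V_def)
  have norm: "l2_norm D (weak_div D z) \<le> sqrt CARD('d) * h1_norm D z" if "z \<in> h1_E0 D dD" for z
    by (rule order_trans[OF weak_div_l2(2)[OF h1_E0_h1[OF that]] mult_left_mono[OF h1_norm_ge(2)]]) simp
  fix z z' assume z: "z \<in> h1_E0 D dD"
  show "l2_norm D (weak_div D z) \<le> sqrt CARD('d) * h1_norm D z" using z by (rule norm)
  show "weak_div D z \<in> l2_space D" using z by (intro weak_div_l2 h1_E0_h1)
  assume z': "z' \<in> h1_E0 D dD"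
  note zs = H.scale_mem[OF z', of "- 1"]
  have "AE x in lebesgue_on D. weak_div D (\<lambda>x. z x - z' x) x = weak_div D z x - weak_div D z' x"
    using linear_grad_add[OF bounded_linear_trace h1_E0_h1[OF z] h1_E0_h1[OF zs]]
      linear_grad_scale[OF bounded_linear_trace h1_E0_h1[OF z'], of "- 1"]
    by eventually_elim (simp add: weak_div_def)
  then have "l2_norm D (weak_div D (\<lambda>x. z x - z' x)) = l2_norm D (\<lambda>x. weak_div D z x - weak_div D z' x)"
    using z z' by (intro l2_norm_cong_AE l2_diff weak_div_l2 h1_E0_h1[where dD = dD] H.diff_mem)
  with norm[OF H.diff_mem[OF z z']]
  show "l2_norm D (\<lambda>x. weak_div D z x - weak_div D z' x) \<le> sqrt CARD('d) * h1_norm D (\<lambda>x. z x - z' x)" by simp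
qed

lemma norm_W_div:
  assumes "v \<in> V" shows "norm_W D (\<lambda>y. weak_div D (v y)) \<le> sqrt CARD('d) * grad_norm_W D v"
proof -
  have v: "v \<in> bochner_L2 param_measure (h1_E0 D dD) (h1_norm D)" using assms by (simp add: space_V_def)
  have d: "(\<lambda>y. weak_div D (v y)) \<in> bochner_L2 param_measure (l2_space D) (l2_norm D)"
    using div_mem_W[OF assms] by (simp add: space_W_def)
  have "inner_W D (\<lambda>y. weak_div D (v y)) (\<lambda>y. weak_div D (v y)) \<le>
    (LINT y|param_measure. real CARD('d) * l2_inner D (weak_grad D (v y)) (weak_grad D (v y)))"
    unfolding inner_W_def
  proof (rule integral_mono)
    show "integrable param_measure (\<lambda>y. l2_inner D (weak_div D (v y)) (weak_div D (v y)))"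
      by (rule Q.pairing_integrable[OF d d])
    show "integrable param_measure (\<lambda>y. real CARD('d) * l2_inner D (weak_grad D (v y)) (weak_grad D (v y)))"
      using G.pairing_integrable[OF v v] by simp
    fix y assume "y \<in> space param_measure"
    from power_mono[OF weak_div_l2(2)[OF h1_E0_h1[OF V_mem[OF assms this]]], of 2]
    show "l2_inner D (weak_div D (v y)) (weak_div D (v y)) \<le> real CARD('d) * l2_inner D (weak_grad D (v y)) (weak_grad D (v y))"
      by (simp add: l2_norm_nonneg power_mult_distrib l2_norm_sq)
  qed
  then have "norm_W D (\<lambda>y. weak_div D (v y)) \<le>
    sqrt (real CARD('d) * (LINT y|param_measure. l2_inner D (weak_grad D (v y)) (weak_grad D (v y))))"
    unfolding norm_W_eq by (intro real_sqrt_le_mono) simp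
  then show ?thesis
    by (simp add: grad_norm_W_def norm_W_eq inner_W_def real_sqrt_mult)
qed

lemma form_b_eq: "form_b D v q = - inner_W D q (\<lambda>y. weak_div D (v y))"
  by (simp add: form_b_def inner_W_def l2_inner_def)

lemma form_b_bound:
  assumes "v \<in> V" "q \<in> W"
  shows "\<bar>form_b D v q\<bar> \<le> norm_W D q * norm_W D (\<lambda>y. weak_div D (v y))"
  unfolding form_b_eq norm_W_eq using inner_W.F_cauchy_schwarz[OF assms(2) div_mem_W[OF assms(1)]] by simp

lemma form_b_add_left: "v \<in> V \<Longrightarrow> w \<in> V \<Longrightarrow> q \<in> W \<Longrightarrow>
    form_b D (\<lambda>y x. v y x + w y x) q = form_b D v q + form_b D w q"
  unfolding form_b_def using B.pairing_add_left[of v w q] by (simp add: space_V_def space_W_def)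

lemma form_b_diff_left: "v \<in> V \<Longrightarrow> w \<in> V \<Longrightarrow> q \<in> W \<Longrightarrow>
    form_b D (\<lambda>y x. v y x - w y x) q = form_b D v q - form_b D w q"
  unfolding form_b_def using B.pairing_diff_left[of v w q] by (simp add: space_V_def space_W_def)

lemma form_b_scale_left: "v \<in> V \<Longrightarrow> q \<in> W \<Longrightarrow> form_b D (\<lambda>y x. c *\<^sub>R v y x) q = c * form_b D v q"
  unfolding form_b_def using B.pairing_scale_left[of v q c] by (simp add: space_V_def space_W_def)

lemma form_b_diff_right: "v \<in> V \<Longrightarrow> q \<in> W \<Longrightarrow> r \<in> W \<Longrightarrow>
    form_b D v (\<lambda>y x. q y x - r y x) = form_b D v q - form_b D v r"
  unfolding form_b_def using B.pairing_diff_right[of v q r] by (simp add: space_V_def space_W_def)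

lemma form_a_diff_left: "u \<in> V \<Longrightarrow> v \<in> V \<Longrightarrow> w \<in> V \<Longrightarrow>
    form_a D \<alpha> E (\<lambda>y x. u y x - v y x) w = form_a D \<alpha> E u w - form_a D \<alpha> E v w"
  unfolding form_a_eq using A.pairing_diff_left[of u v w]
  by (simp add: space_V_def right_diff_distrib)

text \<open>Zero energy means a vanishing gradient for a.e. parameter, and Korn's inequality with
  the Dirichlet condition then removes the field itself. Turns \<open>eustar\<close> being nonzero
  into positive energy.\<close>

lemma norm_a0_eq_0_imp_zero:
  assumes v: "v \<in> V" "norm_a0 D \<alpha> v = 0" shows "zero_field D v"
proof -
  have vb: "v \<in> bochner_L2 param_measure (h1_E0 D dD) (h1_norm D)" using v(1) by (simp add: space_V_def)
  let ?g = "\<lambda>y. l2_inner D (weak_grad D (v y)) (weak_grad D (v y))"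
  have nn: "0 \<le> ?g y" for y unfolding l2_norm_sq[symmetric] by simp
  have "(LINT y|param_measure. ?g y) = 0"
    using v(2) norm_a0_sq[of v] alpha_pos by (simp add: form_a0_eq)
  then have "AE y in param_measure. ?g y = 0"
    using integral_nonneg_eq_0_iff_AE[OF G.pairing_integrable[OF vb vb]] nn by simp
  then have "AE y in param_measure. AE x in lebesgue_on D. v y x = 0"
    using AE_space
  proof eventually_elim
    case (elim y)
    note vy = V_mem[OF v(1) elim(2)]
    have "l2_norm D (weak_grad D (v y)) = 0" using elim(1) by (simp add: l2_norm_eq_inner)
    then have "AE x in lebesgue_on D. weak_grad D (v y) x = 0"
      by (rule l2_norm_eq_0[OF weak_grad(1)[OF h1_E0_h1[OF vy]]])
    then show ?case by (rule korn_grad_zero_imp_zero[OF dim korn vy])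
  qed
  then show ?thesis by (simp add: zero_field_def)
qed

lemma tensor_V: "Vh \<subseteq> h1_E0 D dD \<Longrightarrow> u \<in> tensor_space Vh (legendre_span \<Lambda>) \<Longrightarrow> u \<in> V"
  unfolding space_V_def
  by (rule H.tensor_space_subset_bochner_L2[OF finite_measure_param _ legendre_span_bounded_measurable])

lemma tensor_W: "Wh \<subseteq> l2_space D \<Longrightarrow> q \<in> tensor_space Wh (legendre_span \<Lambda>) \<Longrightarrow> q \<in> W"
  unfolding space_W_def
  by (rule L.tensor_space_subset_bochner_L2[OF finite_measure_param _ legendre_span_bounded_measurable])

lemma form_a0_tensor_orthogonal:
  assumes "V1 \<subseteq> h1_E0 D dD" "V2 \<subseteq> h1_E0 D dD" "\<Lambda> \<subseteq> multi_indices" "Q \<subseteq> multi_indices" "\<Lambda> \<inter> Q = {}"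
    and "v \<in> tensor_space V1 (legendre_span \<Lambda>)" "w \<in> tensor_space V2 (legendre_span Q)"
  shows "form_a0 D \<alpha> v w = 0"
  unfolding form_a0_eq
  using G.pairing_tensor_zero[OF finite_measure_param assms(1,2) legendre_span_bounded_measurable
      legendre_span_bounded_measurable refl legendre_span_orthogonal[OF assms(3-5)] assms(6,7)]
  by simp

text \<open>The right-hand side is the squared energy of v + w. As v y and w y lie in the spatial
  spaces for each y, the spatial CBS inequality can be used under the parameter integral, with its
  constant unchanged.\<close>

lemma strengthened_cauchy_schwarz:
  assumes Vh: "finite_dim_space Vh" "Vh \<subseteq> h1_E0 D dD" and Vt: "finite_dim_space Vt" "Vt \<subseteq> h1_E0 D dD"
    and cbs: "\<forall>v\<in>Vh. \<forall>w\<in>Vt. \<bar>LINT x|lebesgue_on D. weak_grad D v x \<bullet> weak_grad D w x\<bar>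
         \<le> \<gamma> * l2_norm D (weak_grad D v) * l2_norm D (weak_grad D w)"
    and v: "v \<in> tensor_space Vh (legendre_span \<Lambda>)" and w: "w \<in> tensor_space Vt (legendre_span \<Lambda>)"
  shows "(1 - \<gamma>\<^sup>2) * form_a0 D \<alpha> w w \<le> form_a0 D \<alpha> v v + 2 * form_a0 D \<alpha> v w + form_a0 D \<alpha> w w"
proof -
  have vb: "v \<in> bochner_L2 param_measure (h1_E0 D dD) (h1_norm D)"
    and wb: "w \<in> bochner_L2 param_measure (h1_E0 D dD) (h1_norm D)"
    using tensor_V[OF Vh(2) v] tensor_V[OF Vt(2) w] by (simp_all add: space_V_def)
  let ?g = "\<lambda>v w. l2_inner D (weak_grad D v) (weak_grad D w)"
  note int = G.pairing_integrable[OF vb vb] G.pairing_integrable[OF vb wb] G.pairing_integrable[OF wb wb]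
  have "(LINT y|param_measure. (1 - \<gamma>\<^sup>2) * ?g (w y) (w y)) \<le>
    (LINT y|param_measure. ?g (v y) (v y) + 2 * ?g (v y) (w y) + ?g (w y) (w y))"
  proof (rule integral_mono)
    fix y
    let ?a = "l2_norm D (weak_grad D (v y))" and ?b = "l2_norm D (weak_grad D (w y))"
    have "\<bar>?g (v y) (w y)\<bar> \<le> \<gamma> * ?a * ?b"
      using cbs tensor_space_pointwise[OF Vh(1) v] tensor_space_pointwise[OF Vt(1) w]
      by (simp add: l2_inner_def)
    \<comment> \<open>Completing the square: a^2 - 2 \<gamma> a b + b^2 = (a - \<gamma> b)^2 + (1 -
      \<gamma>^2) b^2.\<close>
    moreover have "0 \<le> (?a - \<gamma> * ?b)\<^sup>2" by simp
    moreover have "(?a - \<gamma> * ?b)\<^sup>2 = ?a\<^sup>2 - 2 * (\<gamma> * ?a * ?b) + \<gamma>\<^sup>2 * ?b\<^sup>2"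
      by (simp add: power2_diff power_mult_distrib)
    ultimately have "(1 - \<gamma>\<^sup>2) * ?b\<^sup>2 \<le> ?a\<^sup>2 + 2 * ?g (v y) (w y) + ?b\<^sup>2"
      by (simp add: left_diff_distrib)
    then show "(1 - \<gamma>\<^sup>2) * ?g (w y) (w y) \<le> ?g (v y) (v y) + 2 * ?g (v y) (w y) + ?g (w y) (w y)"
      by (simp add: l2_norm_sq)
  qed (use int in simp_all)
  also have "\<dots> = (LINT y|param_measure. ?g (v y) (v y)) + 2 * (LINT y|param_measure. ?g (v y) (w y)) +
      (LINT y|param_measure. ?g (w y) (w y))"
    using int by simp
  finally have "\<alpha> * ((1 - \<gamma>\<^sup>2) * (LINT y|param_measure. ?g (w y) (w y))) \<le>
    \<alpha> * ((LINT y|param_measure. ?g (v y) (v y)) + 2 * (LINT y|param_measure. ?g (v y) (w y)) +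
      (LINT y|param_measure. ?g (w y) (w y)))"
    using alpha_pos by simp
  then show ?thesis unfolding form_a0_eq by (simp add: algebra_simps)
qed

end

subsection \<open>Reliability and efficiency of the estimator\<close>

text \<open>To be read with A and B as the two parts of the error norm, r the energy norm of
  \<open>eu0\<close>, d the divergence estimator, m = \<open>Emin\<close>, M = \<open>Emax\<close>,
  \<kappa> the Korn constant and c the inf-sup constant. After b has been sent to c, Cauchy-Schwarz
  in the plane for (r, d) and (A + c/M B, B) bounds A^2 + B^2 by a multiple of its own square root,
  which is then cancelled.\<close>

lemma stability_arithmetic:
  fixes A B r d m M \<kappa> c :: real
  assumes main: "\<And>b. 0 < b \<Longrightarrow> b < c \<Longrightarrow>
      1 / 2 * m * min \<kappa> (b\<^sup>2 / M\<^sup>2) * (A\<^sup>2 + B\<^sup>2) \<le> r * (A + b / M * B) + d * B"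
    and nonneg: "0 \<le> A" "0 \<le> B" "0 \<le> r" "0 \<le> d" and pos: "0 < m" "0 < M" "0 < \<kappa>" "0 < c"
  shows "sqrt (A\<^sup>2 + B\<^sup>2) \<le> (sqrt (2 * (M\<^sup>2 + c\<^sup>2 + 1)) / M) /
      (1 / 2 * min \<kappa> (min (c\<^sup>2 / M\<^sup>2) (1 / M\<^sup>2)) * m) * sqrt (r\<^sup>2 + d\<^sup>2)"
proof -
  define S where "S = A\<^sup>2 + B\<^sup>2"
  define X where "X = 1 / 2 * m * min \<kappa> (c\<^sup>2 / M\<^sup>2)"
  define C1 where "C1 = 1 / 2 * min \<kappa> (min (c\<^sup>2 / M\<^sup>2) (1 / M\<^sup>2))"
  define C2 where "C2 = sqrt (2 * (M\<^sup>2 + c\<^sup>2 + 1)) / M"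
  have S: "0 \<le> S" by (simp add: S_def)
  have C1: "0 < C1" unfolding C1_def using pos by simp
  have C2: "0 \<le> C2" unfolding C2_def using pos by (intro divide_nonneg_pos real_sqrt_ge_zero) auto
  have XS: "X * S \<le> r * (A + c / M * B) + d * B"
  proof (rule field_le_mult_one_interval)
    fix z :: real assume z: "0 < z" "z < 1"
    \<comment> \<open>With this b one has b^2 = z c^2, so the minimum shrinks by at most the factor
      z, while the right-hand side only grows when b is replaced by c. All z below 1 together give
      the limit.\<close>
    define b where "b = sqrt z * c"
    have sz: "0 < sqrt z" "sqrt z < 1" using z by auto
    have b: "0 < b" "b < c" using sz pos(4) by (auto simp: b_def)
    have b2: "b\<^sup>2 / M\<^sup>2 = z * (c\<^sup>2 / M\<^sup>2)" using z by (simp add: b_def power_mult_distrib)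
    have "z * min \<kappa> (c\<^sup>2 / M\<^sup>2) \<le> min \<kappa> (z * (c\<^sup>2 / M\<^sup>2))"
    proof (rule min.boundedI)
      have "z * min \<kappa> (c\<^sup>2 / M\<^sup>2) \<le> 1 * \<kappa>" using z pos by (intro mult_mono) auto
      then show "z * min \<kappa> (c\<^sup>2 / M\<^sup>2) \<le> \<kappa>" by simp
      show "z * min \<kappa> (c\<^sup>2 / M\<^sup>2) \<le> z * (c\<^sup>2 / M\<^sup>2)" using z by (intro mult_left_mono) auto
    qed
    then have "(1 / 2 * m) * (z * min \<kappa> (c\<^sup>2 / M\<^sup>2)) * S \<le> (1 / 2 * m) * min \<kappa> (b\<^sup>2 / M\<^sup>2) * S"
      unfolding b2 using pos S by (intro mult_right_mono mult_left_mono) auto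
    also have "\<dots> \<le> r * (A + b / M * B) + d * B" using main[OF b] by (simp add: S_def)
    also have "\<dots> \<le> r * (A + c / M * B) + d * B"
      using b pos nonneg by (intro add_right_mono mult_left_mono add_left_mono mult_right_mono divide_right_mono) auto
    finally show "z * (X * S) \<le> r * (A + c / M * B) + d * B" by (simp add: X_def mult_ac)
  qed
  have "X \<ge> C1 * m" unfolding X_def C1_def using pos by simp
  then have "(C1 * m) * S \<le> X * S" using S by (rule mult_right_mono)
  also have "\<dots> \<le> r * (A + c / M * B) + d * B" by (rule XS)
  also have "\<dots> \<le> sqrt (r\<^sup>2 + d\<^sup>2) * sqrt ((A + c / M * B)\<^sup>2 + B\<^sup>2)"
  proof -
    have "(r, d) \<bullet> (A + c / M * B, B) \<le> norm (r, d) * norm (A + c / M * B, B)"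
      by (rule norm_cauchy_schwarz)
    then show ?thesis by (simp add: norm_Pair)
  qed
  also have "\<dots> \<le> sqrt (r\<^sup>2 + d\<^sup>2) * (C2 * sqrt S)"
  proof (rule mult_left_mono)
    have "(A + c / M * B)\<^sup>2 \<le> 2 * A\<^sup>2 + 2 * (c / M * B)\<^sup>2"
      using sum_squares_bound[of A "c / M * B"] by (simp add: power2_sum)
    also have "(c / M * B)\<^sup>2 = c\<^sup>2 / M\<^sup>2 * B\<^sup>2" by (simp add: power_mult_distrib power_divide)
    finally have "(A + c / M * B)\<^sup>2 + B\<^sup>2 \<le> 2 * A\<^sup>2 + (2 * (c\<^sup>2 / M\<^sup>2) + 1) * B\<^sup>2"
      by (simp add: algebra_simps)
    \<comment> \<open>Both coefficients are raised to the common value 2 (M^2 + c^2 + 1) / M^2,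
      which is the square of \<open>C2\<close>.\<close>
    also have "\<dots> \<le> (2 * (1 + c\<^sup>2 / M\<^sup>2 + 1 / M\<^sup>2)) * A\<^sup>2 + (2 * (1 + c\<^sup>2 / M\<^sup>2 + 1 / M\<^sup>2)) * B\<^sup>2"
      by (intro add_mono mult_right_mono) auto
    also have "\<dots> = C2\<^sup>2 * S"
    proof -
      have "C2\<^sup>2 = 2 * (M\<^sup>2 + c\<^sup>2 + 1) / M\<^sup>2" by (simp add: C2_def power_divide)
      also have "\<dots> = 2 * (1 + c\<^sup>2 / M\<^sup>2 + 1 / M\<^sup>2)" using pos by (simp add: field_simps)
      finally show ?thesis by (simp add: S_def distrib_left)
    qed
    finally have "sqrt ((A + c / M * B)\<^sup>2 + B\<^sup>2) \<le> sqrt (C2\<^sup>2 * S)" by (rule real_sqrt_le_mono)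
    then show "sqrt ((A + c / M * B)\<^sup>2 + B\<^sup>2) \<le> C2 * sqrt S" using C2 by (simp add: real_sqrt_mult)
  qed simp
  finally have fin: "(C1 * m) * sqrt S * sqrt S \<le> (sqrt (r\<^sup>2 + d\<^sup>2) * C2) * sqrt S"
    using S by (simp add: mult.assoc)
  have "(C1 * m) * sqrt S \<le> sqrt (r\<^sup>2 + d\<^sup>2) * C2"
  proof (cases "sqrt S = 0")
    case True then show ?thesis using C2 by simp
  next
    case False
    then have "0 < sqrt S" using S by simp
    then show ?thesis using fin by (rule mult_right_le_imp_le[rotated])
  qed
  then have "sqrt S \<le> sqrt (r\<^sup>2 + d\<^sup>2) * C2 / (C1 * m)"
    using C1 pos by (simp add: pos_le_divide_eq mult.commute)
  then show ?thesis unfolding S_def C1_def C2_def by (simp add: mult_ac)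
qed

text \<open>The origin of \<open>C6\<close>, with s = sqrt d: the two squares add up to at most (M^2
  + 2 s^2) (A^2 + B^2), and M^2 + 2 s^2 \<le> 2 (M + s)^2.\<close>

lemma efficiency_arithmetic:
  fixes A B M s \<eta>1 \<eta>2 :: real
  assumes "0 \<le> \<eta>1" "\<eta>1 \<le> M * A + s * B" "0 \<le> \<eta>2" "\<eta>2 \<le> s * A" "0 < M" "0 < s" "0 \<le> A" "0 \<le> B"
  shows "inverse (sqrt 2 * (M + s)) * sqrt (\<eta>1\<^sup>2 + \<eta>2\<^sup>2) \<le> sqrt (A\<^sup>2 + B\<^sup>2)"
proof -
  have "\<eta>1\<^sup>2 \<le> (M * A + s * B)\<^sup>2" using assms by (intro power_mono)
  \<comment> \<open>Lagrange's identity: the difference of the two sides is (M B - s A)^2.\<close>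
  also have "\<dots> \<le> (M\<^sup>2 + s\<^sup>2) * (A\<^sup>2 + B\<^sup>2)"
    using zero_le_power2[of "M * B - s * A"] by (simp add: power2_eq_square algebra_simps)
  finally have 1: "\<eta>1\<^sup>2 \<le> (M\<^sup>2 + s\<^sup>2) * (A\<^sup>2 + B\<^sup>2)" .
  have "\<eta>2\<^sup>2 \<le> (s * A)\<^sup>2" using assms by (intro power_mono)
  also have "\<dots> \<le> s\<^sup>2 * (A\<^sup>2 + B\<^sup>2)" by (simp add: power_mult_distrib mult_left_mono)
  finally have "\<eta>1\<^sup>2 + \<eta>2\<^sup>2 \<le> (M\<^sup>2 + 2 * s\<^sup>2) * (A\<^sup>2 + B\<^sup>2)" using 1 by (simp add: algebra_simps)
  also have "\<dots> \<le> (2 * (M + s)\<^sup>2) * (A\<^sup>2 + B\<^sup>2)"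
    using assms by (intro mult_right_mono) (simp_all add: power2_sum)
  finally have "sqrt (\<eta>1\<^sup>2 + \<eta>2\<^sup>2) \<le> sqrt ((2 * (M + s)\<^sup>2) * (A\<^sup>2 + B\<^sup>2))" by (rule real_sqrt_le_mono)
  also have "\<dots> = (sqrt 2 * (M + s)) * sqrt (A\<^sup>2 + B\<^sup>2)" using assms by (simp add: real_sqrt_mult)
  finally have le: "sqrt (\<eta>1\<^sup>2 + \<eta>2\<^sup>2) \<le> (sqrt 2 * (M + s)) * sqrt (A\<^sup>2 + B\<^sup>2)" .
  have "0 < sqrt 2 * (M + s)" using assms by simp
  with le show ?thesis by (metis divide_inverse_commute pos_divide_le_eq mult.commute)
qed

text \<open>Here x is the energy norm of \<open>eustar\<close>, and T the squared energy of its
  components outside the Galerkin space. The first bound gives sqrt T \<le> x / sqrt (1 -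
  \<gamma>^2); inserted into the second, one factor x cancels.\<close>

lemma cbs_arithmetic:
  fixes x \<gamma> T \<eta> :: real
  assumes "0 \<le> \<gamma>" "\<gamma> < 1" "0 \<le> x" "0 \<le> \<eta>" "0 \<le> T" "(1 - \<gamma>\<^sup>2) * T \<le> x\<^sup>2" "x\<^sup>2 \<le> \<eta> * sqrt T"
  shows "x \<le> \<eta> / sqrt (1 - \<gamma>\<^sup>2)"
proof (cases "x = 0")
  case True
  then show ?thesis using assms(1,2,4) by (simp add: power_le_one)
next
  case False
  then have x: "0 < x" using assms(3) by simp
  have g: "0 < 1 - \<gamma>\<^sup>2" using assms(1,2) by (simp add: power_less_one_iff)
  have "sqrt (1 - \<gamma>\<^sup>2) * sqrt T \<le> x"
    using real_sqrt_le_mono[OF assms(6)] x by (simp add: real_sqrt_mult)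
  then have "\<eta> * (sqrt (1 - \<gamma>\<^sup>2) * sqrt T) \<le> \<eta> * x" using assms(4) by (rule mult_left_mono)
  moreover have "sqrt (1 - \<gamma>\<^sup>2) * x\<^sup>2 \<le> sqrt (1 - \<gamma>\<^sup>2) * (\<eta> * sqrt T)"
    using assms(7) g by (intro mult_left_mono) auto
  ultimately have "(sqrt (1 - \<gamma>\<^sup>2) * x) * x \<le> \<eta> * x" by (simp add: power2_eq_square mult_ac)
  then have "sqrt (1 - \<gamma>\<^sup>2) * x \<le> \<eta>" using x by simp
  then show ?thesis using g by (simp add: pos_le_divide_eq mult.commute)
qed

text \<open>The witness sqrt (1 - (a/b)^2) turns the second inequality into an equality. It is below
  1 because a is positive.\<close>

lemma saturation_exists:
  fixes a b :: real
  assumes "0 < a" "a \<le> b"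
  shows "\<exists>\<Theta>\<in>{0..<1}. a \<le> b \<and> b \<le> 1 / sqrt (1 - \<Theta>\<^sup>2) * a"
proof -
  define q where "q = a / b"
  have q: "0 < q" "q \<le> 1" using assms by (auto simp: q_def)
  then have q2: "0 < q\<^sup>2" "q\<^sup>2 \<le> 1" by (auto simp: power_le_one)
  have "1 - (sqrt (1 - q\<^sup>2))\<^sup>2 = q\<^sup>2" using q2 by simp
  then have "1 / sqrt (1 - (sqrt (1 - q\<^sup>2))\<^sup>2) * a = b" using q assms by (simp add: q_def)
  moreover have "sqrt (1 - q\<^sup>2) \<in> {0..<1}" using q2 by auto
  ultimately show ?thesis using assms(2) by (intro bexI[of _ "sqrt (1 - q\<^sup>2)"]) auto
qed

section \<open>Stability of the mixed problem\<close>

context stokes_forms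
begin

text \<open>A field whose quotient exceeds b times the norm of q exists because b is strictly below
  the constant, even when the supremum is not attained. With B the scaled norm of q, the field is
  normalised to have b(w, q) = B^2 and then has energy at most B / b.\<close>

lemma inf_sup_witness:
  assumes isc: "inf_sup_const D dD c" and q: "q \<in> W" and b: "0 < b" "b < c"
  obtains w where "w \<in> V" "form_b D w q = inverse \<alpha> * (norm_W D q)\<^sup>2"
    "norm_a0 D \<alpha> w \<le> sqrt (inverse \<alpha>) * norm_W D q / b"
\<comment> \<open>For q of norm 0 the strict inequality between the b- and c-multiples of its norm
  fails; the zero field is a witness in that case.\<close>
proof (cases "norm_W D q = 0")
  case True
  have z: "(\<lambda>y x. 0) \<in> V"
    unfolding space_V_def by (rule H.bochner_L2_const[OF finite_measure_param H.zero_mem])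
  then have "form_b D (\<lambda>y x. 0 *\<^sub>R 0) q = 0 * form_b D (\<lambda>y x. 0) q" "norm_a0 D \<alpha> (\<lambda>y x. 0 *\<^sub>R 0) = \<bar>0\<bar> * norm_a0 D \<alpha> (\<lambda>y x. 0)"
    using form_b_scale_left[OF z q, of 0] norm_a0_scale[OF z, of 0] by simp_all
  then show thesis using True z by (intro that[of "\<lambda>y x. 0"]) simp_all
next
  case False
  then have qpos: "0 < norm_W D q" using norm_W_nonneg[of D q] by simp
  define B where "B = sqrt (inverse \<alpha>) * norm_W D q"
  have B: "0 < B" "B\<^sup>2 = inverse \<alpha> * (norm_W D q)\<^sup>2"
    using qpos alpha_pos by (simp_all add: B_def power_mult_distrib)
  have "ereal (b * norm_W D q) < ereal (c * norm_W D q)" using b qpos by simp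
  also have "\<dots> \<le> (SUP v\<in>{v \<in> V. \<not> zero_field D v}. ereal (form_b D v q / grad_norm_W D v))"
    using isc q unfolding inf_sup_const_def by blast
  finally obtain w where w: "w \<in> V" "b * norm_W D q < form_b D w q / grad_norm_W D w"
    unfolding less_SUP_iff by auto
  have "0 < b * norm_W D q" using b qpos by simp
  \<comment> \<open>A quotient with denominator 0 has the value 0, so positivity also shows that the
    gradient norm is positive.\<close>
  then have "0 < form_b D w q / grad_norm_W D w" using w(2) by linarith
  moreover have "0 \<le> grad_norm_W D w" by (simp add: grad_norm_W_def norm_W_nonneg)
  ultimately have g: "0 < grad_norm_W D w" and f: "0 < form_b D w q"
    by (auto simp: zero_less_divide_iff)
  have lt: "b * norm_W D q * grad_norm_W D w < form_b D w q" using w(2) g by (simp add: pos_less_divide_eq)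
  have "norm_W D q * grad_norm_W D w = B * norm_a0 D \<alpha> w"
    using alpha_pos by (simp add: B_def norm_a0_eq real_sqrt_inverse)
  with lt have le: "b * B * norm_a0 D \<alpha> w \<le> form_b D w q" by (simp add: mult.assoc)
  \<comment> \<open>The scaling that normalises b(t w, q) to B^2.\<close>
  define t where "t = B\<^sup>2 / form_b D w q"
  have t: "0 < t" unfolding t_def using B(1) f by (intro divide_pos_pos zero_less_power)
  show thesis
  proof (rule that)
    show "(\<lambda>y x. t *\<^sub>R w y x) \<in> V" using w(1) by (rule V_scale)
    show "form_b D (\<lambda>y x. t *\<^sub>R w y x) q = inverse \<alpha> * (norm_W D q)\<^sup>2"
      using form_b_scale_left[OF w(1) q, of t] f by (simp add: t_def B(2))
    have "t * (b * B * norm_a0 D \<alpha> w) \<le> t * form_b D w q" using le t by (intro mult_left_mono) auto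
    also have "\<dots> = B * B" using f by (simp add: t_def power2_eq_square)
    finally have "B * (b * (t * norm_a0 D \<alpha> w)) \<le> B * B" by (simp add: mult_ac)
    then have "b * (t * norm_a0 D \<alpha> w) \<le> B" using B by simp
    then show "norm_a0 D \<alpha> (\<lambda>y x. t *\<^sub>R w y x) \<le> sqrt (inverse \<alpha>) * norm_W D q / b"
      unfolding B_def[symmetric] norm_a0_scale[OF w(1)] using b t by (simp add: pos_le_divide_eq mult.commute)
  qed
qed

text \<open>
  Testing with \<open>v = u + \<delta> w\<close>, where \<open>\<delta> = b\<^sup>2 / Emax\<close> and \<open>w\<close> is an inf-sup witness for \<open>q\<close>, and using
  \<open>a (u, u) + \<delta> a (u, w) \<ge> (a (u, u) - \<delta>\<^sup>2 a (w, w)) / 2\<close>.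
\<close>

lemma stability_bound:
  assumes isc: "inf_sup_const D dD c" and u: "u \<in> V" and q: "q \<in> W" and b: "0 < b" "b < c"
    and Emax: "Emin \<le> Emax"
    and R: "\<And>v. v \<in> V \<Longrightarrow> form_a D \<alpha> E u v + form_b D v q \<le> r * norm_a0 D \<alpha> v" "0 \<le> r"
    and d: "\<bar>form_b D u q\<bar> \<le> d * (sqrt (inverse \<alpha>) * norm_W D q)"
  shows "1 / 2 * Emin * min CK (b\<^sup>2 / Emax\<^sup>2) * ((norm_a0 D \<alpha> u)\<^sup>2 + (sqrt (inverse \<alpha>) * norm_W D q)\<^sup>2) \<le>
    r * (norm_a0 D \<alpha> u + b / Emax * (sqrt (inverse \<alpha>) * norm_W D q)) + d * (sqrt (inverse \<alpha>) * norm_W D q)"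
proof -
  define B where "B = sqrt (inverse \<alpha>) * norm_W D q"
  have B: "0 \<le> B" "B\<^sup>2 = inverse \<alpha> * (norm_W D q)\<^sup>2"
    using alpha_pos by (simp_all add: B_def power_mult_distrib norm_W_nonneg)
  have M: "0 < Emax" using Emin_pos Emax by simp
  obtain w where w: "w \<in> V" "form_b D w q = B\<^sup>2" "norm_a0 D \<alpha> w \<le> B / b"
    using inf_sup_witness[OF isc q b] B(2) B_def by metis
  \<comment> \<open>Chosen so that \<delta>^2 \<open>Emax\<close> / b^2 = \<delta>: then \<delta>^2
    a(w, w) \<le> \<delta> B^2, and half of it, the loss in the mixed term, consumes at most half of
    the gain \<delta> B^2 from the pressure.\<close>
  define \<delta> where "\<delta> = b\<^sup>2 / Emax"
  have \<delta>: "0 < \<delta>" using b M by (simp add: \<delta>_def)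
  define a where "a = form_a D \<alpha> E u u"
  let ?v = "\<lambda>y x. u y x + \<delta> *\<^sub>R w y x"
  have \<delta>w: "(\<lambda>y x. \<delta> *\<^sub>R w y x) \<in> V" using w(1) by (rule V_scale)
  have v: "?v \<in> V" using u \<delta>w by (rule V_add)
  have "0 \<le> a + 2 * \<delta> * form_a D \<alpha> E u w + \<delta>\<^sup>2 * form_a D \<alpha> E w w"
    unfolding a_def form_a.F_quadratic[OF u w(1), symmetric] using v by (rule form_a.F_nonneg)
  moreover have "\<delta>\<^sup>2 * form_a D \<alpha> E w w \<le> \<delta> * B\<^sup>2"
  proof -
    have "form_a D \<alpha> E w w \<le> Emax * (norm_a0 D \<alpha> w)\<^sup>2"
      using form_a_bounds(2)[OF w(1)] by (simp add: norm_a0_sq)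
    also have "\<dots> \<le> Emax * (B / b)\<^sup>2" using w(3) M by (intro mult_left_mono power_mono norm_a0_pos) auto
    finally have "\<delta>\<^sup>2 * form_a D \<alpha> E w w \<le> \<delta>\<^sup>2 * (Emax * (B / b)\<^sup>2)" by (rule mult_left_mono) simp
    also have "\<dots> = \<delta> * B\<^sup>2" using b M by (simp add: \<delta>_def power2_eq_square field_simps)
    finally show ?thesis .
  qed
  ultimately have low: "a / 2 + \<delta> * B\<^sup>2 / 2 \<le> a + \<delta> * form_a D \<alpha> E u w + \<delta> * B\<^sup>2" by linarith
  have "form_a D \<alpha> E u ?v = a + \<delta> * form_a D \<alpha> E u w"
  proof -
    have "form_a D \<alpha> E u ?v = form_a D \<alpha> E ?v u" using u v by (rule form_a.F_sym)
    also have "\<dots> = a + \<delta> * form_a D \<alpha> E w u"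
      using form_a.F_add[OF u \<delta>w u] form_a.F_scale[OF w(1) u] by (simp add: a_def)
    finally show ?thesis using form_a.F_sym[OF u w(1)] by simp
  qed
  moreover have "form_b D ?v q = form_b D u q + \<delta> * B\<^sup>2"
    using form_b_add_left[OF u \<delta>w q] form_b_scale_left[OF w(1) q] by (simp add: w(2))
  ultimately have "a + \<delta> * form_a D \<alpha> E u w + \<delta> * B\<^sup>2 = form_a D \<alpha> E u ?v + form_b D ?v q - form_b D u q"
    by simp
  also have "\<dots> \<le> r * norm_a0 D \<alpha> ?v + d * B" using R(1)[OF v] d by (simp add: B_def)
  also have "\<dots> \<le> r * (norm_a0 D \<alpha> u + b / Emax * B) + d * B"
  proof (intro add_right_mono mult_left_mono R(2))
    have "norm_a0 D \<alpha> ?v \<le> norm_a0 D \<alpha> u + \<delta> * norm_a0 D \<alpha> w"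
      using norm_a0_triangle[OF u w(1), of \<delta>] \<delta> by simp
    also have "\<delta> * norm_a0 D \<alpha> w \<le> \<delta> * (B / b)" using w(3) \<delta> by (intro mult_left_mono) auto
    also have "\<dots> = b / Emax * B" using b by (simp add: \<delta>_def power2_eq_square)
    finally show "norm_a0 D \<alpha> ?v \<le> norm_a0 D \<alpha> u + b / Emax * B" by simp
  qed
  finally have up: "a / 2 + \<delta> * B\<^sup>2 / 2 \<le> r * (norm_a0 D \<alpha> u + b / Emax * B) + d * B" using low by linarith
  \<comment> \<open>One coefficient for both parts: coercivity gives \<open>Emin * CK\<close> for
    the velocity, and \<delta> = \<open>Emax\<close> (b / \<open>Emax\<close>)^2 \<ge>
    \<open>Emin\<close> (b / \<open>Emax\<close>)^2 for the pressure.\<close>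
  define \<mu> where "\<mu> = min CK (b\<^sup>2 / Emax\<^sup>2)"
  have "Emin * \<mu> * (norm_a0 D \<alpha> u)\<^sup>2 \<le> Emin * CK * (norm_a0 D \<alpha> u)\<^sup>2"
    using Emin_pos by (intro mult_right_mono mult_left_mono) (auto simp: \<mu>_def)
  also have "\<dots> \<le> a" unfolding a_def norm_a0_sq using u by (rule form_a_bounds)
  finally have 1: "Emin * \<mu> * (norm_a0 D \<alpha> u)\<^sup>2 \<le> a" .
  have "Emin * \<mu> \<le> Emax * (b\<^sup>2 / Emax\<^sup>2)"
    using Emin_pos Emax b korn by (intro mult_mono) (auto simp: \<mu>_def korn_const_def)
  also have "\<dots> = \<delta>" using M by (simp add: \<delta>_def power2_eq_square)
  finally have 2: "Emin * \<mu> * B\<^sup>2 \<le> \<delta> * B\<^sup>2" by (rule mult_right_mono) simp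
  have "1 / 2 * Emin * \<mu> * ((norm_a0 D \<alpha> u)\<^sup>2 + B\<^sup>2) = (Emin * \<mu> * (norm_a0 D \<alpha> u)\<^sup>2 + Emin * \<mu> * B\<^sup>2) / 2"
    by (simp add: algebra_simps)
  also have "\<dots> \<le> (a + \<delta> * B\<^sup>2) / 2" using add_mono[OF 1 2] by (rule divide_right_mono) simp
  also have "\<dots> = a / 2 + \<delta> * B\<^sup>2 / 2" by (simp add: add_divide_distrib)
  also note up
  finally show ?thesis unfolding \<mu>_def B_def .
qed

lemma norm_S_eq: "norm_S D \<alpha> v q = sqrt ((norm_a0 D \<alpha> v)\<^sup>2 + (sqrt (inverse \<alpha>) * norm_W D q)\<^sup>2)"
  using alpha_pos by (simp add: norm_S_def norm_a0_eq power_mult_distrib)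

lemma form_b_energy_bound:
  assumes "v \<in> V" "q \<in> W"
  shows "\<bar>form_b D v q\<bar> \<le> sqrt \<alpha> * norm_W D (\<lambda>y. weak_div D (v y)) * (sqrt (inverse \<alpha>) * norm_W D q)"
proof -
  have "sqrt \<alpha> * sqrt (inverse \<alpha>) = 1" using alpha_pos by (simp add: real_sqrt_inverse)
  then have *: "sqrt \<alpha> * x * (sqrt (inverse \<alpha>) * y) = y * x" for x y
    by (metis mult.assoc mult.commute mult.left_neutral)
  show ?thesis unfolding * by (rule form_b_bound[OF assms])
qed

lemma div_energy_bound:
  assumes "v \<in> V"
  shows "sqrt \<alpha> * norm_W D (\<lambda>y. weak_div D (v y)) \<le> sqrt CARD('d) * norm_a0 D \<alpha> v"
  using mult_left_mono[OF norm_W_div[OF assms], of "sqrt \<alpha>"] alpha_pos by (simp add: norm_a0_eq mult_ac)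

end

theorem theorem6p1:
  fixes D dD dN :: "(real ^ 'd) set"
    and e0 :: "real ^ 'd \<Rightarrow> real" and e :: "nat \<Rightarrow> real ^ 'd \<Rightarrow> real"
    and E :: "real ^ 'd \<Rightarrow> (nat \<Rightarrow> real) \<Rightarrow> real"
    and Emin Emax e0min e0max \<nu> \<alpha> CK CD \<gamma>1 \<gamma>2 \<gamma> C1 C2 C6 C7 \<eta>1 \<eta>2 \<eta> :: real
    and f :: "real ^ 'd \<Rightarrow> real ^ 'd"
    and Vh Vt :: "(real ^ 'd \<Rightarrow> real ^ 'd) set" and Wh Wt :: "(real ^ 'd \<Rightarrow> real) set"
    and \<Lambda> Q :: "(nat \<Rightarrow> nat) set"
    and u uh eu0 eustar ut uq :: "(nat \<Rightarrow> real) \<Rightarrow> real ^ 'd \<Rightarrow> real ^ 'd"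
    and p ph :: "(nat \<Rightarrow> real) \<Rightarrow> real ^ 'd \<Rightarrow> real"
    and R :: "((nat \<Rightarrow> real) \<Rightarrow> real ^ 'd \<Rightarrow> real ^ 'd) \<Rightarrow> real"
    and eu :: "(nat \<Rightarrow> real) \<Rightarrow> real ^ 'd \<Rightarrow> real ^ 'd"
    and ep :: "(nat \<Rightarrow> real) \<Rightarrow> real ^ 'd \<Rightarrow> real"
  assumes dim: "CARD('d) \<in> {2, 3}"
    and domain: "lipschitz_polyhedron D"
    and boundary: "frontier D = dD \<union> dN" "dD \<inter> dN = {}" "dD \<noteq> {}" "dN \<noteq> {}"
    and e_meas: "e0 \<in> borel_measurable (lebesgue_on D)"
      "\<And>k. e k \<in> borel_measurable (lebesgue_on D)"
    and E_def: "E = young e0 e"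
    and E_meas: "(\<lambda>(x, y). E x y) \<in> borel_measurable (lebesgue_on D \<Otimes>\<^sub>M param_measure)"
    and E_bounds: "0 < Emin"
      "AE (x, y) in lebesgue_on D \<Otimes>\<^sub>M param_measure. Emin \<le> E x y \<and> E x y \<le> Emax"
    and e0_bounds: "0 < e0min" "AE x in lebesgue_on D. e0min \<le> e0 x \<and> e0 x \<le> e0max"
    and e_decay: "ereal (1 / e0min) * (\<Sum>k. esssup (lebesgue_on D) (\<lambda>x. ereal \<bar>e k x\<bar>)) < 1"
    and nu: "\<nu> = 1 / 2" and alpha: "\<alpha> = 1 / (1 + \<nu>)"
    and f: "f \<in> l2_space D"
    and korn: "korn_const D dD CK"
    and inf_sup: "inf_sup_const D dD CD"
    and weak_solution: "stokes_solution D \<alpha> E f (space_V D dD) (space_W D) u p"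
    and Vh: "finite_dim_space Vh" "Vh \<subseteq> h1_E0 D dD"
    and Wh: "finite_dim_space Wh" "Wh \<subseteq> l2_space D"
    and Vh_Wh_stable: "discrete_inf_sup D Vh Wh"
    and Lambda: "finite \<Lambda>" "\<Lambda> \<subseteq> multi_indices"
    and galerkin: "stokes_solution D \<alpha> E f (tensor_space Vh (legendre_span \<Lambda>))
      (tensor_space Wh (legendre_span \<Lambda>)) uh ph"
    and residual: "R = residual_u D \<alpha> E f uh ph"
    and Vt: "finite_dim_space Vt" "Vt \<subseteq> h1_E0 D dD" "trivial_intersection D Vh Vt"
    and Wt: "finite_dim_space Wt" "Wt \<subseteq> l2_space D" "trivial_intersection D Wh Wt"
    and enriched_stable: "discrete_inf_sup D (sum_space Vh Vt) (sum_space Wh Wt)"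
    and cbs1: "0 \<le> \<gamma>1" "\<gamma>1 < 1"
      "\<forall>v\<in>Vh. \<forall>w\<in>Vt. \<bar>LINT x|lebesgue_on D. weak_grad D v x \<bullet> weak_grad D w x\<bar>
         \<le> \<gamma>1 * l2_norm D (weak_grad D v) * l2_norm D (weak_grad D w)"
    and cbs2: "0 \<le> \<gamma>2" "\<gamma>2 < 1"
      "\<forall>q\<in>Wh. \<forall>r\<in>Wt. \<bar>LINT x|lebesgue_on D. q x * r x\<bar> \<le> \<gamma>2 * l2_norm D q * l2_norm D r"
    and gamma: "\<gamma> = max \<gamma>1 \<gamma>2"
    and Q: "finite Q" "Q \<subseteq> multi_indices" "\<Lambda> \<inter> Q = {}"
    and eu0: "residual_solution D \<alpha> R (space_V D dD) eu0"
    and eustar: "residual_solution D \<alpha> R (enriched_V Vh Vt \<Lambda> Q) eustar"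
    and ut: "residual_solution D \<alpha> R (tensor_space Vt (legendre_span \<Lambda>)) ut"
    and uq: "residual_solution D \<alpha> R (tensor_space Vh (legendre_span Q)) uq"
    and eta1: "\<eta>1 = sqrt ((norm_a0 D \<alpha> ut)\<^sup>2 + (norm_a0 D \<alpha> uq)\<^sup>2)"
    and eta2: "\<eta>2 = sqrt \<alpha> * norm_W D (\<lambda>y. weak_div D (uh y))"
    and eta: "\<eta> = sqrt (\<eta>1\<^sup>2 + \<eta>2\<^sup>2)"
    and eu: "eu = (\<lambda>y x. u y x - uh y x)"
    and ep: "ep = (\<lambda>y x. p y x - ph y x)"
    and eu0_nz: "\<not> zero_field D eu0"
    and eustar_nz: "\<not> zero_field D eustar"
    and C1: "C1 = 1 / 2 * min CK (min (CD\<^sup>2 / Emax\<^sup>2) (1 / Emax\<^sup>2))"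
    and C2: "C2 = sqrt (2 * (Emax\<^sup>2 + CD\<^sup>2 + 1)) / Emax"
    and C6: "C6 = inverse (sqrt 2 * (Emax + sqrt (real CARD('d))))"
    and C7: "C7 = C2 / (C1 * Emin)"
  shows "(\<exists>\<Theta>\<in>{0..<1}. norm_a0 D \<alpha> eustar \<le> norm_a0 D \<alpha> eu0 \<and>
           norm_a0 D \<alpha> eu0 \<le> 1 / sqrt (1 - \<Theta>\<^sup>2) * norm_a0 D \<alpha> eustar) \<and>
         (\<forall>\<Theta>\<in>{0..<1}. norm_a0 D \<alpha> eustar \<le> norm_a0 D \<alpha> eu0 \<and>
           norm_a0 D \<alpha> eu0 \<le> 1 / sqrt (1 - \<Theta>\<^sup>2) * norm_a0 D \<alpha> eustar \<longrightarrow>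
         C6 * \<eta> \<le> norm_S D \<alpha> eu ep \<and>
         norm_S D \<alpha> eu ep \<le> C7 / (sqrt (1 - \<gamma>\<^sup>2) * sqrt (1 - \<Theta>\<^sup>2)) * \<eta>)"
proof -
  have D: "open D" "bounded D" "D \<noteq> {}"
    using domain by (auto simp: lipschitz_polyhedron_def lipschitz_domain_def)
  interpret bounded_open D by standard (fact D)+
  have alpha_pos: "0 < \<alpha>" using nu alpha by simp
  interpret sigma_finite_measure "lebesgue_on D" by (rule sigma_finite_D)
  interpret PP: pair_sigma_finite "lebesgue_on D" param_measure
    by unfold_locales
  \<comment> \<open>The a.e. statement on the product yields sections with x outermost, whereas the
    forms integrate over the parameter last. Exchanging the quantifiers relies on joint
    measurability of E.\<close>
  have E_AE: "AE y in param_measure. AE x in lebesgue_on D. Emin \<le> E x y \<and> E x y \<le> Emax"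
  proof -
    have "AE x in lebesgue_on D. AE y in param_measure. Emin \<le> E x y \<and> E x y \<le> Emax"
      using PP.AE_pair[OF E_bounds(2)] by simp
    moreover have "{z \<in> space (lebesgue_on D \<Otimes>\<^sub>M param_measure). Emin \<le> E (fst z) (snd z) \<and> E (fst z) (snd z) \<le> Emax}
      \<in> sets (lebesgue_on D \<Otimes>\<^sub>M param_measure)"
    proof -
      have [measurable]: "(\<lambda>z. E (fst z) (snd z)) \<in> borel_measurable (lebesgue_on D \<Otimes>\<^sub>M param_measure)"
        using E_meas by (simp add: case_prod_beta')
      show ?thesis by measurable
    qed
    then have "(AE x in lebesgue_on D. AE y in param_measure. Emin \<le> E x y \<and> E x y \<le> Emax) \<longleftrightarrow>
      (AE y in param_measure. AE x in lebesgue_on D. Emin \<le> E x y \<and> E x y \<le> Emax)"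
      by (rule PP.AE_commute)
    ultimately show ?thesis by (rule iffD1[rotated])
  qed
  interpret stokes_forms D dD \<alpha> Emin Emax "\<bar>e0max\<bar> + e0min" CK E
  proof
    show "AE x in lebesgue_on D. \<bar>E x y\<bar> \<le> \<bar>e0max\<bar> + e0min" if "y \<in> space param_measure" for y
      unfolding E_def using e0_bounds e_decay that by (rule young_bounded)
    show "CARD('d) \<ge> 2" using dim by auto
  qed (use alpha_pos E_meas E_AE E_bounds(1) e0_bounds(1) korn in auto)
  \<comment> \<open>Otherwise the bounds on E would be contradictory a.e., and D, a nonempty open
    set, would be a null set.\<close>
  have Emax: "Emin \<le> Emax"
  proof (rule ccontr)
    assume "\<not> Emin \<le> Emax"
    have "AE y in param_measure. AE x in lebesgue_on D. False"
      using E_AE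
    proof eventually_elim
      case (elim y)
      then show ?case by eventually_elim (use \<open>\<not> Emin \<le> Emax\<close> in linarith)
    qed
    then have "AE x in lebesgue_on D. False" by simp
    then have "emeasure (lebesgue_on D) (space (lebesgue_on D)) = 0"
      unfolding ae_filter_eq_bot_iff[symmetric] trivial_limit_def .
    then have "D \<in> null_sets lebesgue"
      using sets_D by (simp add: space_restrict_space emeasure_restrict_space null_sets_def)
    then show False using open_not_negligible[OF D(1,3)] by (simp add: negligible_iff_null_sets)
  qed
  have M: "0 < Emax" using Emax E_bounds(1) by simp
  have CD: "0 < CD" using inf_sup by (simp add: inf_sup_const_def)
  have CK: "0 < CK" using korn by (simp add: korn_const_def)
  have gam: "0 \<le> \<gamma>" "\<gamma> < 1" "\<gamma>1 \<le> \<gamma>" using cbs1(1,2) cbs2(1,2) gamma by auto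
  have mem: "u \<in> V" "p \<in> W" "uh \<in> V" "ph \<in> W" "eu0 \<in> V" "ut \<in> V" "uq \<in> V"
    using weak_solution galerkin eu0 ut uq
    by (auto simp: stokes_solution_def residual_solution_def
        intro: tensor_V[OF Vh(2)] tensor_V[OF Vt(2)] tensor_W[OF Wh(2)])
  have eu_V: "eu \<in> V" unfolding eu using mem(1,3) by (rule V_diff)
  have ep_W: "ep \<in> W" unfolding ep using mem(2,4) by (rule W_diff)
  have Rv: "R v = form_a D \<alpha> E eu v + form_b D v ep" if v: "v \<in> V" for v
  proof -
    have "load D f v = form_a D \<alpha> E u v + form_b D v p"
      using weak_solution v by (simp add: stokes_solution_def)
    then show ?thesis
      unfolding residual residual_u_def eu ep
      using form_a_diff_left[OF mem(1,3) v] form_b_diff_right[OF v mem(2,4)] by simp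
  qed
  \<comment> \<open>Additivity of the residual is read off from the error equation, whose forms are
    already known to be linear in v, and so the load is not treated separately.\<close>
  have R_add: "R (\<lambda>y x. v y x + w y x) = R v + R w" if "v \<in> V" "w \<in> V" for v w
  proof -
    note vw = V_add[OF that]
    show ?thesis
      using Rv[OF that(1)] Rv[OF that(2)] Rv[OF vw] form_b_add_left[OF that ep_W]
        form_a.F_sym[OF eu_V vw] form_a.F_add[OF that eu_V] form_a.F_sym[OF that(1) eu_V]
        form_a.F_sym[OF that(2) eu_V] by simp
  qed
  have b_eu: "form_b D eu q = - form_b D uh q" if "q \<in> W" for q
    using weak_solution form_b_diff_left[OF mem(1,3) that] that by (simp add: stokes_solution_def eu)
  define A where "A = norm_a0 D \<alpha> eu"
  define B where "B = sqrt (inverse \<alpha>) * norm_W D ep"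
  have AB: "0 \<le> A" "0 \<le> B" using alpha_pos by (simp_all add: A_def B_def norm_a0_pos norm_W_nonneg)
  have S: "norm_S D \<alpha> eu ep = sqrt (A\<^sup>2 + B\<^sup>2)" by (simp add: norm_S_eq A_def B_def)
  have eta_nonneg: "0 \<le> \<eta>1" "0 \<le> \<eta>2"
    using alpha_pos by (simp_all add: eta1 eta2 norm_W_nonneg)
  have eta1_sq: "\<eta>1\<^sup>2 = (norm_a0 D \<alpha> ut)\<^sup>2 + (norm_a0 D \<alpha> uq)\<^sup>2" by (simp add: eta1)

  have orth: "form_a0 D \<alpha> v w = 0"
    if "V1 \<subseteq> h1_E0 D dD" "v \<in> tensor_space V1 (legendre_span \<Lambda>)" "w \<in> tensor_space Vh (legendre_span Q)" for V1 v w
    using form_a0_tensor_orthogonal[OF that(1) Vh(2) Lambda(2) Q(2,3) that(2,3)] .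
  have ut_t: "ut \<in> tensor_space Vt (legendre_span \<Lambda>)" and uq_t: "uq \<in> tensor_space Vh (legendre_span Q)"
    using ut uq by (auto simp: residual_solution_def)

  \<comment> \<open>Efficiency\<close>
  have lower: "C6 * \<eta> \<le> norm_S D \<alpha> eu ep"
    unfolding C6 eta S
  proof (rule efficiency_arithmetic)
    let ?w = "\<lambda>y x. ut y x + uq y x"
    have w: "?w \<in> V" using mem(6,7) by (rule V_add)
    have "form_a0 D \<alpha> ?w ?w = form_a0 D \<alpha> ut ut + form_a0 D \<alpha> uq uq"
      using form_a0.F_quadratic[OF mem(6,7), of 1] orth[OF Vt(2) ut_t uq_t] by simp
    then have norm_w: "norm_a0 D \<alpha> ?w = \<eta>1" by (simp add: eta1 norm_a0_sq) (simp add: norm_a0_def)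
    have "\<eta>1\<^sup>2 = R ut + R uq"
      using ut uq ut_t uq_t by (simp add: eta1_sq norm_a0_sq residual_solution_def)
    also have "\<dots> = form_a D \<alpha> E eu ?w + form_b D ?w ep"
      using R_add[OF mem(6,7)] Rv[OF w] by simp
    also have "\<dots> \<le> Emax * (A * \<eta>1) + sqrt CARD('d) * \<eta>1 * B"
    proof (rule add_mono)
      show "form_a D \<alpha> E eu ?w \<le> Emax * (A * \<eta>1)"
        using form_a_bound[OF eu_V w] M by (simp add: A_def norm_w)
      have "form_b D ?w ep \<le> sqrt \<alpha> * norm_W D (\<lambda>y. weak_div D (?w y)) * B"
        using form_b_energy_bound[OF w ep_W] by (simp add: B_def)
      also have "\<dots> \<le> sqrt CARD('d) * \<eta>1 * B"
        using div_energy_bound[OF w] AB(2) unfolding norm_w by (intro mult_right_mono)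
      finally show "form_b D ?w ep \<le> sqrt CARD('d) * \<eta>1 * B" .
    qed
    finally have "\<eta>1 * \<eta>1 \<le> (Emax * A + sqrt CARD('d) * B) * \<eta>1"
      by (simp add: power2_eq_square algebra_simps)
    then show "\<eta>1 \<le> Emax * A + sqrt CARD('d) * B"
    proof (cases "\<eta>1 = 0")
      case False
      then have "0 < \<eta>1" using eta_nonneg by simp
      then show ?thesis using \<open>\<eta>1 * \<eta>1 \<le> _\<close> by (rule mult_right_le_imp_le[rotated])
    qed (use AB M in simp)
    \<comment> \<open>Testing the incompressibility constraint with the divergence of
      \<open>uh\<close> itself: b(u, q) = 0 gives b(eu, q) = - b(uh, q), the squared norm of q, so
      this norm is at most that of the divergence of \<open>eu\<close>.\<close>
    let ?q = "\<lambda>y. weak_div D (uh y)"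
    have qW: "?q \<in> W" using mem(3) by (rule div_mem_W)
    have "(norm_W D ?q)\<^sup>2 = form_b D eu ?q"
      using b_eu[OF qW] by (simp add: form_b_eq norm_W_eq inner_W_nonneg)
    also have "\<dots> \<le> norm_W D ?q * norm_W D (\<lambda>y. weak_div D (eu y))"
      using form_b_bound[OF eu_V qW] by simp
    finally have "norm_W D ?q * norm_W D ?q \<le> norm_W D (\<lambda>y. weak_div D (eu y)) * norm_W D ?q"
      by (simp add: power2_eq_square mult.commute)
    then have "norm_W D ?q \<le> norm_W D (\<lambda>y. weak_div D (eu y))"
    proof (cases "norm_W D ?q = 0")
      case False
      then have "0 < norm_W D ?q" using norm_W_nonneg[of D ?q] by simp
      then show ?thesis using \<open>norm_W D ?q * norm_W D ?q \<le> _\<close> by (rule mult_right_le_imp_le[rotated])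
    qed (simp add: norm_W_nonneg)
    then have "\<eta>2 \<le> sqrt \<alpha> * norm_W D (\<lambda>y. weak_div D (eu y))"
      unfolding eta2 using alpha_pos by (intro mult_left_mono) auto
    also have "\<dots> \<le> sqrt CARD('d) * A" unfolding A_def by (rule div_energy_bound[OF eu_V])
    finally show "\<eta>2 \<le> sqrt CARD('d) * A" .
  qed (use eta_nonneg AB M in simp_all)

  \<comment> \<open>The enriched residual solution and its components\<close>
  obtain v vt vq where eustar_eq: "eustar = (\<lambda>y x. v y x + vt y x + vq y x)"
    and v_t: "v \<in> tensor_space Vh (legendre_span \<Lambda>)" and vt_t: "vt \<in> tensor_space Vt (legendre_span \<Lambda>)"
    and vq_t: "vq \<in> tensor_space Vh (legendre_span Q)"
    using eustar by (auto simp: residual_solution_def enriched_V_def)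
  have vV: "v \<in> V" "vt \<in> V" "vq \<in> V"
    using v_t vt_t vq_t by (auto intro: tensor_V[OF Vh(2)] tensor_V[OF Vt(2)])
  note vvt = V_add[OF vV(1,2)]
  have eustar_V: "eustar \<in> V" unfolding eustar_eq using vvt vV(3) by (rule V_add)
  have eustar_R: "(norm_a0 D \<alpha> eustar)\<^sup>2 = R eustar"
    using eustar by (simp add: norm_a0_sq residual_solution_def)
  have R_eu0: "R v = form_a0 D \<alpha> eu0 v" if "v \<in> V" for v
    using eu0 that by (simp add: residual_solution_def)
  have star_pos: "0 < norm_a0 D \<alpha> eustar"
    using eustar_nz norm_a0_eq_0_imp_zero[OF eustar_V] norm_a0_pos[of eustar] by fastforce
  \<comment> \<open>\<open>eustar\<close> is the energy-orthogonal projection of \<open>eu0\<close>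
    onto the enriched space: its squared energy is R \<open>eustar\<close> = a0(\<open>eu0\<close>,
    \<open>eustar\<close>).\<close>
  have star_le: "norm_a0 D \<alpha> eustar \<le> norm_a0 D \<alpha> eu0"
  proof -
    have "norm_a0 D \<alpha> eustar * norm_a0 D \<alpha> eustar \<le> norm_a0 D \<alpha> eu0 * norm_a0 D \<alpha> eustar"
      using eustar_R R_eu0[OF eustar_V] form_a0_bound[OF mem(5) eustar_V] by (simp add: power2_eq_square)
    then show ?thesis using star_pos by (rule mult_right_le_imp_le)
  qed
  have star_eta: "norm_a0 D \<alpha> eustar \<le> \<eta>1 / sqrt (1 - \<gamma>\<^sup>2)"
  proof (rule cbs_arithmetic[where T = "form_a0 D \<alpha> vt vt + form_a0 D \<alpha> vq vq"])
    \<comment> \<open>The component \<open>vq\<close> is orthogonal to both \<open>v\<close> and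
      \<open>vt\<close> through its parameter indices, so the only mixed term left is that of
      \<open>v\<close> and \<open>vt\<close>, which the CBS inequality controls.\<close>
    have "form_a0 D \<alpha> eustar eustar =
      form_a0 D \<alpha> (\<lambda>y x. v y x + vt y x) (\<lambda>y x. v y x + vt y x) + form_a0 D \<alpha> vq vq"
      using form_a0.F_quadratic[OF vvt vV(3), of 1] form_a0.F_add[OF vV(1,2,3)]
        orth[OF Vh(2) v_t vq_t] orth[OF Vt(2) vt_t vq_t] by (simp add: eustar_eq)
    also have "form_a0 D \<alpha> (\<lambda>y x. v y x + vt y x) (\<lambda>y x. v y x + vt y x) =
      form_a0 D \<alpha> v v + 2 * form_a0 D \<alpha> v vt + form_a0 D \<alpha> vt vt"
      using form_a0.F_quadratic[OF vV(1,2), of 1] by simp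
    finally have eq: "form_a0 D \<alpha> eustar eustar =
      form_a0 D \<alpha> v v + 2 * form_a0 D \<alpha> v vt + form_a0 D \<alpha> vt vt + form_a0 D \<alpha> vq vq" .
    have g2: "\<gamma>1\<^sup>2 \<le> \<gamma>\<^sup>2" using gam cbs1(1) by (intro power_mono) auto
    have "(1 - \<gamma>\<^sup>2) * form_a0 D \<alpha> vt vt \<le> (1 - \<gamma>1\<^sup>2) * form_a0 D \<alpha> vt vt"
      using g2 by (intro mult_right_mono form_a0_nonneg) auto
    also have "\<dots> \<le> form_a0 D \<alpha> v v + 2 * form_a0 D \<alpha> v vt + form_a0 D \<alpha> vt vt"
      by (rule strengthened_cauchy_schwarz[OF Vh Vt(1,2) cbs1(3) v_t vt_t])
    finally have 1: "(1 - \<gamma>\<^sup>2) * form_a0 D \<alpha> vt vt \<le> form_a0 D \<alpha> v v + 2 * form_a0 D \<alpha> v vt + form_a0 D \<alpha> vt vt" .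
    have "(1 - \<gamma>\<^sup>2) * form_a0 D \<alpha> vq vq \<le> 1 * form_a0 D \<alpha> vq vq"
      by (intro mult_right_mono form_a0_nonneg) simp
    with 1 show "(1 - \<gamma>\<^sup>2) * (form_a0 D \<alpha> vt vt + form_a0 D \<alpha> vq vq) \<le> (norm_a0 D \<alpha> eustar)\<^sup>2"
      unfolding norm_a0_sq eq by (simp add: distrib_left)
    \<comment> \<open>Galerkin orthogonality: the residual vanishes on the original velocity space,
      so the component \<open>v\<close> of \<open>eustar\<close> drops out, and the other two are
      seen by \<open>ut\<close> and \<open>uq\<close>.\<close>
    have "form_a D \<alpha> E uh v + form_b D v ph = load D f v"
      using galerkin v_t by (simp add: stokes_solution_def)
    then have "R v = 0" by (simp add: residual residual_u_def)
    then have "R eustar = R vt + R vq"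
      unfolding eustar_eq using R_add[OF vvt vV(3)] R_add[OF vV(1,2)] by simp
    also have "\<dots> = form_a0 D \<alpha> ut vt + form_a0 D \<alpha> uq vq"
      using ut uq vt_t vq_t by (simp add: residual_solution_def)
    also have "\<dots> \<le> norm_a0 D \<alpha> ut * norm_a0 D \<alpha> vt + norm_a0 D \<alpha> uq * norm_a0 D \<alpha> vq"
      using form_a0_bound[OF mem(6) vV(2)] form_a0_bound[OF mem(7) vV(3)] by linarith
    also have "\<dots> \<le> \<eta>1 * sqrt (form_a0 D \<alpha> vt vt + form_a0 D \<alpha> vq vq)"
    proof -
      have "(norm_a0 D \<alpha> ut, norm_a0 D \<alpha> uq) \<bullet> (norm_a0 D \<alpha> vt, norm_a0 D \<alpha> vq) \<le>
        norm (norm_a0 D \<alpha> ut, norm_a0 D \<alpha> uq) * norm (norm_a0 D \<alpha> vt, norm_a0 D \<alpha> vq)"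
        by (rule norm_cauchy_schwarz)
      then show ?thesis by (simp add: norm_Pair eta1 norm_a0_sq)
    qed
    finally show "(norm_a0 D \<alpha> eustar)\<^sup>2 \<le> \<eta>1 * sqrt (form_a0 D \<alpha> vt vt + form_a0 D \<alpha> vq vq)"
      unfolding eustar_R .
  qed (use gam eta_nonneg norm_a0_pos form_a0_nonneg in auto)

  \<comment> \<open>Reliability\<close>
  have stab: "norm_S D \<alpha> eu ep \<le> C7 * sqrt ((norm_a0 D \<alpha> eu0)\<^sup>2 + \<eta>2\<^sup>2)"
    unfolding S C7 C1 C2
  proof (rule stability_arithmetic)
    fix b assume b: "0 < b" "b < CD"
    show "1 / 2 * Emin * min CK (b\<^sup>2 / Emax\<^sup>2) * (A\<^sup>2 + B\<^sup>2) \<le> norm_a0 D \<alpha> eu0 * (A + b / Emax * B) + \<eta>2 * B"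
      unfolding A_def B_def
    proof (rule stability_bound[OF inf_sup eu_V ep_W b Emax])
      show "form_a D \<alpha> E eu v + form_b D v ep \<le> norm_a0 D \<alpha> eu0 * norm_a0 D \<alpha> v" if "v \<in> V" for v
        using Rv[OF that] R_eu0[OF that] form_a0_bound[OF mem(5) that] by simp
      \<comment> \<open>As u satisfies the constraint, b(eu, ep) = - b(uh, ep), and this involves
        only the divergence of \<open>uh\<close>, which is what the second estimator
        measures.\<close>
      show "\<bar>form_b D eu ep\<bar> \<le> \<eta>2 * (sqrt (inverse \<alpha>) * norm_W D ep)"
        using form_b_energy_bound[OF mem(3) ep_W] b_eu[OF ep_W] by (simp add: eta2)
    qed (rule norm_a0_pos)
  qed (use AB eta_nonneg norm_a0_pos E_bounds(1) M CK CD in auto)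

  have upper: "norm_S D \<alpha> eu ep \<le> C7 / (sqrt (1 - \<gamma>\<^sup>2) * sqrt (1 - \<Theta>\<^sup>2)) * \<eta>"
    if \<Theta>: "\<Theta> \<in> {0..<1}" and sat: "norm_a0 D \<alpha> eu0 \<le> 1 / sqrt (1 - \<Theta>\<^sup>2) * norm_a0 D \<alpha> eustar" for \<Theta>
  proof -
    \<comment> \<open>The factor k arises for the first estimator alone, from saturation and CBS.
      Since k \<ge> 1, the second one may be enlarged by it too, and k can be pulled out of the
      Euclidean norm.\<close>
    define k where "k = 1 / (sqrt (1 - \<gamma>\<^sup>2) * sqrt (1 - \<Theta>\<^sup>2))"
    have s: "0 < sqrt (1 - x\<^sup>2)" "sqrt (1 - x\<^sup>2) \<le> 1" if "0 \<le> x" "x < 1" for x :: real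
      using that by (auto simp: power_less_one_iff)
    have "0 \<le> \<Theta>" "\<Theta> < 1" using \<Theta> by auto
    note sg = s[OF gam(1,2)] and st = s[OF this]
    have "sqrt (1 - \<gamma>\<^sup>2) * sqrt (1 - \<Theta>\<^sup>2) \<le> 1 * 1" using sg st by (intro mult_mono) auto
    then have k: "1 \<le> k" using sg st by (simp add: k_def)
    have "norm_a0 D \<alpha> eu0 \<le> 1 / sqrt (1 - \<Theta>\<^sup>2) * (\<eta>1 / sqrt (1 - \<gamma>\<^sup>2))"
      using sat mult_left_mono[OF star_eta, of "1 / sqrt (1 - \<Theta>\<^sup>2)"] st by simp
    then have "norm_a0 D \<alpha> eu0 \<le> k * \<eta>1" by (simp add: k_def mult.commute)
    moreover have "\<eta>2 \<le> k * \<eta>2" using mult_right_mono[OF k eta_nonneg(2)] by simp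
    ultimately have "(norm_a0 D \<alpha> eu0)\<^sup>2 + \<eta>2\<^sup>2 \<le> (k * \<eta>1)\<^sup>2 + (k * \<eta>2)\<^sup>2"
      using eta_nonneg by (intro add_mono power_mono norm_a0_pos)
    also have "\<dots> = k\<^sup>2 * (\<eta>1\<^sup>2 + \<eta>2\<^sup>2)" by (simp add: power_mult_distrib distrib_left)
    finally have "sqrt ((norm_a0 D \<alpha> eu0)\<^sup>2 + \<eta>2\<^sup>2) \<le> sqrt (k\<^sup>2 * (\<eta>1\<^sup>2 + \<eta>2\<^sup>2))" by (rule real_sqrt_le_mono)
    also have "\<dots> = k * \<eta>" using k by (simp add: real_sqrt_mult eta)
    finally have le: "sqrt ((norm_a0 D \<alpha> eu0)\<^sup>2 + \<eta>2\<^sup>2) \<le> k * \<eta>" .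
    have "0 \<le> C7"
      unfolding C7 C1 C2 using M CK CD E_bounds(1)
      by (intro divide_nonneg_nonneg mult_nonneg_nonneg real_sqrt_ge_zero) auto
    then have "C7 * sqrt ((norm_a0 D \<alpha> eu0)\<^sup>2 + \<eta>2\<^sup>2) \<le> C7 * (k * \<eta>)" using le by (intro mult_left_mono)
    with stab show ?thesis by (simp add: k_def)
  qed
  show ?thesis
    using saturation_exists[OF star_pos star_le] lower upper by blast
qed

end
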